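(* Let $V$ be the ball of radius $R_1>0$ centred at the origin, filled with a lossy dielectric of permittivity $\epsilon_1$ (with $\epsilon_1'=\Re\{\epsilon_1\}$), permeability $\mu_0$, and wave number $k_1=\omega\sqrt{\mu_0\epsilon_1}=k_1'+ik_1''$ with $k_1',k_1''>0$, surrounded by free space of wave number $k_0=\omega\sqrt{\mu_0\epsilon_0}$. For $n\ge1$, $-n\le m\le n$, $l\in\{1,2\}$, let $\mathbf E_{nml},\mathbf H_{nml}$ be the electric and magnetic fields generated by the current density $\mathbf v^\star_{nml}$ in $V$, and let $$W^{e,in}_{nml}=\frac{\epsilon_1'}4\int_{0<r<R_1}\|\mathbf E_{nml}(\mathbf r)\|^2d\mathbf r,\qquad W^{m,in}_{nml}=\frac{\mu_0}4\int_{0<r<R_1}\|\mathbf H_{nml}(\mathbf r)\|^2d\mathbf r$$ be the electric and magnetic energies stored in $V$. Then, with the quantities $I_{n,l}^{jj},I_{n,l}^{jj^*},\mathcal F_{n,l}$ defined in the context, $$W^{e,in}_{nml}=\frac{\epsilon_1'}4\omega^2\mu_0^2\left(|\mathcal F_{n,l}|^2+\Big(\frac1{4k_1'k_1''}\Big)^2+\frac{\Re\{\mathcal F_{n,l}I_{n,l}^{jj}\}}{2k_1'k_1''I_{n,l}^{jj^*}}\right),$$ $$W^{m,in}_{nml}=\frac{\mu_0}4\left(\Big[|k_1\mathcal F_{n,l}|^2+\Big|\frac{k_1}{4k_1'k_1''}\Big|^2\Big]\frac{I_{n,3-l}^{jj^*}}{I_{n,l}^{jj^*}}+\frac{\Re\{k_1^2\mathcal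 F_{n,l}I_{n,3-l}^{jj}\}}{2k_1'k_1''I_{n,l}^{jj^*}}\right).$$
   Context: **Conventions.** Time dependence $e^{-i\omega t}$, $\omega,\mu_0,\epsilon_0>0$. ${}^*$ is complex conjugation, ${}^H$ conjugate transpose. $j_n,y_n,h_n^{(1)}=j_n+iy_n$ are the spherical Bessel functions of the first, second and third kind; $Y_{nm}$ are orthonormal spherical harmonics; $r=\|\mathbf r\|$, $\hat{\mathbf r}=\mathbf r/r$. **Waves.** $\mathbf U_{nm1}(k,\mathbf r)=\nabla\times \mathbf r h_n^{(1)}(kr)Y_{nm}$, $\mathbf V_{nm1}(k,\mathbf r)=\nabla\times\mathbf r j_n(kr)Y_{nm}$, $\mathbf U_{nm2}=\frac1k\nabla\times\mathbf U_{nm1}$, $\mathbf V_{nm2}=\frac1k\nabla\times\mathbf V_{nm1}$; conjugate waves $\mathbf U^\star_{nm1}=\nabla\times\mathbf r h_n^{(1)}(kr)^*Y_{nm}$, $\mathbf V^\star_{nm1}=\nabla\times\mathbf r j_n(kr)^*Y_{nm}$, $\mathbf U^\star_{nm2}=\frac1{k^*}\nabla\times\mathbf U^\star_{nm1}$, $\mathbf V^\star_{nm2}=\frac1{k^*}\nabla\times\mathbf V^\star_{nm1}$. The normalized source is $\mathbf v^\star_{nml}=\mathbf V^\star_{nml}(k_1,\cdot)/\big(\int_V\|\mathbf V^\star_{nml}(k_1,\mathbf r)\|^2d\mathbf r\big)^{1/2}$. **Scattering coefficients.** With $\mathcal C=k_1/k_0$, $z=k_0R_1$, $\hat J_n(\rho)=\rho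 j_n(\rho)$, $\hat H_n(\rho)=\rho h_n^{(1)}(\rho)$: $$\mathcal R_{n,1}=\frac{\mathcal C\hat H_n(z)\hat H_n'(\mathcal Cz)-\hat H_n'(z)\hat H_n(\mathcal Cz)}{\hat J_n(\mathcal Cz)\hat H_n'(z)-\mathcal C\hat J_n'(\mathcal Cz)\hat H_n(z)},\qquad \mathcal R_{n,2}=\frac{\hat H_n(z)\hat H_n'(\mathcal Cz)-\mathcal C\hat H_n'(z)\hat H_n(\mathcal Cz)}{\mathcal C\hat J_n(\mathcal Cz)\hat H_n'(z)-\hat J_n'(\mathcal Cz)\hat H_n(z)}.$$ **Fields.** For a current $\mathbf J$ in $V$, $\mathbf E(\mathbf r)=i\omega\mu_0\int_V\overline{\mathbf G}(\mathbf r,\mathbf r')\mathbf J(\mathbf r')d\mathbf r'$ and $\mathbf H=\nabla\times\mathbf E/(i\omega\mu_0)$, where for $\mathbf r,\mathbf r'\in V$ the dyadic Green function is $$\overline{\mathbf G}(\mathbf r,\mathbf r')=ik_1\sum_{n,l}\frac1{n(n+1)}\overline{\mathbf g}_{nl}(\mathbf r,\mathbf r')-\frac{\hat{\mathbf r}\hat{\mathbf r}^T}{k_1^2}\delta(\mathbf r-\mathbf r'),$$ with $\overline{\mathbf g}_{nl}=\sum_m[\mathbf U_{nml}(k_1,\mathbf r)+\mathcal R_{n,l}\mathbf V_{nml}(k_1,\mathbf r)]\mathbf V^\star_{nml}(k_1,\mathbf r')^H$ if $r\ge r'$ and $\overline{\mathbf g}_{nl}=\sum_m\mathbf V_{nml}(k_1,\mathbf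 r)[\mathbf U^\star_{nml}(k_1,\mathbf r')^H+\mathcal R_{n,l}\mathbf V^\star_{nml}(k_1,\mathbf r')^H]$ if $r\le r'$. **Coefficients.** $I_{n,1}^{jj}=\int_0^{R_1}j_n(k_1r)^2r^2dr$, $I_{n,1}^{jj^*}=\int_0^{R_1}|j_n(k_1r)|^2r^2dr$, $I_{n,1}^{yj^*}=\int_0^{R_1}y_n(k_1r)j_n(k_1r)^*r^2dr$, and for each superscript $I_{n,2}=\frac{n+1}{2n+1}I_{n-1,1}+\frac n{2n+1}I_{n+1,1}$. Further $\mathcal D_{n,l}=k_1[(1+\mathcal R_{n,l})I_{n,l}^{jj^*}+iI_{n,l}^{yj^*}]$, $\mathcal E_{n,1}=k_1^{-n}(k_1^* )^n$, $\mathcal E_{n,2}=\frac{n+1}{2n+1}\mathcal E_{n-1,1}+\frac n{2n+1}\mathcal E_{n+1,1}$, and $\mathcal F_{n,l}=\mathcal D_{n,l}-\mathcal E_{n,l}/(4k_1'k_1'')$. *)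

theory Defs
  imports "HOL-Analysis.Analysis"
begin

section \<open>Vector calculus on three-dimensional space\<close>

definition partial :: "3 \<Rightarrow> (real^3 \<Rightarrow> 'b::real_normed_vector) \<Rightarrow> real^3 \<Rightarrow> 'b" where
  "partial i f x = vector_derivative (\<lambda>t. f (x + t *\<^sub>R axis i 1)) (at 0)"

definition curl :: "(real^3 \<Rightarrow> complex^3) \<Rightarrow> real^3 \<Rightarrow> complex^3" where
  "curl F x = vector
     [partial 2 (\<lambda>y. F y $ 3) x - partial 3 (\<lambda>y. F y $ 2) x,
      partial 3 (\<lambda>y. F y $ 1) x - partial 1 (\<lambda>y. F y $ 3) x,
      partial 1 (\<lambda>y. F y $ 2) x - partial 2 (\<lambda>y. F y $ 1) x]"

definition laplacian :: "(real^3 \<Rightarrow> complex) \<Rightarrow> real^3 \<Rightarrow> complex" where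
  "laplacian f x = (\<Sum>i\<in>UNIV. partial i (partial i f) x)"

definition cvec :: "real^3 \<Rightarrow> complex^3" where
  "cvec x = (\<chi> i. complex_of_real (x $ i))"

text \<open>The dyad \<open>a b\<^sup>H\<close>.\<close>

definition dyad :: "complex^3 \<Rightarrow> complex^3 \<Rightarrow> complex^3^3" where
  "dyad a b = (\<chi> i j. a $ i * cnj (b $ j))"

section \<open>Spherical Bessel functions\<close>

text \<open>Rayleigh's formulas, with \<open>rayleigh\<close> the operator \<open>- (1/z) d/dz\<close>. The value at \<open>0\<close> is
  arbitrary and is never used except on null sets.\<close>

definition rayleigh :: "(complex \<Rightarrow> complex) \<Rightarrow> complex \<Rightarrow> complex" where
  "rayleigh f z = - (deriv f z / z)"

definition sph_j :: "nat \<Rightarrow> complex \<Rightarrow> complex" where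
  "sph_j n z = z ^ n * (rayleigh ^^ n) (\<lambda>w. sin w / w) z"

definition sph_y :: "nat \<Rightarrow> complex \<Rightarrow> complex" where
  "sph_y n z = - (z ^ n * (rayleigh ^^ n) (\<lambda>w. cos w / w) z)"

definition sph_h :: "nat \<Rightarrow> complex \<Rightarrow> complex" where
  "sph_h n z = sph_j n z + \<i> * sph_y n z"

definition J_hat :: "nat \<Rightarrow> complex \<Rightarrow> complex" where
  "J_hat n \<rho> = \<rho> * sph_j n \<rho>"

definition H_hat :: "nat \<Rightarrow> complex \<Rightarrow> complex" where
  "H_hat n \<rho> = \<rho> * sph_h n \<rho>"

section \<open>Orthonormal spherical harmonics\<close>

text \<open>Surface measure on the unit sphere, as the cone measure
  \<open>\<sigma>(A) = 3 vol {s u | 0 < s < 1, u \<in> A}\<close>, which has total mass \<open>4\<pi>\<close>.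
  Note \<open>sgn x = x / norm x\<close>.\<close>

definition sphere_integral :: "(real^3 \<Rightarrow> complex) \<Rightarrow> complex" where
  "sphere_integral f = 3 * (LINT x:ball 0 1|lborel. f (sgn x))"

definition spherical_harmonic :: "nat \<Rightarrow> (real^3 \<Rightarrow> complex) \<Rightarrow> bool" where
  "spherical_harmonic n S \<longleftrightarrow>
     (\<exists>p. polynomial_function p \<and>
          (\<forall>c x. p (c *\<^sub>R x) = complex_of_real (c ^ n) * p x) \<and>
          (\<forall>x. laplacian p x = 0) \<and>
          (\<forall>x\<in>sphere 0 1. S x = p x))"

text \<open>No phase or basis convention is fixed: \<open>Y n m\<close> (for \<open>-n \<le> m \<le> n\<close>) may be any orthonormal
  system of spherical harmonics of degree \<open>n\<close>. Only values on the unit sphere matter.\<close>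

definition orthonormal_spherical_harmonics :: "(nat \<Rightarrow> int \<Rightarrow> real^3 \<Rightarrow> complex) \<Rightarrow> bool" where
  "orthonormal_spherical_harmonics Y \<longleftrightarrow>
     (\<forall>n. \<forall>m\<in>{- int n..int n}. spherical_harmonic n (Y n m)) \<and>
     (\<forall>n n'. \<forall>m\<in>{- int n..int n}. \<forall>m'\<in>{- int n'..int n'}.
        sphere_integral (\<lambda>x. Y n m x * cnj (Y n' m' x)) = (if n = n' \<and> m = m' then 1 else 0))"

section \<open>Vector spherical waves\<close>

text \<open>The wave with radial function \<open>f\<close> and angular function \<open>S\<close>; \<open>k\<close> only enters as the
  normalisation \<open>1/k\<close> for \<open>l = 2\<close>. The index \<open>l\<close> ranges over \<open>{1, 2}\<close> throughout.\<close>

definition wave ::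
  "complex \<Rightarrow> (real \<Rightarrow> complex) \<Rightarrow> (real^3 \<Rightarrow> complex) \<Rightarrow> nat \<Rightarrow> real^3 \<Rightarrow> complex^3" where
  "wave k f S l =
     (let W = curl (\<lambda>x. (f (norm x) * S (sgn x)) *s cvec x)
      in if l = 1 then W else (\<lambda>x. (1 / k) *s curl W x))"

context
  fixes Y :: "nat \<Rightarrow> int \<Rightarrow> real^3 \<Rightarrow> complex"
begin

definition U_wave :: "nat \<Rightarrow> int \<Rightarrow> nat \<Rightarrow> complex \<Rightarrow> real^3 \<Rightarrow> complex^3" where
  "U_wave n m l k = wave k (\<lambda>r. sph_h n (k * of_real r)) (Y n m) l"

definition V_wave :: "nat \<Rightarrow> int \<Rightarrow> nat \<Rightarrow> complex \<Rightarrow> real^3 \<Rightarrow> complex^3" where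
  "V_wave n m l k = wave k (\<lambda>r. sph_j n (k * of_real r)) (Y n m) l"

definition U_star :: "nat \<Rightarrow> int \<Rightarrow> nat \<Rightarrow> complex \<Rightarrow> real^3 \<Rightarrow> complex^3" where
  "U_star n m l k = wave (cnj k) (\<lambda>r. cnj (sph_h n (k * of_real r))) (Y n m) l"

definition V_star :: "nat \<Rightarrow> int \<Rightarrow> nat \<Rightarrow> complex \<Rightarrow> real^3 \<Rightarrow> complex^3" where
  "V_star n m l k = wave (cnj k) (\<lambda>r. cnj (sph_j n (k * of_real r))) (Y n m) l"

definition v_star :: "complex \<Rightarrow> real \<Rightarrow> nat \<Rightarrow> int \<Rightarrow> nat \<Rightarrow> real^3 \<Rightarrow> complex^3" where
  "v_star k1 R1 n m l x =
     V_star n m l k1 x /\<^sub>R sqrt (LINT y:ball 0 R1|lborel. (norm (V_star n m l k1 y))\<^sup>2)"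

end

section \<open>Scattering coefficients\<close>

definition scat :: "real \<Rightarrow> complex \<Rightarrow> real \<Rightarrow> nat \<Rightarrow> nat \<Rightarrow> complex" where
  "scat k0 k1 R1 n l =
     (let C = k1 / of_real k0; z = complex_of_real (k0 * R1);
          J = J_hat n; H = H_hat n; J' = deriv (J_hat n); H' = deriv (H_hat n)
      in if l = 1
         then (C * H z * H' (C * z) - H' z * H (C * z)) / (J (C * z) * H' z - C * J' (C * z) * H z)
         else (H z * H' (C * z) - C * H' z * H (C * z)) / (C * J (C * z) * H' z - J' (C * z) * H z))"

section \<open>Fields generated by a current in the ball\<close>

definition g_dyadic ::
  "(nat \<Rightarrow> int \<Rightarrow> real^3 \<Rightarrow> complex) \<Rightarrow> real \<Rightarrow> complex \<Rightarrow> real \<Rightarrow> nat \<Rightarrow> nat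
     \<Rightarrow> real^3 \<Rightarrow> real^3 \<Rightarrow> complex^3^3" where
  "g_dyadic Y k0 k1 R1 n l r r' =
     (\<Sum>m\<in>{- int n..int n}.
        if norm r \<ge> norm r'
        then dyad (U_wave Y n m l k1 r + scat k0 k1 R1 n l *s V_wave Y n m l k1 r)
                  (V_star Y n m l k1 r')
        else dyad (V_wave Y n m l k1 r) (U_star Y n m l k1 r')
             + dyad (scat k0 k1 R1 n l *s V_wave Y n m l k1 r) (V_star Y n m l k1 r'))"

text \<open>\<open>\<integral>\<^sub>V G(r,r') J(r') dr'\<close> for \<open>r\<close> in \<open>V = ball 0 R1\<close>. The dyadic Green function is a
  distribution: its mode expansion is integrated term by term, and its delta part evaluates \<open>J\<close>
  at \<open>r\<close>. The modes are \<open>n = 1, 2, \<dots>\<close>, written \<open>n = Suc i\<close>.\<close>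

definition green_apply ::
  "(nat \<Rightarrow> int \<Rightarrow> real^3 \<Rightarrow> complex) \<Rightarrow> real \<Rightarrow> complex \<Rightarrow> real
     \<Rightarrow> (real^3 \<Rightarrow> complex^3) \<Rightarrow> real^3 \<Rightarrow> complex^3" where
  "green_apply Y k0 k1 R1 J r =
     (\<i> * k1) *s (\<Sum>i. let n = Suc i in
        \<Sum>l\<in>{1, 2}. (1 / (of_nat n * (of_nat n + 1))) *s
          (LINT r':ball 0 R1|lborel. g_dyadic Y k0 k1 R1 n l r r' *v J r'))
     - (1 / k1\<^sup>2) *s (dyad (cvec (sgn r)) (cvec (sgn r)) *v J r)"

definition E_field ::
  "(nat \<Rightarrow> int \<Rightarrow> real^3 \<Rightarrow> complex) \<Rightarrow> real \<Rightarrow> real \<Rightarrow> real \<Rightarrow> complex \<Rightarrow> real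
     \<Rightarrow> (real^3 \<Rightarrow> complex^3) \<Rightarrow> real^3 \<Rightarrow> complex^3" where
  "E_field Y \<omega> \<mu>0 k0 k1 R1 J r = (\<i> * of_real \<omega> * of_real \<mu>0) *s green_apply Y k0 k1 R1 J r"

definition H_field ::
  "(nat \<Rightarrow> int \<Rightarrow> real^3 \<Rightarrow> complex) \<Rightarrow> real \<Rightarrow> real \<Rightarrow> real \<Rightarrow> complex \<Rightarrow> real
     \<Rightarrow> (real^3 \<Rightarrow> complex^3) \<Rightarrow> real^3 \<Rightarrow> complex^3" where
  "H_field Y \<omega> \<mu>0 k0 k1 R1 J r =
     (1 / (\<i> * of_real \<omega> * of_real \<mu>0)) *s curl (E_field Y \<omega> \<mu>0 k0 k1 R1 J) r"

section \<open>Coefficients\<close>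

definition l_extend :: "(nat \<Rightarrow> 'a::real_field) \<Rightarrow> nat \<Rightarrow> nat \<Rightarrow> 'a" where
  "l_extend f n l =
     (if l = 1 then f n
      else (of_nat n + 1) / (2 * of_nat n + 1) * f (n - 1) + of_nat n / (2 * of_nat n + 1) * f (n + 1))"

definition I_jj :: "complex \<Rightarrow> real \<Rightarrow> nat \<Rightarrow> nat \<Rightarrow> complex" where
  "I_jj k1 R1 = l_extend (\<lambda>n.
     LINT r:{0..R1}|lborel. (sph_j n (k1 * of_real r))\<^sup>2 * of_real (r\<^sup>2))"

definition I_jjs :: "complex \<Rightarrow> real \<Rightarrow> nat \<Rightarrow> nat \<Rightarrow> real" where
  "I_jjs k1 R1 = l_extend (\<lambda>n.
     LINT r:{0..R1}|lborel. (cmod (sph_j n (k1 * of_real r)))\<^sup>2 * r\<^sup>2)"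

definition I_yjs :: "complex \<Rightarrow> real \<Rightarrow> nat \<Rightarrow> nat \<Rightarrow> complex" where
  "I_yjs k1 R1 = l_extend (\<lambda>n.
     LINT r:{0..R1}|lborel.
       sph_y n (k1 * of_real r) * cnj (sph_j n (k1 * of_real r)) * of_real (r\<^sup>2))"

definition D_coeff :: "real \<Rightarrow> complex \<Rightarrow> real \<Rightarrow> nat \<Rightarrow> nat \<Rightarrow> complex" where
  "D_coeff k0 k1 R1 n l =
     k1 * ((1 + scat k0 k1 R1 n l) * of_real (I_jjs k1 R1 n l) + \<i> * I_yjs k1 R1 n l)"

definition E_coeff :: "complex \<Rightarrow> nat \<Rightarrow> nat \<Rightarrow> complex" where
  "E_coeff k1 = l_extend (\<lambda>n. k1 powi (- int n) * cnj k1 ^ n)"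

definition F_coeff :: "real \<Rightarrow> complex \<Rightarrow> real \<Rightarrow> nat \<Rightarrow> nat \<Rightarrow> complex" where
  "F_coeff k0 k1 R1 n l =
     D_coeff k0 k1 R1 n l - E_coeff k1 n l / of_real (4 * Re k1 * Im k1)"

end

theory Submission
  imports Defs "HOL-Complex_Analysis.Cauchy_Integral_Formula"
begin

text \<open>Away from the origin every wave of degree \<open>n\<close> is a combination, with coefficients depending only
  on \<open>r\<close>, of the vector fields \<open>\<nabla>p \<times> x\<close>, \<open>\<nabla>p\<close> and \<open>p x\<close>, where \<open>p\<close> is the harmonic homogeneous
  polynomial extending the spherical harmonic.  The divergence theorem for homogeneous polynomial fields
  reduces the pairings of these fields over the sphere to those of the polynomials \<open>p\<close>.  By orthogonality
  only the mode of the source survives in the Green function, and what remains are radial integrals of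
  products of solutions of the radial equation for \<open>k\<^sub>1\<close> and for its conjugate.  Such integrals have an
  explicit primitive (Lommel), and the Wronskian of \<open>j\<^sub>n\<close> and \<open>y\<^sub>n\<close> turns the bilinear combination
  of primitives and waves that occurs in the field into the conjugate wave.  For \<open>l = 2\<close> the delta part of the Green
  function supplies precisely what is missing in the radial component.  Hence the electric field is
  proportional to \<open>i F V + i V\<^sup>\<star> / (4 k\<^sub>1' k\<^sub>1'')\<close>, where the term \<open>E_coeff\<close> in \<open>F\<close> is the boundary
  value at the origin of Lommel's primitive for \<open>y\<^sub>n\<close>.  The curl exchanges \<open>l = 1\<close> and \<open>l = 2\<close>, and
  expanding the squares gives the two energies.\<close>

section \<open>Iterates of Rayleigh's operator\<close>

text \<open>The Green function changes form at the radius r of the field point, so the source is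
  integrated over two regions. With j, y the radial functions at r, L_J, L_Y Lommel's primitives
  against conj(j) and s the scattering coefficient, the amplitude becomes, up to a factor, ((1 + s)
  L_J(R) + i L_Y(R)) j + i (L_J(r) y - L_Y(r) j). The first bracket holds all the boundary data and
  is F up to a factor. In the second, inserting the primitives leaves conj(j) times the Wronskian of
  j and y. The constant 4 k1' k1'' is (k1^2 - conj(k1)^2) / i, the denominator in Lommel's
  primitives, and it is nonzero because the medium is lossy. The obstacle is the origin: Rayleigh's
  formulas give arbitrary values there and y_n is singular, so entire companions of both families
  are built first. A radial function f is then replaced by the pair of f / r^n and (r f)' / r^n.
  Such pairs obey a first-order linear system that is stable under superposition and conjugation,
  and the curl acts on them directly, with polynomials in place of functions of the
  direction.\<close>

lemma open_punctured [simp]: "open (- {0 :: complex})"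
  by (simp add: open_Compl)

lemma rayleigh_funpow_holomorphic:
  assumes "f holomorphic_on - {0}"
  shows "(rayleigh ^^ n) f holomorphic_on - {0}"
proof (induction n)
  case (Suc n)
  have "(\<lambda>z. - (deriv ((rayleigh ^^ n) f) z / z)) holomorphic_on - {0}"
    using Suc by (intro holomorphic_intros holomorphic_deriv) auto
  then show ?case
    by (simp add: rayleigh_def[abs_def])
qed (use assms in simp)

lemma rayleigh_funpow_has_derivative:
  assumes "f holomorphic_on - {0}" "z \<noteq> 0"
  shows "((rayleigh ^^ n) f has_field_derivative - (z * (rayleigh ^^ Suc n) f z)) (at z)"
proof -
  have "((rayleigh ^^ n) f has_field_derivative deriv ((rayleigh ^^ n) f) z) (at z)"
    by (rule holomorphic_derivI[OF rayleigh_funpow_holomorphic[OF assms(1)]]) (use assms in auto)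
  moreover have "deriv ((rayleigh ^^ n) f) z = - (z * (rayleigh ^^ Suc n) f z)"
    using assms(2) by (simp add: rayleigh_def)
  ultimately show ?thesis by simp
qed

text \<open>Differentiating the identity for \<open>n\<close> and dividing by \<open>- z\<close>
  gives the one for \<open>n + 1\<close>; the derivative of z^2 raises the coefficient by 2. In
  terms of z^n times the iterates this is the three-term recurrence of the spherical Bessel
  functions.\<close>

lemma rayleigh_funpow_recurrence:
  assumes "f holomorphic_on - {0}"
    and "\<And>z. z \<noteq> 0 \<Longrightarrow> f z = 3 * rayleigh f z - z\<^sup>2 * (rayleigh ^^ 2) f z"
    and "z \<noteq> 0"
  shows "(rayleigh ^^ n) f z =
           of_nat (2 * n + 3) * (rayleigh ^^ Suc n) f z - z\<^sup>2 * (rayleigh ^^ Suc (Suc n)) f z"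
  using assms(3)
proof (induction n arbitrary: z)
  case 0
  then show ?case using assms(2)[OF 0] by (simp add: numeral_2_eq_2)
next
  case (Suc n)
  let ?r = "\<lambda>n. (rayleigh ^^ n) f"
  have D: "(?r m has_field_derivative - (w * ?r (Suc m) w)) (at w)" if "w \<noteq> 0" for m w
    by (rule rayleigh_funpow_has_derivative[OF assms(1) that])
  have "((\<lambda>w. of_nat (2 * n + 3) * ?r (Suc n) w - w\<^sup>2 * ?r (Suc (Suc n)) w) has_field_derivative
      of_nat (2 * n + 3) * (- (z * ?r (Suc (Suc n)) z))
      - (2 * z * ?r (Suc (Suc n)) z + z\<^sup>2 * (- (z * ?r (Suc (Suc (Suc n))) z)))) (at z)"
    by (rule derivative_eq_intros D[OF Suc.prems] refl)+ simp
  moreover have "\<forall>\<^sub>F w in nhds z. of_nat (2 * n + 3) * ?r (Suc n) w - w\<^sup>2 * ?r (Suc (Suc n)) w = ?r n w"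
  proof -
    have "\<forall>\<^sub>F w in nhds z. w \<in> - {0}"
      using Suc.prems by (intro eventually_nhds_in_open) auto
    then show ?thesis
      by eventually_elim (use Suc.IH in \<open>auto simp del: funpow.simps\<close>)
  qed
  ultimately have "(?r n has_field_derivative
      of_nat (2 * n + 3) * (- (z * ?r (Suc (Suc n)) z))
      - (2 * z * ?r (Suc (Suc n)) z + z\<^sup>2 * (- (z * ?r (Suc (Suc (Suc n))) z)))) (at z)"
    by (subst (asm) DERIV_cong_ev[OF refl _ refl]) auto
  from DERIV_unique[OF this D[OF Suc.prems]]
  have "z * ?r (Suc n) z = z * (of_nat (2 * n + 5) * ?r (Suc (Suc n)) z - z\<^sup>2 * ?r (Suc (Suc (Suc n))) z)"
    by (simp del: funpow.simps add: algebra_simps power2_eq_square)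
  then show ?case
    using Suc.prems by (simp del: funpow.simps)
qed

definition ray_sin :: "nat \<Rightarrow> complex \<Rightarrow> complex" where
  "ray_sin n = (rayleigh ^^ n) (\<lambda>w. sin w / w)"

definition ray_cos :: "nat \<Rightarrow> complex \<Rightarrow> complex" where
  "ray_cos n = (rayleigh ^^ n) (\<lambda>w. cos w / w)"

lemma rayleigh_eqI:
  "(f has_field_derivative - (z * d)) (at z) \<Longrightarrow> z \<noteq> 0 \<Longrightarrow> rayleigh f z = d"
  by (simp add: rayleigh_def DERIV_imp_deriv)

lemma rayleigh_over_id:
  assumes f: "\<And>z. (f has_field_derivative f' z) (at z)" and "z \<noteq> 0"
  shows "rayleigh (\<lambda>w. f w / w) z = f z / z ^ 3 - f' z / z\<^sup>2"
proof (rule rayleigh_eqI)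
  show "((\<lambda>w. f w / w) has_field_derivative - (z * (f z / z ^ 3 - f' z / z\<^sup>2))) (at z)"
    by (rule derivative_eq_intros f refl)+
      (use assms(2) in \<open>auto simp: field_simps power2_eq_square power3_eq_cube\<close>)
qed fact

text \<open>The case \<open>n = 0\<close> of the recurrence, that is, the spherical Bessel equation
  of order zero. It rests on f'' = - f alone, so that sine and cosine are treated together.\<close>

lemma rayleigh_over_id_ode:
  assumes f: "\<And>z. (f has_field_derivative f' z) (at z)"
    and f': "\<And>z. (f' has_field_derivative - f z) (at z)" and "z \<noteq> 0"
  shows "f z / z = 3 * rayleigh (\<lambda>w. f w / w) z - z\<^sup>2 * (rayleigh ^^ 2) (\<lambda>w. f w / w) z"
proof -
  have "(rayleigh ^^ 2) (\<lambda>w. f w / w) z = rayleigh (rayleigh (\<lambda>w. f w / w)) z"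
    by (simp add: numeral_2_eq_2)
  also have "\<dots> = 3 * f z / z ^ 5 - 3 * f' z / z ^ 4 - f z / z ^ 3"
  proof (rule rayleigh_eqI)
    have "((\<lambda>w. f w / w ^ 3 - f' w / w\<^sup>2) has_field_derivative
            - (z * (3 * f z / z ^ 5 - 3 * f' z / z ^ 4 - f z / z ^ 3))) (at z)"
      by (rule derivative_eq_intros f f' refl | use assms(3) in simp; fail)+
        (use assms(3) in \<open>auto simp: field_simps eval_nat_numeral\<close>)
    moreover have "\<forall>\<^sub>F w in nhds z. f w / w ^ 3 - f' w / w\<^sup>2 = rayleigh (\<lambda>w. f w / w) w"
    proof -
      have "\<forall>\<^sub>F w in nhds z. w \<in> - {0}"
        using assms(3) by (intro eventually_nhds_in_open) auto
      then show ?thesis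
        by eventually_elim (use rayleigh_over_id[OF f] in auto)
    qed
    ultimately show "(rayleigh (\<lambda>w. f w / w) has_field_derivative
            - (z * (3 * f z / z ^ 5 - 3 * f' z / z ^ 4 - f z / z ^ 3))) (at z)"
      by (subst (asm) DERIV_cong_ev[OF refl _ refl]) auto
  qed fact
  finally have 2: "(rayleigh ^^ 2) (\<lambda>w. f w / w) z = 3 * f z / z ^ 5 - 3 * f' z / z ^ 4 - f z / z ^ 3" .
  show ?thesis
    unfolding 2 rayleigh_over_id[OF f assms(3)] using assms(3) by (simp add: field_simps eval_nat_numeral)
qed

lemma sin_over_id_holomorphic: "(\<lambda>w. sin w / w) holomorphic_on - {0 :: complex}"
  by (intro holomorphic_intros) auto

lemma cos_over_id_holomorphic: "(\<lambda>w. cos w / w) holomorphic_on - {0 :: complex}"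
  by (intro holomorphic_intros) auto

lemma ray_sin_has_derivative [derivative_intros]:
  "z \<noteq> 0 \<Longrightarrow> (ray_sin n has_field_derivative - (z * ray_sin (Suc n) z)) (at z)"
  unfolding ray_sin_def by (rule rayleigh_funpow_has_derivative[OF sin_over_id_holomorphic])

lemma ray_cos_has_derivative [derivative_intros]:
  "z \<noteq> 0 \<Longrightarrow> (ray_cos n has_field_derivative - (z * ray_cos (Suc n) z)) (at z)"
  unfolding ray_cos_def by (rule rayleigh_funpow_has_derivative[OF cos_over_id_holomorphic])

lemma ray_sin_recurrence:
  "z \<noteq> 0 \<Longrightarrow> ray_sin n z = of_nat (2 * n + 3) * ray_sin (Suc n) z - z\<^sup>2 * ray_sin (Suc (Suc n)) z"
  unfolding ray_sin_def
  by (rule rayleigh_funpow_recurrence[OF sin_over_id_holomorphic])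
    (auto intro!: rayleigh_over_id_ode[of sin cos] DERIV_sin DERIV_cos)

lemma ray_cos_recurrence:
  "z \<noteq> 0 \<Longrightarrow> ray_cos n z = of_nat (2 * n + 3) * ray_cos (Suc n) z - z\<^sup>2 * ray_cos (Suc (Suc n)) z"
  unfolding ray_cos_def
  by (rule rayleigh_funpow_recurrence[OF cos_over_id_holomorphic])
    (auto intro!: rayleigh_over_id_ode[of cos "\<lambda>z. - sin z"] derivative_eq_intros)

text \<open>Expanding the two factors of index \<open>n\<close> by the recurrence, the products of
  two functions of index \<open>n + 1\<close> cancel and z^2 times the expression for
  \<open>n + 1\<close> remains. The induction thus starts from sin^2 + cos^2 = 1 and divides by z^2
  at each step.\<close>

lemma ray_wronskian:
  assumes "z \<noteq> 0"
  shows "ray_sin n z * ray_cos (Suc n) z - ray_sin (Suc n) z * ray_cos n z = 1 / z ^ (2 * n + 3)"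
proof (induction n)
  case 0
  have "sin z * sin z + cos z * cos z = 1"
    using sin_cos_squared_add[of z] by (simp add: power2_eq_square)
  have *: "s / z * (c / z ^ 3 + s / z\<^sup>2) - (s / z ^ 3 - c / z\<^sup>2) * (c / z) = (s * s + c * c) / z ^ 3"
    for s c :: complex
    using assms by (simp add: field_simps eval_nat_numeral)
  have "ray_sin (Suc 0) z = sin z / z ^ 3 - cos z / z\<^sup>2"
    unfolding ray_sin_def using rayleigh_over_id[OF DERIV_sin assms] by simp
  moreover have "ray_cos (Suc 0) z = cos z / z ^ 3 + sin z / z\<^sup>2"
    unfolding ray_cos_def using rayleigh_over_id[OF DERIV_cos assms] by simp
  moreover have "ray_sin 0 z = sin z / z" "ray_cos 0 z = cos z / z"
    by (simp_all add: ray_sin_def ray_cos_def)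
  ultimately have "ray_sin 0 z * ray_cos (Suc 0) z - ray_sin (Suc 0) z * ray_cos 0 z
     = sin z / z * (cos z / z ^ 3 + sin z / z\<^sup>2) - (sin z / z ^ 3 - cos z / z\<^sup>2) * (cos z / z)"
    by simp
  also have "\<dots> = (sin z * sin z + cos z * cos z) / z ^ 3"
    by (rule *)
  finally have "ray_sin 0 z * ray_cos (Suc 0) z - ray_sin (Suc 0) z * ray_cos 0 z
     = (sin z * sin z + cos z * cos z) / z ^ 3" .
  then show ?case
    using \<open>sin z * sin z + cos z * cos z = 1\<close> by simp
next
  case (Suc n)
  have "ray_sin n z * ray_cos (Suc n) z - ray_sin (Suc n) z * ray_cos n z =
     z\<^sup>2 * (ray_sin (Suc n) z * ray_cos (Suc (Suc n)) z - ray_sin (Suc (Suc n)) z * ray_cos (Suc n) z)"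
    unfolding ray_sin_recurrence[OF assms, of n] ray_cos_recurrence[OF assms, of n]
    by (simp add: algebra_simps)
  then have "z\<^sup>2 * (ray_sin (Suc n) z * ray_cos (Suc (Suc n)) z - ray_sin (Suc (Suc n)) z * ray_cos (Suc n) z)
      = 1 / z ^ (2 * n + 3)"
    using Suc.IH by (simp only:)
  also have "1 / z ^ (2 * n + 3) = z\<^sup>2 * (1 / z ^ (2 * Suc n + 3))"
    using assms by (simp add: field_simps eval_nat_numeral)
  finally have "z\<^sup>2 * (ray_sin (Suc n) z * ray_cos (Suc (Suc n)) z - ray_sin (Suc (Suc n)) z * ray_cos (Suc n) z)
      = z\<^sup>2 * (1 / z ^ (2 * Suc n + 3))" .
  then show ?case
    using assms by (metis mult_left_cancel power_not_zero)
qed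

text \<open>Entire versions: \<open>ent_sin n\<close> extends \<open>ray_sin n\<close>, and \<open>ent_cos n\<close> is
  \<open>z ^ (2 * n + 1) * ray_cos n z\<close>.\<close>

primrec ent_sin :: "nat \<Rightarrow> complex \<Rightarrow> complex" where
  "ent_sin 0 = (\<lambda>z. if z = 0 then 1 else sin z / z)"
| "ent_sin (Suc n) = (\<lambda>z. if z = 0 then - deriv (deriv (ent_sin n)) 0 else - (deriv (ent_sin n) z / z))"

primrec ent_cos :: "nat \<Rightarrow> complex \<Rightarrow> complex" where
  "ent_cos 0 = cos"
| "ent_cos (Suc n) = (\<lambda>z. of_nat (2 * n + 1) * ent_cos n z - z * deriv (ent_cos n) z)"

lemma ent_cos_holomorphic: "ent_cos n holomorphic_on A"
proof -
  have "ent_cos n holomorphic_on UNIV"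
  proof (induction n)
    case (Suc n)
    then show ?case
      by (auto intro!: holomorphic_intros holomorphic_deriv)
  qed (simp add: holomorphic_on_cos)
  then show ?thesis
    using holomorphic_on_subset by blast
qed

text \<open>Rayleigh's operator raises the order of the pole by two, and the quotient rule for the
  numerator over z^(2n+1) is the recursion that defines \<open>ent_cos\<close>.\<close>

lemma ray_cos_eq_ent_cos: "z \<noteq> 0 \<Longrightarrow> ray_cos n z = ent_cos n z / z ^ (2 * n + 1)"
proof (induction n arbitrary: z)
  case 0
  then show ?case by (simp add: ray_cos_def)
next
  case (Suc n)
  have d: "(ent_cos n has_field_derivative deriv (ent_cos n) z) (at z)"
    by (rule holomorphic_derivI[OF ent_cos_holomorphic open_UNIV]) simp
  have "((\<lambda>z. ent_cos n z / z ^ (2 * n + 1)) has_field_derivative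
         - (z * (ent_cos (Suc n) z / z ^ (2 * Suc n + 1)))) (at z)"
    by (rule derivative_eq_intros d refl)+
      (use Suc.prems in \<open>auto simp: field_simps eval_nat_numeral\<close>)
  moreover have "\<forall>\<^sub>F w in nhds z. ent_cos n w / w ^ (2 * n + 1) = ray_cos n w"
  proof -
    have "\<forall>\<^sub>F w in nhds z. w \<in> - {0}"
      using Suc.prems by (intro eventually_nhds_in_open) auto
    then show ?thesis
      by eventually_elim (use Suc.IH in auto)
  qed
  ultimately have "(ray_cos n has_field_derivative
         - (z * (ent_cos (Suc n) z / z ^ (2 * Suc n + 1)))) (at z)"
    by (subst (asm) DERIV_cong_ev[OF refl _ refl]) auto
  from DERIV_unique[OF this ray_cos_has_derivative[OF Suc.prems]] show ?case
    unfolding minus_minus neg_equal_iff_equal mult_left_cancel[OF Suc.prems] by (rule sym)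
qed

text \<open>The three claims need each other: the division by z in the recursion is removable at 0
  only if the derivative vanishes there, and for the next index this vanishing follows from the
  recurrence, which is known only through the agreement with \<open>ray_sin\<close>.\<close>

lemma ent_sin_main:
  "ent_sin n holomorphic_on UNIV \<and> deriv (ent_sin n) 0 = 0 \<and> (\<forall>z. z \<noteq> 0 \<longrightarrow> ent_sin n z = ray_sin n z)"
proof (induction n)
  case 0
  have holo: "ent_sin 0 holomorphic_on UNIV"
  proof -
    have "(\<lambda>z. if z = 0 then deriv sin 0 else (sin z - sin 0) / (z - 0)) holomorphic_on (UNIV :: complex set)"
      by (rule pole_lemma) (auto simp: holomorphic_on_sin)
    moreover have "deriv sin (0 :: complex) = 1"
      by (rule DERIV_imp_deriv) (auto intro!: derivative_eq_intros)
    ultimately show ?thesis by (simp cong: if_cong)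
  qed
  have "deriv (ent_sin 0) 0 = 0"
  proof -
    have h: "(ent_sin 0 has_field_derivative deriv (ent_sin 0) 0) (at 0)"
      by (rule holomorphic_derivI[OF holo open_UNIV]) simp
    have h': "(ent_sin 0 has_field_derivative deriv (ent_sin 0) 0) (at (- 0))"
      using h by simp
    \<comment> \<open>\<open>ent_sin 0\<close> is even, so its derivative at 0 equals its own
      negative.\<close>
    have "((\<lambda>z. ent_sin 0 (- z)) has_field_derivative deriv (ent_sin 0) 0 * (- 1)) (at 0)"
      by (rule DERIV_chain2[where f = "ent_sin 0" and g = uminus, OF h'])
        (auto intro!: derivative_eq_intros)
    moreover have "(\<lambda>z. ent_sin 0 (- z)) = ent_sin 0"
      by (auto simp: fun_eq_iff)
    ultimately have "deriv (ent_sin 0) 0 = deriv (ent_sin 0) 0 * (- 1)"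
      using h by (metis DERIV_unique)
    then show ?thesis by simp
  qed
  then show ?case using holo by (auto simp: ray_sin_def)
next
  case (Suc n)
  let ?F = "ent_sin n"
  have hol: "?F holomorphic_on UNIV" and d0: "deriv ?F 0 = 0"
    and eq: "\<And>z. z \<noteq> 0 \<Longrightarrow> ?F z = ray_sin n z"
    using Suc by auto
  have hol': "deriv ?F holomorphic_on UNIV"
    by (intro holomorphic_deriv hol open_UNIV)
  have "(\<lambda>z. if z = 0 then deriv (deriv ?F) 0 else (deriv ?F z - deriv ?F 0) / (z - 0)) holomorphic_on UNIV"
    by (rule pole_lemma[OF hol']) simp
  then have "(\<lambda>z. - (if z = 0 then deriv (deriv ?F) 0 else (deriv ?F z - deriv ?F 0) / (z - 0))) holomorphic_on UNIV"
    by (rule holomorphic_on_minus)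
  moreover have "(\<lambda>z. - (if z = 0 then deriv (deriv ?F) 0 else (deriv ?F z - deriv ?F 0) / (z - 0))) = ent_sin (Suc n)"
    by (auto simp: fun_eq_iff d0)
  ultimately have holS: "ent_sin (Suc n) holomorphic_on UNIV" by simp
  have eqS: "ent_sin (Suc n) z = ray_sin (Suc n) z" if "z \<noteq> 0" for z
  proof -
    have "\<forall>\<^sub>F w in nhds z. w \<in> - {0}"
      using that by (intro eventually_nhds_in_open) auto
    then have "\<forall>\<^sub>F w in nhds z. ?F w = ray_sin n w"
      by eventually_elim (use eq in auto)
    then have "deriv ?F z = deriv (ray_sin n) z"
      by (intro deriv_cong_ev) auto
    then show ?thesis
      using that by (simp add: ray_sin_def rayleigh_def)
  qed
  have holS': "deriv (ent_sin (Suc n)) holomorphic_on UNIV"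
    by (intro holomorphic_deriv holS open_UNIV)
  \<comment> \<open>This is \<open>ray_sin_recurrence\<close> extended to \<open>0\<close>; differentiating it there gives the vanishing of
    the derivative.\<close>
  have ode: "?F z = of_nat (2 * n + 3) * ent_sin (Suc n) z + z * deriv (ent_sin (Suc n)) z" (is "_ = ?G z") for z
  proof -
    have nz: "?F z = ?G z" if "z \<noteq> 0" for z
    proof -
      have "\<forall>\<^sub>F w in nhds z. w \<in> - {0}"
        using that by (intro eventually_nhds_in_open) auto
      then have "\<forall>\<^sub>F w in nhds z. ent_sin (Suc n) w = ray_sin (Suc n) w"
        by eventually_elim (use eqS in auto)
      then have "deriv (ent_sin (Suc n)) z = deriv (ray_sin (Suc n)) z"
        by (intro deriv_cong_ev) auto
      also have "\<dots> = - (z * ray_sin (Suc (Suc n)) z)"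
        by (rule DERIV_imp_deriv[OF ray_sin_has_derivative[OF that]])
      finally show ?thesis
        using eq[OF that] eqS[OF that] ray_sin_recurrence[OF that, of n]
        by (simp add: power2_eq_square del: ent_sin.simps)
    qed
    have "isCont ?F 0" "isCont ?G 0"
      using hol holS holS'
      by (auto simp del: ent_sin.simps intro!: continuous_intros
          dest!: holomorphic_on_imp_continuous_on simp: continuous_on_eq_continuous_at)
    then have "(?F \<longlongrightarrow> ?F 0) (at 0)" "(?G \<longlongrightarrow> ?G 0) (at 0)"
      by (simp_all add: isCont_def)
    moreover have "(?F \<longlongrightarrow> ?G 0) (at 0)"
      using calculation(2) by (rule Lim_transform_eventually)
        (use nz in \<open>auto simp: eventually_at intro!: exI[of _ 1]\<close>)
    ultimately have "?F 0 = ?G 0"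
      using LIM_unique by blast
    with nz show ?thesis by (cases "z = 0") auto
  qed
  have "deriv (ent_sin (Suc n)) 0 = 0"
  proof -
    have dS: "(ent_sin (Suc n) has_field_derivative deriv (ent_sin (Suc n)) 0) (at 0)"
      by (rule holomorphic_derivI[OF holS open_UNIV]) simp
    have dS': "(deriv (ent_sin (Suc n)) has_field_derivative deriv (deriv (ent_sin (Suc n))) 0) (at 0)"
      by (rule holomorphic_derivI[OF holS' open_UNIV]) simp
    have "((\<lambda>z. of_nat (2 * n + 3) * ent_sin (Suc n) z + z * deriv (ent_sin (Suc n)) z) has_field_derivative
        of_nat (2 * n + 4) * deriv (ent_sin (Suc n)) 0) (at 0)"
      by (rule derivative_eq_intros dS dS' refl)+ (simp add: algebra_simps)
    then have "(?F has_field_derivative of_nat (2 * n + 4) * deriv (ent_sin (Suc n)) 0) (at 0)"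
      unfolding ode[symmetric] .
    then have "deriv ?F 0 = of_nat (2 * n + 4) * deriv (ent_sin (Suc n)) 0"
      by (rule DERIV_imp_deriv)
    then have "of_nat (2 * n + 4) * deriv (ent_sin (Suc n)) 0 = 0"
      using d0 by (simp only:)
    moreover have "of_nat (2 * n + 4) \<noteq> (0 :: complex)"
      unfolding of_nat_eq_0_iff by simp
    ultimately show ?thesis by (simp only: mult_eq_0_iff simp_thms)
  qed
  then show ?case using holS eqS by blast
qed

lemma ent_sin_holomorphic: "ent_sin n holomorphic_on A"
  using ent_sin_main holomorphic_on_subset by blast

lemma ray_sin_eq_ent_sin: "z \<noteq> 0 \<Longrightarrow> ray_sin n z = ent_sin n z"
  using ent_sin_main by simp

text \<open>The limit of the recurrence at 0, where the term with z^2 disappears. Iterated, it shows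
  that \<open>ent_sin n 0\<close> is 1 / (2n+1)!!, the leading coefficient of j_n.\<close>

lemma ent_sin_Suc_0: "ent_sin n 0 = of_nat (2 * n + 3) * ent_sin (Suc n) 0"
proof -
  let ?G = "\<lambda>z. of_nat (2 * n + 3) * ent_sin (Suc n) z - z\<^sup>2 * ent_sin (Suc (Suc n)) z"
  have cont: "isCont (ent_sin m) z" for m z
    using ent_sin_holomorphic[of m UNIV]
    by (auto dest!: holomorphic_on_imp_continuous_on simp: continuous_on_eq_continuous_at)
  have "isCont ?G 0"
    by (intro continuous_intros cont)
  then have "(?G \<longlongrightarrow> ?G 0) (at 0)"
    by (simp add: isCont_def del: ent_sin.simps)
  then have "(ent_sin n \<longlongrightarrow> ?G 0) (at 0)"
    by (rule Lim_transform_eventually)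
      (use ray_sin_recurrence[of _ n] in
        \<open>auto simp: eventually_at ray_sin_eq_ent_sin simp del: ent_sin.simps intro!: exI[of _ 1]\<close>)
  moreover have "(ent_sin n \<longlongrightarrow> ent_sin n 0) (at 0)"
    using cont[where m = n and z = 0] unfolding isCont_def .
  ultimately show ?thesis
    using LIM_unique[of "ent_sin n" "ent_sin n 0" 0 "?G 0"] by (simp del: ent_sin.simps)
qed

text \<open>The values are (2n-1)!! and 1 / (2n+1)!!. Both are real; the conjugate is kept because
  the product arises from y_n times the conjugate of j_n, at the lower end of the radial
  integral.\<close>

lemma ent_cos_cnj_ent_sin_0: "ent_cos n 0 * cnj (ent_sin n 0) = 1 / of_nat (2 * n + 1)"
proof (induction n)
  case (Suc n)
  have "cnj (ent_sin n 0) = of_nat (2 * n + 3) * cnj (ent_sin (Suc n) 0)"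
    by (subst ent_sin_Suc_0) (simp del: ent_sin.simps)
  moreover have nz: "(of_nat (2 * n + 3) :: complex) \<noteq> 0" "(of_nat (2 * n + 1) :: complex) \<noteq> 0"
    unfolding of_nat_eq_0_iff by simp_all
  ultimately have "cnj (ent_sin (Suc n) 0) = cnj (ent_sin n 0) / of_nat (2 * n + 3)"
    by (metis nonzero_mult_div_cancel_left)
  then have "ent_cos (Suc n) 0 * cnj (ent_sin (Suc n) 0) =
      of_nat (2 * n + 1) * (ent_cos n 0 * cnj (ent_sin n 0)) / of_nat (2 * n + 3)"
    by (simp del: ent_sin.simps)
  also have "\<dots> = 1 / of_nat (2 * Suc n + 1)"
    unfolding Suc using nz by (simp add: add.commute)
  finally show ?case .
qed simp

lemma sph_j_eq: "sph_j n z = z ^ n * ray_sin n z"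
  by (simp add: sph_j_def ray_sin_def)

lemma sph_y_eq: "sph_y n z = - (z ^ n * ray_cos n z)"
  by (simp add: sph_y_def ray_cos_def)

section \<open>Integration in polar coordinates\<close>

lemma sgn_scaleR_pos: "t > 0 \<Longrightarrow> sgn (t *\<^sub>R x) = sgn (x :: real^3)"
  by (simp add: sgn_div_norm)

lemma measurable_sgn_vec [measurable]: "(sgn :: real^3 \<Rightarrow> real^3) \<in> borel_measurable borel"
  unfolding sgn_div_norm[abs_def] by measurable

lemma measurable_ball_vec [measurable]: "ball (0 :: real^3) t \<in> sets borel"
  by simp

text \<open>A function of the direction is invariant under dilations, so only the Jacobian t^3
  appears.\<close>

lemma nn_integral_ball_homogeneous:
  fixes q :: "real^3 \<Rightarrow> real"
  assumes [measurable]: "q \<in> borel_measurable borel" and "t > 0"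
  shows "(\<integral>\<^sup>+x. ennreal (q (sgn x)) * indicator (ball 0 t) x \<partial>lborel) =
    ennreal (t ^ 3) * (\<integral>\<^sup>+x. ennreal (q (sgn x)) * indicator (ball 0 1) x \<partial>lborel)"
proof -
  have *: "indicator (ball 0 t) (t *\<^sub>R x) = (indicator (ball 0 1) x :: ennreal)" for x :: "real^3"
    using \<open>t > 0\<close> by (auto simp: indicator_def mem_ball)
  have "(\<integral>\<^sup>+x. ennreal (q (sgn x)) * indicator (ball 0 t) x \<partial>lborel) =
      (\<integral>\<^sup>+x. ennreal (q (sgn x)) * indicator (ball 0 t) x
        \<partial>density (distr lborel borel (\<lambda>x::real^3. 0 + t *\<^sub>R x)) (\<lambda>_. \<bar>t\<bar> ^ DIM(real^3)))"
    using \<open>t > 0\<close> by (subst lborel_affine[of t "0 :: real^3", symmetric]) auto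
  also have "\<dots> = (\<integral>\<^sup>+x. ennreal (t ^ 3) * (ennreal (q (sgn x)) * indicator (ball 0 1) x) \<partial>lborel)"
    using \<open>t > 0\<close> by (simp add: nn_integral_density nn_integral_distr sgn_scaleR_pos *)
  also have "\<dots> = ennreal (t ^ 3) * (\<integral>\<^sup>+x. ennreal (q (sgn x)) * indicator (ball 0 1) x \<partial>lborel)"
    by (rule nn_integral_cmult) measurable
  finally show ?thesis .
qed

lemma integrable_direction_ball:
  fixes q :: "real^3 \<Rightarrow> 'a::{banach, second_countable_topology}"
  assumes [measurable]: "q \<in> borel_measurable borel" and "\<And>x. norm (q (sgn x)) \<le> B"
  shows "integrable lborel (\<lambda>x. indicator (ball 0 1) x *\<^sub>R q (sgn x))"
proof (rule integrableI_bounded_set[where A = "ball 0 1" and B = B])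
  show "emeasure lborel (ball (0 :: real^3) 1) < \<infinity>"
    using emeasure_bounded_finite[of "ball (0 :: real^3) 1"] by simp
qed (use assms(2) in auto)

lemma continuous_direction_bounded:
  fixes q :: "real^3 \<Rightarrow> 'a::real_normed_vector"
  assumes "continuous_on UNIV q"
  obtains B where "\<And>x. norm (q (sgn x)) \<le> B"
proof -
  have "compact (q ` cball 0 1)"
    by (intro compact_continuous_image continuous_on_subset[OF assms]) auto
  then obtain B where "\<forall>x\<in>cball 0 1. norm (q x) \<le> B"
    using compact_imp_bounded[of "q ` cball 0 1"] unfolding bounded_iff by (metis imageI)
  then have "norm (q (sgn x)) \<le> B" for x
    by (simp add: norm_sgn)
  then show thesis by (rule that)
qed

text \<open>Polar coordinates as an identity of measures on the line. Both sides give c t^3 to the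
  half-line below a positive t and 0 to the others, and these half-lines form an intersection-stable
  generator of the Borel sets.\<close>

lemma distr_norm_density:
  fixes q :: "real^3 \<Rightarrow> real"
  assumes [measurable]: "q \<in> borel_measurable borel"
    and "\<And>x. 0 \<le> q (sgn x)" "\<And>x. q (sgn x) \<le> B"
  shows "distr (density lborel (\<lambda>x. ennreal (q (sgn x)))) borel norm =
    density lborel (\<lambda>r. ennreal (3 * (LINT x:ball 0 1|lborel. q (sgn x)) * (indicator {0..} r * r\<^sup>2)))"
    (is "?M = ?N")
proof -
  define c where "c = (LINT x:ball 0 1|lborel. q (sgn x))"
  have c: "c \<ge> 0"
    unfolding c_def set_lebesgue_integral_def by (rule integral_nonneg_AE) (use assms in auto)
  have cc: "(\<integral>\<^sup>+x. ennreal (q (sgn x)) * indicator (ball 0 1) x \<partial>lborel) = ennreal c"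
  proof -
    have "(\<integral>\<^sup>+x. ennreal (indicator (ball 0 1) x *\<^sub>R q (sgn x)) \<partial>lborel) = ennreal c"
      unfolding c_def set_lebesgue_integral_def
    proof (rule nn_integral_eq_integral)
      show "integrable lborel (\<lambda>x. indicat_real (ball 0 1) x *\<^sub>R q (sgn x))"
        by (rule integrable_direction_ball[where B = B]) (use assms in auto)
    qed (use assms in auto)
    moreover have "(\<lambda>x. ennreal (indicator (ball 0 1) x *\<^sub>R q (sgn x))) =
        (\<lambda>x. ennreal (q (sgn x)) * indicator (ball 0 1) x)"
      by (auto simp: fun_eq_iff indicator_def)
    ultimately show ?thesis by simp
  qed
  have M: "emeasure ?M {..<t} = ennreal (max 0 t ^ 3 * c)" for t
  proof -
    have "norm -` {..<t} = ball (0 :: real^3) t"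
      by (auto simp: mem_ball)
    then have "emeasure ?M {..<t} = (\<integral>\<^sup>+x. ennreal (q (sgn x)) * indicator (ball 0 t) x \<partial>lborel)"
      by (simp add: emeasure_distr emeasure_density)
    then show ?thesis
      using nn_integral_ball_homogeneous[OF assms(1), of t] c
      by (cases "t > 0") (auto simp: cc ennreal_mult max_def not_less ball_empty)
  qed
  have N: "emeasure ?N {..<t} = ennreal (max 0 t ^ 3 * c)" for t
  proof (cases "t > 0")
    case True
    have "emeasure ?N {..<t} = (\<integral>\<^sup>+r. ennreal (3 * c * (indicator {0..} r * r\<^sup>2)) * indicator {..<t} r \<partial>lborel)"
      by (simp add: emeasure_density c_def)
    also have "\<dots> = (\<integral>\<^sup>+r. ennreal (3 * c * r\<^sup>2) * indicator {0..t} r \<partial>lborel)"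
    proof (rule nn_integral_cong_AE)
      have "AE r in lborel. r \<noteq> t"
        by (rule AE_lborel_singleton)
      then show "AE r in lborel. ennreal (3 * c * (indicator {0..} r * r\<^sup>2)) * indicator {..<t} r =
          ennreal (3 * c * r\<^sup>2) * indicator {0..t} r"
        by eventually_elim (auto simp: indicator_def)
    qed
    also have "\<dots> = ennreal (c * t ^ 3 - c * 0 ^ 3)"
      by (rule nn_integral_FTC_Icc)
        (use True c in \<open>auto intro!: derivative_eq_intros
          simp flip: has_real_derivative_iff_has_vector_derivative\<close>)
    finally show ?thesis using True by (simp add: mult.commute max_def)
  next
    case False
    have "emeasure ?N {..<t} = (\<integral>\<^sup>+r. ennreal (3 * c * (indicator {0..} r * r\<^sup>2)) * indicator {..<t} r \<partial>lborel)"
      by (simp add: emeasure_density c_def)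
    also have "\<dots> = (\<integral>\<^sup>+(r :: real). 0 \<partial>lborel)"
      by (rule nn_integral_cong) (use False in \<open>auto simp: indicator_def\<close>)
    finally show ?thesis using False by (simp add: max_def)
  qed
  have IS: "Int_stable (range lessThan :: real set set)"
  proof (rule Int_stableI)
    fix a b :: "real set" assume "a \<in> range lessThan" "b \<in> range lessThan"
    then obtain s t where "a = {..<s}" "b = {..<t}" by auto
    then have "a \<inter> b = {..<min s t}" by auto
    then show "a \<inter> b \<in> range lessThan" by blast
  qed
  have sM: "sets ?M = sigma_sets UNIV (range lessThan)"
    unfolding sets_distr by (simp add: borel_Iio)
  have sN: "sets ?N = sigma_sets UNIV (range lessThan)"
    unfolding sets_density sets_lborel by (simp add: borel_Iio)
  have UN: "(\<Union>i. {..<real i}) = UNIV"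
    using reals_Archimedean2 by auto
  have eq: "emeasure ?M X = emeasure ?N X" if "X \<in> range lessThan" for X
    using that by (auto simp only: M N)
  show ?thesis
    by (rule measure_eqI_generator_eq[OF IS _ eq sM sN _ UN]) (simp_all add: M image_subset_iff)
qed

text \<open>A signed weight becomes nonnegative after adding its bound \<open>B\<close>; the
  constant weight \<open>B\<close> is then subtracted again.\<close>

lemma polar_real:
  fixes q :: "real^3 \<Rightarrow> real" and f :: "real \<Rightarrow> complex"
  assumes [measurable]: "q \<in> borel_measurable borel" "f \<in> borel_measurable borel"
    and bnd: "\<And>x. \<bar>q (sgn x)\<bar> \<le> B"
    and int: "integrable lborel (\<lambda>r. indicator {0..} r *\<^sub>R (of_real (r\<^sup>2) * f r))"
  shows "has_bochner_integral lborel (\<lambda>x. q (sgn x) *\<^sub>R f (norm x))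
     ((3 * (LINT x:ball 0 1|lborel. q (sgn x))) *\<^sub>R (LINT r:{0..}|lborel. of_real (r\<^sup>2) * f r))"
proof -
  have nonneg: "has_bochner_integral lborel (\<lambda>x. q (sgn x) *\<^sub>R f (norm x))
     ((3 * (LINT x:ball 0 1|lborel. q (sgn x))) *\<^sub>R (LINT r:{0..}|lborel. of_real (r\<^sup>2) * f r))"
    if [measurable]: "q \<in> borel_measurable borel"
      and q: "\<And>x. 0 \<le> q (sgn x)" "\<And>x. q (sgn x) \<le> B" for q :: "real^3 \<Rightarrow> real" and B
  proof -
    define c where "c = (LINT x:ball 0 1|lborel. q (sgn x))"
    have c: "c \<ge> 0"
      unfolding c_def set_lebesgue_integral_def by (rule integral_nonneg_AE) (use q in auto)
    note D = distr_norm_density[OF that(1) q, folded c_def]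
    have eq: "(\<lambda>r. (3 * c * (indicat_real {0..} r * r\<^sup>2)) *\<^sub>R f r) =
        (\<lambda>r. (3 * c) *\<^sub>R (indicator {0..} r *\<^sub>R (of_real (r\<^sup>2) * f r)))"
      by (auto simp: fun_eq_iff scaleR_conv_of_real)
    have "integrable (density lborel (\<lambda>r. ennreal (3 * c * (indicator {0..} r * r\<^sup>2)))) f"
      using c
      by (subst integrable_density, measurable)
        (auto simp del: scaleR_scaleR of_real_power simp: eq intro!: integrable_scaleR_right int)
    then have "integrable (distr (density lborel (\<lambda>x. ennreal (q (sgn x)))) borel norm) f"
      by (simp add: D)
    then have 1: "integrable lborel (\<lambda>x. q (sgn x) *\<^sub>R f (norm x))"
      using q by (simp add: integrable_distr_eq integrable_density)
    have "(\<integral>x. q (sgn x) *\<^sub>R f (norm x) \<partial>lborel) =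
        integral\<^sup>L (distr (density lborel (\<lambda>x. ennreal (q (sgn x)))) borel norm) f"
      using q by (simp add: integral_distr integral_density)
    also have "\<dots> = (\<integral>r. (3 * c * (indicat_real {0..} r * r\<^sup>2)) *\<^sub>R f r \<partial>lborel)"
      unfolding D using c by (subst integral_density) auto
    also have "\<dots> = (3 * c) *\<^sub>R (LINT r:{0..}|lborel. of_real (r\<^sup>2) * f r)"
      unfolding eq set_lebesgue_integral_def by (rule integral_scaleR_right)
    finally show ?thesis
      using 1 by (simp add: has_bochner_integral_iff c_def)
  qed
  have B: "B \<ge> 0" using bnd[of 0] by linarith
  let ?I = "LINT r:{0..}|lborel. of_real (r\<^sup>2) * f r"
  have 1: "has_bochner_integral lborel (\<lambda>x. (q (sgn x) + B) *\<^sub>R f (norm x))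
     ((3 * (LINT x:ball 0 1|lborel. (q (sgn x) + B))) *\<^sub>R ?I)"
  proof (rule nonneg[where q = "\<lambda>x. q x + B" and B = "2 * B"])
    show "0 \<le> q (sgn x) + B" "q (sgn x) + B \<le> 2 * B" for x
      using bnd[of x] by linarith+
  qed simp
  have 2: "has_bochner_integral lborel (\<lambda>x :: real^3. B *\<^sub>R f (norm x))
     ((3 * (LINT x:ball (0 :: real^3) 1|lborel. B)) *\<^sub>R ?I)"
    by (rule nonneg[where q = "\<lambda>x. B" and B = B]) (use B in auto)
  have i: "integrable lborel (\<lambda>x. indicator (ball 0 1) x *\<^sub>R q (sgn x))"
    by (rule integrable_direction_ball[where B = B]) (use bnd in auto)
  have iB: "integrable lborel (\<lambda>x :: real^3. indicator (ball 0 1) x *\<^sub>R B)"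
    by (rule integrable_direction_ball[where B = B]) (use B in auto)
  have "(LINT x:ball 0 1|lborel. (q (sgn x) + B)) - (LINT x:ball (0 :: real^3) 1|lborel. B) =
      (LINT x:ball 0 1|lborel. q (sgn x))"
    using i iB unfolding set_lebesgue_integral_def by (simp add: scaleR_add_right del: real_scaleR_def)
  then show ?thesis
    using has_bochner_integral_diff[OF 1 2]
    by (simp add: scaleR_left_diff_distrib[symmetric] right_diff_distrib[symmetric])
qed

lemma polar_complex:
  fixes q :: "real^3 \<Rightarrow> complex" and f :: "real \<Rightarrow> complex"
  assumes q: "continuous_on UNIV q" and [measurable]: "f \<in> borel_measurable borel"
    and int: "set_integrable lborel {0..} (\<lambda>r. of_real (r\<^sup>2) * f r)"
  shows "has_bochner_integral lborel (\<lambda>x. f (norm x) * q (sgn x))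
     (sphere_integral q * (LINT r:{0..}|lborel. of_real (r\<^sup>2) * f r))"
proof -
  have [measurable]: "q \<in> borel_measurable borel"
    using q by (rule borel_measurable_continuous_onI)
  obtain B where B: "\<And>x. norm (q (sgn x)) \<le> B"
    using continuous_direction_bounded[OF q] by blast
  note int' = int[unfolded set_integrable_def]
  let ?I = "LINT r:{0..}|lborel. of_real (r\<^sup>2) * f r"
  have bR: "\<bar>Re (q (sgn x))\<bar> \<le> B" and bI: "\<bar>Im (q (sgn x))\<bar> \<le> B" for x
    using B[of x] abs_Re_le_cmod[of "q (sgn x)"] abs_Im_le_cmod[of "q (sgn x)"] by linarith+
  have R: "has_bochner_integral lborel (\<lambda>x. Re (q (sgn x)) *\<^sub>R f (norm x))
     ((3 * (LINT x:ball 0 1|lborel. Re (q (sgn x)))) *\<^sub>R ?I)"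
    by (rule polar_real[where q = "\<lambda>x. Re (q x)" and B = B]) (use bR int' in auto)
  have I: "has_bochner_integral lborel (\<lambda>x. Im (q (sgn x)) *\<^sub>R f (norm x))
     ((3 * (LINT x:ball 0 1|lborel. Im (q (sgn x)))) *\<^sub>R ?I)"
    by (rule polar_real[where q = "\<lambda>x. Im (q x)" and B = B]) (use bI int' in auto)
  have iq: "integrable lborel (\<lambda>x. indicator (ball 0 1) x *\<^sub>R q (sgn x))"
    by (rule integrable_direction_ball[where q = q and B = B]) (use B in auto)
  have Re: "(LINT x:ball 0 1|lborel. Re (q (sgn x))) = Re (LINT x:ball 0 1|lborel. q (sgn x))"
    and Im: "(LINT x:ball 0 1|lborel. Im (q (sgn x))) = Im (LINT x:ball 0 1|lborel. q (sgn x))"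
    unfolding set_lebesgue_integral_def using integral_Re[OF iq] integral_Im[OF iq] by simp_all
  have "has_bochner_integral lborel
     (\<lambda>x. Re (q (sgn x)) *\<^sub>R f (norm x) + \<i> * (Im (q (sgn x)) *\<^sub>R f (norm x)))
     ((3 * (LINT x:ball 0 1|lborel. Re (q (sgn x)))) *\<^sub>R ?I
        + \<i> * ((3 * (LINT x:ball 0 1|lborel. Im (q (sgn x)))) *\<^sub>R ?I))"
    by (intro has_bochner_integral_add has_bochner_integral_mult_right R I)
  moreover have "Re (q (sgn x)) *\<^sub>R f (norm x) + \<i> * (Im (q (sgn x)) *\<^sub>R f (norm x)) = f (norm x) * q (sgn x)" for x
    by (subst (3) complex_eq) (simp add: scaleR_conv_of_real algebra_simps)
  moreover have "(3 * (LINT x:ball 0 1|lborel. Re (q (sgn x)))) *\<^sub>R ?I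
        + \<i> * ((3 * (LINT x:ball 0 1|lborel. Im (q (sgn x)))) *\<^sub>R ?I) = sphere_integral q * ?I"
    unfolding Re Im sphere_integral_def
    by (subst (3) complex_eq) (simp add: scaleR_conv_of_real algebra_simps)
  ultimately show ?thesis by simp
qed

lemma polar_set:
  fixes q :: "real^3 \<Rightarrow> complex" and f :: "real \<Rightarrow> complex"
  assumes q: "continuous_on UNIV q" and A: "A \<in> sets borel" "A \<subseteq> {0..}"
    and int: "set_integrable lborel A (\<lambda>r. of_real (r\<^sup>2) * f r)"
  shows "has_bochner_integral lborel (\<lambda>x. indicator A (norm x) *\<^sub>R (f (norm x) * q (sgn x)))
     (sphere_integral q * (LINT r:A|lborel. of_real (r\<^sup>2) * f r))"
proof -
  \<comment> \<open>The factor r^2 erases the value of \<open>f\<close> at 0, so integrability of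
    the product makes \<open>f\<close> measurable only away from 0. Dividing by r^2 recovers it
    there, and division by zero yields 0 at the origin.\<close>
  define F where "F r = indicator (A - {0}) r *\<^sub>R f r" for r
  have "(\<lambda>r. indicator A r *\<^sub>R (of_real (r\<^sup>2) * f r)) \<in> borel_measurable lborel"
    using int unfolding set_integrable_def by auto
  then have "(\<lambda>r. (indicator A r *\<^sub>R (of_real (r\<^sup>2) * f r)) / of_real (r\<^sup>2)) \<in> borel_measurable borel"
    by measurable
  moreover have "(\<lambda>r. (indicator A r *\<^sub>R (of_real (r\<^sup>2) * f r)) / of_real (r\<^sup>2)) = F"
    by (auto simp: fun_eq_iff F_def indicator_def)
  ultimately have [measurable]: "F \<in> borel_measurable borel" by simp
  have eq: "(\<lambda>r. indicator {0..} r *\<^sub>R (of_real (r\<^sup>2) * F r)) = (\<lambda>r. indicator A r *\<^sub>R (of_real (r\<^sup>2) * f r))"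
    using A by (auto simp: fun_eq_iff F_def indicator_def)
  have "has_bochner_integral lborel (\<lambda>x. F (norm x) * q (sgn x))
     (sphere_integral q * (LINT r:{0..}|lborel. of_real (r\<^sup>2) * F r))"
    by (rule polar_complex[OF q]) (use int in \<open>auto simp del: of_real_power simp: set_integrable_def eq\<close>)
  then have "has_bochner_integral lborel (\<lambda>x. F (norm x) * q (sgn x))
     (sphere_integral q * (LINT r:A|lborel. of_real (r\<^sup>2) * f r))"
    by (simp only: set_lebesgue_integral_def eq)
  moreover have "AE x in lborel. F (norm x) * q (sgn x) = indicator A (norm x) *\<^sub>R (f (norm x) * q (sgn x))"
    using AE_lborel_singleton[of "0 :: real^3"] by eventually_elim (auto simp: F_def indicator_def)
  moreover have "(\<lambda>x. indicator A (norm x) *\<^sub>R (f (norm x) * q (sgn x))) \<in> borel_measurable lborel"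
  proof -
    have [measurable]: "q \<in> borel_measurable borel"
      using q by (rule borel_measurable_continuous_onI)
    \<comment> \<open>\<open>F\<close> vanishes at 0; the extra summand restores the value that the
      integrand of the statement has at the origin.\<close>
    have "(\<lambda>x. F (norm x) * q (sgn x) + (if x = 0 then indicator A 0 *\<^sub>R (f 0 * q 0) else 0)) \<in> borel_measurable borel"
      by measurable
    moreover have "(\<lambda>x. F (norm x) * q (sgn x) + (if x = 0 then indicator A 0 *\<^sub>R (f 0 * q 0) else 0)) =
        (\<lambda>x. indicator A (norm x) *\<^sub>R (f (norm x) * q (sgn x)))"
      by (auto simp: fun_eq_iff F_def indicator_def)
    ultimately show ?thesis by simp
  qed
  ultimately show ?thesis
    by (subst has_bochner_integral_cong_AE[symmetric]) auto
qed

section \<open>Partial derivatives\<close>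

text \<open>\<open>partial\<close> is total and its value carries no information where the
  derivative fails to exist. The relation records existence as well, so derivative rules
  compose.\<close>

definition has_partial :: "(real^3 \<Rightarrow> 'b::real_normed_vector) \<Rightarrow> 'b \<Rightarrow> 3 \<Rightarrow> real^3 \<Rightarrow> bool" where
  "has_partial f d i x \<longleftrightarrow> ((\<lambda>t. f (x + t *\<^sub>R axis i 1)) has_vector_derivative d) (at 0)"

lemma has_partial_eq: "has_partial f d i x \<Longrightarrow> partial i f x = d"
  unfolding has_partial_def partial_def by (rule vector_derivative_at)

lemma has_partial_const: "has_partial (\<lambda>x. c) 0 i x"
  by (simp add: has_partial_def)

lemma has_partial_add:
  "has_partial f d i x \<Longrightarrow> has_partial g e i x \<Longrightarrow> has_partial (\<lambda>x. f x + g x) (d + e) i x"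
  unfolding has_partial_def by (rule has_vector_derivative_add)

lemma has_partial_diff:
  "has_partial f d i x \<Longrightarrow> has_partial g e i x \<Longrightarrow> has_partial (\<lambda>x. f x - g x) (d - e) i x"
  unfolding has_partial_def by (rule has_vector_derivative_diff)

lemma has_partial_mult:
  fixes f g :: "real^3 \<Rightarrow> 'b::real_normed_algebra"
  shows "has_partial f d i x \<Longrightarrow> has_partial g e i x \<Longrightarrow> has_partial (\<lambda>x. f x * g x) (f x * e + d * g x) i x"
  unfolding has_partial_def by (drule (1) has_vector_derivative_mult) simp

lemma has_partial_bounded_linear:
  assumes "bounded_linear h" "has_partial f d i x"
  shows "has_partial (\<lambda>x. h (f x)) (h d) i x"
  using bounded_linear.has_vector_derivative[OF assms(1)] assms(2) unfolding has_partial_def by blast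

lemma has_partial_linear:
  assumes "bounded_linear h" shows "has_partial h (h (axis i 1)) i x"
proof -
  have "((\<lambda>t. h (x + t *\<^sub>R axis i 1)) has_vector_derivative h (0 + 1 *\<^sub>R axis i 1)) (at 0)"
    by (rule bounded_linear.has_vector_derivative[OF assms])
      (auto intro!: derivative_eq_intros)
  then show ?thesis by (simp add: has_partial_def)
qed

lemma has_partial_coord: "has_partial (\<lambda>x. complex_of_real (x $ j)) (if i = j then 1 else 0) i x"
proof -
  have "bounded_linear (\<lambda>x :: real^3. complex_of_real (x $ j))"
    by (intro bounded_linear_of_real bounded_linear_compose[OF bounded_linear_of_real bounded_linear_vec_nth])
  from has_partial_linear[OF this, of i x] show ?thesis
    by (cases "i = j") (simp_all add: axis_def)
qed

lemma has_partial_transform: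
  assumes "has_partial f d i x" "open S" "x \<in> S" "\<And>y. y \<in> S \<Longrightarrow> f y = g y"
  shows "has_partial g d i x"
proof -
  have "open ((\<lambda>t :: real. x + t *\<^sub>R axis i 1) -` S)"
    by (intro open_vimage assms(2) continuous_intros)
  then show ?thesis
    unfolding has_partial_def
    by (rule has_vector_derivative_transform_within_open[OF assms(1)[unfolded has_partial_def]])
      (use assms(3,4) in simp_all)
qed

lemma has_partial_along_line:
  assumes "\<And>y. has_partial f (D y) i y"
  shows "((\<lambda>t. f (x + t *\<^sub>R axis i 1)) has_vector_derivative D (x + s *\<^sub>R axis i 1)) (at s)"
proof -
  have "((\<lambda>t. f (x + s *\<^sub>R axis i 1 + t *\<^sub>R axis i 1)) has_vector_derivative D (x + s *\<^sub>R axis i 1)) (at (s - s))"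
    using assms[of "x + s *\<^sub>R axis i 1"] by (simp add: has_partial_def)
  then have "(((\<lambda>t. f (x + s *\<^sub>R axis i 1 + t *\<^sub>R axis i 1)) \<circ> (\<lambda>t. t - s)) has_vector_derivative 1 *\<^sub>R D (x + s *\<^sub>R axis i 1)) (at s)"
    by (intro vector_diff_chain_at) (auto intro!: derivative_eq_intros)
  moreover have "x + s *\<^sub>R axis i 1 + (t - s) *\<^sub>R axis i 1 = x + t *\<^sub>R axis i 1" for t
    by (simp add: scaleR_left_diff_distrib)
  ultimately show ?thesis
    by (simp add: o_def)
qed

section \<open>Polynomials\<close>

lemma partial_linear: "bounded_linear h \<Longrightarrow> partial i h = (\<lambda>x. h (axis i 1))"
  by (rule ext) (rule has_partial_eq, rule has_partial_linear)

lemma partial_const: "partial i (\<lambda>x. c) = (\<lambda>x. 0)"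
  by (rule ext) (rule has_partial_eq, rule has_partial_const)

lemma real_poly_has_partial:
  assumes "real_polynomial_function f"
  shows "real_polynomial_function (partial i f)" "has_partial f (partial i f x) i x"
proof -
  have "real_polynomial_function (partial i f) \<and> (\<forall>x. has_partial f (partial i f x) i x)"
    using assms
  proof induction
    case (linear h)
    then show ?case
      by (simp add: partial_linear has_partial_linear real_polynomial_function.intros(2))
  next
    case (const c)
    show ?case
      by (simp add: partial_const has_partial_const real_polynomial_function.intros(2))
  next
    case (add f g)
    then have d: "has_partial (\<lambda>x. f x + g x) (partial i f x + partial i g x) i x" for x
      by (intro has_partial_add) simp_all
    then have "partial i (\<lambda>x. f x + g x) = (\<lambda>x. partial i f x + partial i g x)"
      by (intro ext has_partial_eq)
    with d add show ?case
      by (simp add: real_polynomial_function.intros(3))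
  next
    case (mult f g)
    then have d: "has_partial (\<lambda>x. f x * g x) (f x * partial i g x + partial i f x * g x) i x" for x
      by (intro has_partial_mult) simp_all
    then have "partial i (\<lambda>x. f x * g x) = (\<lambda>x. f x * partial i g x + partial i f x * g x)"
      by (intro ext has_partial_eq)
    with d mult show ?case
      by (simp add: real_polynomial_function.intros(3,4))
  qed
  then show "real_polynomial_function (partial i f)" "has_partial f (partial i f x) i x"
    by auto
qed

lemma real_poly_partial_commute:
  assumes "real_polynomial_function f"
  shows "partial i (partial j f) x = partial j (partial i f) x"
  using assms
proof (induction arbitrary: x)
  case (linear h)
  then show ?case by (simp add: partial_linear partial_const)
next
  case (const c)
  show ?case by (simp add: partial_const)
next
  case (add f g)
  note d = real_poly_has_partial(2)[OF add.hyps(1)] real_poly_has_partial(2)[OF add.hyps(2)]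
  note dd = real_poly_has_partial(2)[OF real_poly_has_partial(1)[OF add.hyps(1)]]
    real_poly_has_partial(2)[OF real_poly_has_partial(1)[OF add.hyps(2)]]
  have "partial i (\<lambda>x. f x + g x) = (\<lambda>x. partial i f x + partial i g x)" for i
    by (intro ext has_partial_eq has_partial_add d)
  moreover have "partial i (\<lambda>x. partial j f x + partial j g x) x = partial i (partial j f) x + partial i (partial j g) x" for i j
    by (intro has_partial_eq has_partial_add dd)
  ultimately show ?case using add.IH by simp
next
  case (mult f g)
  note d = real_poly_has_partial(2)[OF mult.hyps(1)] real_poly_has_partial(2)[OF mult.hyps(2)]
  note dd = real_poly_has_partial(2)[OF real_poly_has_partial(1)[OF mult.hyps(1)]]
    real_poly_has_partial(2)[OF real_poly_has_partial(1)[OF mult.hyps(2)]]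
  have "partial i (\<lambda>x. f x * g x) = (\<lambda>x. f x * partial i g x + partial i f x * g x)" for i
    by (intro ext has_partial_eq has_partial_mult d)
  moreover have "partial i (\<lambda>x. f x * partial j g x + partial j f x * g x) x =
      (f x * partial i (partial j g) x + partial i f x * partial j g x)
      + (partial j f x * partial i g x + partial i (partial j f) x * g x)" for i j
    by (intro has_partial_eq has_partial_add has_partial_mult d dd)
  ultimately show ?case using mult.IH by simp
qed

lemma complex_poly_iff:
  "polynomial_function p \<longleftrightarrow>
     real_polynomial_function (\<lambda>x. Re (p x)) \<and> real_polynomial_function (\<lambda>x. Im (p x))"
  for p :: "real^3 \<Rightarrow> complex"
  by (subst polynomial_function_iff_Basis_inner)
    (simp add: Basis_complex_def inner_complex_def)

lemma has_partial_Complex: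
  assumes "has_partial (\<lambda>x. Re (p x)) a i x" "has_partial (\<lambda>x. Im (p x)) b i x"
  shows "has_partial p (Complex a b) i x"
  using assms unfolding has_partial_def has_vector_derivative_complex_iff
  by (simp add: has_real_derivative_iff_has_vector_derivative)

lemma complex_poly_has_partial:
  fixes p :: "real^3 \<Rightarrow> complex"
  assumes "polynomial_function p"
  shows "polynomial_function (partial i p)" "has_partial p (partial i p x) i x"
    "partial i (partial j p) x = partial j (partial i p) x"
proof -
  note pp = assms[unfolded complex_poly_iff]
  have d: "has_partial p (Complex (partial i (\<lambda>x. Re (p x)) x) (partial i (\<lambda>x. Im (p x)) x)) i x" for i x
    by (intro has_partial_Complex real_poly_has_partial pp[THEN conjunct1] pp[THEN conjunct2])
  have eq: "partial i p = (\<lambda>x. Complex (partial i (\<lambda>x. Re (p x)) x) (partial i (\<lambda>x. Im (p x)) x))" for i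
    by (rule ext) (rule has_partial_eq[OF d])
  show "polynomial_function (partial i p)"
    unfolding complex_poly_iff by (simp add: eq real_poly_has_partial pp)
  show "has_partial p (partial i p x) i x"
    using d[of i x] by (simp add: eq)
  have "partial i (partial j p) x = Complex (partial i (partial j (\<lambda>x. Re (p x))) x) (partial i (partial j (\<lambda>x. Im (p x))) x)" for i j
    unfolding eq[of j]
    by (rule has_partial_eq, rule has_partial_Complex)
      (simp_all add: real_poly_has_partial pp[THEN conjunct1] pp[THEN conjunct2])
  then show "partial i (partial j p) x = partial j (partial i p) x"
    using pp real_poly_partial_commute by simp
qed

lemma polynomial_function_mult_complex:
  fixes p q :: "real^3 \<Rightarrow> complex"
  assumes "polynomial_function p" "polynomial_function q"
  shows "polynomial_function (\<lambda>x. p x * q x)"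
  using assms unfolding complex_poly_iff
  by (simp add: real_polynomial_function_diff real_polynomial_function.intros(3,4))

lemma polynomial_function_cnj:
  fixes p :: "real^3 \<Rightarrow> complex"
  assumes "polynomial_function p"
  shows "polynomial_function (\<lambda>x. cnj (p x))"
  using assms unfolding complex_poly_iff
  by (simp add: real_polynomial_function_minus)

lemma polynomial_function_coord:
  "polynomial_function (\<lambda>x :: real^3. complex_of_real (x $ j))"
  unfolding complex_poly_iff
  by (simp add: real_polynomial_function.intros(1,2) bounded_linear_vec_nth)

lemmas complex_poly_intros = polynomial_function_mult_complex polynomial_function_cnj
  polynomial_function_coord complex_poly_has_partial(1) polynomial_function_add polynomial_function_diff
  polynomial_function_const polynomial_function_sum

text \<open>Differentiate the homogeneity relation along an axis. The factor \<open>c\<close> stays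
  on the left so that degree 0 causes no truncated exponent.\<close>

lemma partial_homogeneous_pos:
  assumes p: "\<And>y. has_partial p (partial i p y) i y"
    and hom: "\<And>c x. c > 0 \<Longrightarrow> p (c *\<^sub>R x) = complex_of_real (c ^ n) * p x" and "c > 0"
  shows "of_real c * partial i p (c *\<^sub>R x) = of_real (c ^ n) * partial i p x"
proof -
  have "((\<lambda>t. p (c *\<^sub>R x + t *\<^sub>R axis i 1)) has_vector_derivative partial i p (c *\<^sub>R x)) (at (c * 0))"
    using p[of "c *\<^sub>R x"] by (simp add: has_partial_def)
  then have "(((\<lambda>t. p (c *\<^sub>R x + t *\<^sub>R axis i 1)) \<circ> (\<lambda>t. c * t)) has_vector_derivative c *\<^sub>R partial i p (c *\<^sub>R x)) (at 0)"
    by (intro vector_diff_chain_at) (auto intro!: derivative_eq_intros)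
  moreover have "(\<lambda>t. p (c *\<^sub>R x + t *\<^sub>R axis i 1)) \<circ> (\<lambda>t. c * t) = (\<lambda>t. of_real (c ^ n) * p (x + t *\<^sub>R axis i 1))"
    by (simp add: fun_eq_iff hom[OF \<open>c > 0\<close>, symmetric] scaleR_right_distrib del: of_real_power)
  moreover have "((\<lambda>t. of_real (c ^ n) * p (x + t *\<^sub>R axis i 1)) has_vector_derivative of_real (c ^ n) * partial i p x) (at 0)"
    using p[of x] unfolding has_partial_def by (rule has_vector_derivative_mult_right)
  ultimately have "c *\<^sub>R partial i p (c *\<^sub>R x) = of_real (c ^ n) * partial i p x"
    using vector_derivative_unique_at by metis
  then show ?thesis by (simp add: scaleR_conv_of_real)
qed

text \<open>Compare the two derivatives at t = 1 of p along the ray through x: the chain rule and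
  the power t^n.\<close>

lemma euler_homogeneous:
  assumes p: "polynomial_function p"
    and hom: "\<And>c x. p (c *\<^sub>R x) = complex_of_real (c ^ n) * p x"
  shows "(\<Sum>i\<in>UNIV. of_real (x $ i) * partial i p x) = of_nat n * p x"
proof -
  have "p differentiable at x"
    by (rule differentiable_at_polynomial_function[OF p])
  then obtain p' where p': "(p has_derivative p') (at x)"
    by (auto simp: differentiable_def)
  then interpret p': bounded_linear p' by (rule has_derivative_bounded_linear)
  have ax: "p' (axis i 1) = partial i p x" for i
  proof -
    have "((\<lambda>t. x + t *\<^sub>R axis i 1) has_derivative (\<lambda>t. t *\<^sub>R axis i 1)) (at (0 :: real))"
      by (auto intro!: derivative_eq_intros)
    from has_derivative_compose[OF this, of p p'] p'
    have "((\<lambda>t. p (x + t *\<^sub>R axis i 1)) has_derivative (\<lambda>t. p' (t *\<^sub>R axis i 1))) (at 0)"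
      by simp
    then have "has_partial p (p' (axis i 1)) i x"
      by (simp add: has_partial_def has_vector_derivative_def p'.scaleR)
    then show ?thesis by (simp add: has_partial_eq)
  qed
  have "((\<lambda>t. t *\<^sub>R x) has_derivative (\<lambda>t. t *\<^sub>R x)) (at (1 :: real))"
    by (auto intro!: derivative_eq_intros)
  from has_derivative_compose[OF this, of p p'] p'
  have "((\<lambda>t. p (t *\<^sub>R x)) has_vector_derivative p' x) (at 1)"
    by (simp add: has_vector_derivative_def p'.scaleR)
  moreover have "((\<lambda>t. of_real (t ^ n) * p x) has_vector_derivative of_nat n * p x) (at 1)"
  proof -
    have "((\<lambda>t :: real. t ^ n) has_real_derivative of_nat n) (at 1)"
      by (auto intro!: derivative_eq_intros)
    then have "((\<lambda>t. complex_of_real (t ^ n)) has_vector_derivative of_real (of_nat n)) (at 1)"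
      by (rule has_vector_derivative_of_real)
    then have "((\<lambda>t. complex_of_real (t ^ n)) has_vector_derivative of_nat n) (at 1)"
      by simp
    then show ?thesis by (rule has_vector_derivative_mult_left)
  qed
  ultimately have "p' x = of_nat n * p x"
    unfolding hom using vector_derivative_unique_at by blast
  moreover have "p' x = (\<Sum>i\<in>UNIV. (x $ i) *\<^sub>R p' (axis i 1))"
    by (subst basis_expansion[of x, symmetric, unfolded scalar_mult_eq_scaleR]) (simp add: p'.sum p'.scaleR)
  ultimately show ?thesis
    by (simp add: ax scaleR_conv_of_real)
qed

section \<open>The divergence identity on the sphere\<close>

lemma integrable_compact_support:
  fixes f :: "real^3 \<Rightarrow> complex"
  assumes f: "continuous_on UNIV f" and supp: "\<And>x. norm x \<ge> 1 \<Longrightarrow> f x = 0"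
  shows "integrable lborel f"
proof -
  have "integrable lborel (\<lambda>x. indicator (cball 0 1) x *\<^sub>R f x)"
    by (intro borel_integrable_compact continuous_on_subset[OF f]) auto
  moreover have "(\<lambda>x. indicator (cball 0 1) x *\<^sub>R f x) = f"
    using supp by (auto simp: fun_eq_iff indicator_def)
  ultimately show ?thesis by simp
qed

text \<open>By translation invariance every difference quotient of \<open>f\<close> has integral 0.
  The quotients converge pointwise to \<open>D\<close>, and the mean value bound makes the
  convergence dominated.\<close>

lemma integral_partial_eq_0:
  fixes f D :: "real^3 \<Rightarrow> complex"
  assumes f: "continuous_on UNIV f" and D: "continuous_on UNIV D"
    and d: "\<And>x. has_partial f (D x) i x"
    and supp: "\<And>x. norm x \<ge> 1 \<Longrightarrow> f x = 0" "\<And>x. norm x \<ge> 1 \<Longrightarrow> D x = 0"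
  shows "(\<integral>x. D x \<partial>lborel) = 0"
proof -
  define e :: "real^3" where "e = axis i 1"
  have e: "norm e = 1" by (simp add: e_def norm_axis_1)
  have "compact (D ` cball 0 1)"
    by (intro compact_continuous_image continuous_on_subset[OF D]) auto
  then obtain L where L: "\<And>x. norm x \<le> 1 \<Longrightarrow> norm (D x) \<le> L"
    using compact_imp_bounded[of "D ` cball 0 1"] unfolding bounded_iff by (metis imageI mem_cball_0)
  have L0: "L \<ge> 0" using L[of 0] by (simp add: order_trans[OF norm_ge_zero])
  have DL: "norm (D x) \<le> L" for x
    using L[of x] supp(2)[of x] L0 by (cases "norm x \<le> 1") auto
  have line: "((\<lambda>t. f (x + t *\<^sub>R e)) has_vector_derivative D (x + s *\<^sub>R e)) (at s)" for x s
    unfolding e_def by (rule has_partial_along_line[OF d])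
  have lip: "norm (f (x + h *\<^sub>R e) - f x) \<le> L * h" if "h \<ge> 0" for x h
  proof -
    have "norm (f (x + h *\<^sub>R e) - f (x + 0 *\<^sub>R e)) \<le> L * norm (h - 0)"
    proof (rule differentiable_bound[where S = UNIV and f = "\<lambda>t. f (x + t *\<^sub>R e)" and f' = "\<lambda>s t. t *\<^sub>R D (x + s *\<^sub>R e)"])
      show "((\<lambda>t. f (x + t *\<^sub>R e)) has_derivative (\<lambda>t. t *\<^sub>R D (x + s *\<^sub>R e))) (at s within UNIV)" for s
        using line by (simp add: has_vector_derivative_def)
      show "onorm (\<lambda>t. t *\<^sub>R D (x + s *\<^sub>R e)) \<le> L" for s
      proof (rule onorm_le)
        fix t :: real
        show "norm (t *\<^sub>R D (x + s *\<^sub>R e)) \<le> L * norm t"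
          using mult_right_mono[OF DL[of "x + s *\<^sub>R e"], of "\<bar>t\<bar>"] by (simp add: mult.commute)
      qed
    qed auto
    then show ?thesis using that by simp
  qed
  define h where "h n = 1 / real (Suc n)" for n
  have h: "h n > 0" "h n \<le> 1" for n by (auto simp: h_def)
  define s where "s n x = (1 / h n) *\<^sub>R (f (x + h n *\<^sub>R e) - f x)" for n x
  have meas [measurable]: "f \<in> borel_measurable borel" "D \<in> borel_measurable borel"
    using f D by (auto intro: borel_measurable_continuous_onI)
  have fint: "integrable lborel f"
    by (rule integrable_compact_support[OF f supp(1)])
  have shift: "has_bochner_integral lborel (\<lambda>x. f (x + c)) (\<integral>x. f x \<partial>lborel)" for c
  proof -
    have "integrable (distr lborel borel ((+) c)) f"
      using fint by (simp add: lborel_distr_plus)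
    then have 1: "integrable lborel (\<lambda>x. f (c + x))"
      by (simp add: integrable_distr_eq)
    have "(\<integral>x. f (c + x) \<partial>lborel) = integral\<^sup>L (distr lborel borel ((+) c)) f"
      by (subst integral_distr) auto
    with 1 show ?thesis
      by (simp add: has_bochner_integral_iff lborel_distr_plus add.commute)
  qed
  have s0: "(\<integral>x. s n x \<partial>lborel) = 0" for n
  proof -
    have "has_bochner_integral lborel (\<lambda>x. f (x + h n *\<^sub>R e) - f x) ((\<integral>x. f x \<partial>lborel) - (\<integral>x. f x \<partial>lborel))"
      by (intro has_bochner_integral_diff shift has_bochner_integral_integrable fint)
    then have "has_bochner_integral lborel (s n) ((1 / h n) *\<^sub>R 0)"
      unfolding s_def by (intro has_bochner_integral_scaleR_right) simp
    then show ?thesis by (simp add: has_bochner_integral_iff)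
  qed
  have "(\<lambda>n. \<integral>x. s n x \<partial>lborel) \<longlonglongrightarrow> (\<integral>x. D x \<partial>lborel)"
  \<comment> \<open>The step sizes are at most 1, so the difference quotients vanish outside the
    ball of radius 2.\<close>
  proof (rule integral_dominated_convergence[where w = "\<lambda>x. indicator (cball (0 :: real^3) 2) x *\<^sub>R L"])
    show "integrable lborel (\<lambda>x :: real^3. indicat_real (cball 0 2) x *\<^sub>R L)"
      by (intro borel_integrable_compact continuous_on_const compact_cball)
    show "AE x in lborel. (\<lambda>n. s n x) \<longlonglongrightarrow> D x"
    proof (rule AE_I2)
      fix x
      have "((\<lambda>t. f (x + t *\<^sub>R e)) has_vector_derivative D (x + 0 *\<^sub>R e)) (at 0)"
        by (rule line)
      then have "((\<lambda>t. norm (f (x + t *\<^sub>R e) - f x - t *\<^sub>R D x) / norm t) \<longlongrightarrow> 0) (at 0)"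
        by (simp add: has_vector_derivative_def has_derivative_at)
      then have "((\<lambda>t. norm ((f (x + t *\<^sub>R e) - f x) /\<^sub>R t - D x)) \<longlongrightarrow> 0) (at 0)"
      proof (rule Lim_transform_eventually)
        show "\<forall>\<^sub>F t in at 0. norm (f (x + t *\<^sub>R e) - f x - t *\<^sub>R D x) / norm t =
            norm ((f (x + t *\<^sub>R e) - f x) /\<^sub>R t - D x)"
          unfolding eventually_at_filter
        proof (intro always_eventually allI impI)
          fix t :: real assume t: "t \<noteq> 0"
          have "(f (x + t *\<^sub>R e) - f x) /\<^sub>R t - D x = (f (x + t *\<^sub>R e) - f x - t *\<^sub>R D x) /\<^sub>R t"
            using t by (simp add: scaleR_diff_right)
          then show "norm (f (x + t *\<^sub>R e) - f x - t *\<^sub>R D x) / norm t =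
            norm ((f (x + t *\<^sub>R e) - f x) /\<^sub>R t - D x)"
            by (simp add: divide_inverse mult.commute)
        qed
      qed
      then have "((\<lambda>t. (f (x + t *\<^sub>R e) - f x) /\<^sub>R t) \<longlongrightarrow> D x) (at 0)"
        by (simp add: tendsto_norm_zero_iff Lim_null[symmetric])
      moreover have "filterlim h (at 0) sequentially"
      proof -
        have "h \<longlonglongrightarrow> 0" unfolding h_def by (rule lim_1_over_n[THEN LIMSEQ_Suc])
        moreover have "\<forall>\<^sub>F n in sequentially. h n \<noteq> 0"
          using h(1) by (auto intro!: always_eventually simp: less_imp_neq[THEN not_sym])
        ultimately show ?thesis by (simp add: filterlim_at)
      qed
      ultimately have "(\<lambda>n. (f (x + h n *\<^sub>R e) - f x) /\<^sub>R h n) \<longlonglongrightarrow> D x"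
        by (rule filterlim_compose)
      then show "(\<lambda>n. s n x) \<longlonglongrightarrow> D x"
        by (simp add: s_def divide_inverse)
    qed
    show "AE x in lborel. norm (s n x) \<le> indicat_real (cball 0 2) x *\<^sub>R L" for n
    proof (rule AE_I2)
      fix x
      show "norm (s n x) \<le> indicat_real (cball 0 2) x *\<^sub>R L"
      proof (cases "norm x \<le> 2")
        case True
        have "norm (s n x) \<le> (1 / h n) * (L * h n)"
          using lip[of "h n" x] h[of n] by (simp add: s_def pos_divide_le_eq)
        then show ?thesis using True h[of n] by simp
      next
        case False
        have "norm x \<le> norm (x + h n *\<^sub>R e) + norm (h n *\<^sub>R e)"
          using norm_triangle_ineq4[of "x + h n *\<^sub>R e" "h n *\<^sub>R e"] by simp
        then have "norm (x + h n *\<^sub>R e) \<ge> 1"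
          using False h[of n] e by simp
        then show ?thesis using False supp(1) by (simp add: s_def)
      qed
    qed
  qed (auto simp: s_def)
  then show ?thesis
    by (simp add: s0 LIMSEQ_const_iff)
qed

lemma max_square_has_derivative:
  "((\<lambda>s :: real. (max 0 s)\<^sup>2) has_real_derivative 2 * max 0 s) (at s)"
proof -
  consider "s < 0" | "s > 0" | "s = 0" by linarith
  then show ?thesis
  proof cases
    case 1
    have "((\<lambda>s :: real. 0) has_real_derivative 2 * max 0 s) (at s)"
      using 1 by simp
    then show ?thesis
      by (rule has_field_derivative_transform_within_open[of _ _ _ "{..<0}"]) (use 1 in auto)
  next
    case 2
    have "((\<lambda>s :: real. s\<^sup>2) has_real_derivative 2 * max 0 s) (at s)"
      using 2 by (auto intro!: derivative_eq_intros)
    then show ?thesis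
      by (rule has_field_derivative_transform_within_open[of _ _ _ "{0<..}"]) (use 2 in auto)
  next
    case 3
    have "((\<lambda>t :: real. (max 0 t)\<^sup>2 / t) \<longlongrightarrow> 0) (at 0)"
    proof (rule Lim_null_comparison)
      show "\<forall>\<^sub>F t in at 0. norm ((max 0 t)\<^sup>2 / t) \<le> \<bar>t :: real\<bar>"
        by (intro always_eventually allI) (auto simp: max_def power2_eq_square)
      show "((\<lambda>t :: real. \<bar>t\<bar>) \<longlongrightarrow> 0) (at 0)"
        by (rule tendsto_eq_intros | simp)+
    qed
    then show ?thesis
      using 3 by (simp add: has_field_derivative_iff)
  qed
qed

text \<open>The square makes the truncated function continuously differentiable across the unit
  sphere, which is the smoothness that \<open>integral_partial_eq_0\<close> asks for.\<close>

definition bump :: "real^3 \<Rightarrow> complex" where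
  "bump x = of_real ((max 0 (1 - x \<bullet> x))\<^sup>2)"

lemma bump_has_partial:
  "has_partial bump (of_real (- 4 * max 0 (1 - x \<bullet> x) * x $ i)) i x"
proof -
  have "((\<lambda>t. 1 - (x + t *\<^sub>R axis i 1) \<bullet> (x + t *\<^sub>R axis i 1)) has_real_derivative - 2 * x $ i) (at 0)"
    unfolding inner_add_left inner_add_right inner_scaleR_left inner_scaleR_right
    by (auto intro!: derivative_eq_intros simp: inner_axis inner_axis')
  then have 1: "((\<lambda>t. 1 - (x + t *\<^sub>R axis i 1) \<bullet> (x + t *\<^sub>R axis i 1)) has_real_derivative - 2 * x $ i) (at 0 within UNIV)"
    by simp
  have "((\<lambda>t. (max 0 (1 - (x + t *\<^sub>R axis i 1) \<bullet> (x + t *\<^sub>R axis i 1)))\<^sup>2) has_real_derivative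
     2 * max 0 (1 - (x + 0 *\<^sub>R axis i 1) \<bullet> (x + 0 *\<^sub>R axis i 1)) * (- 2 * x $ i)) (at 0)"
    by (rule DERIV_chain2[OF max_square_has_derivative 1])
  then have "((\<lambda>t. bump (x + t *\<^sub>R axis i 1)) has_vector_derivative
     of_real (2 * max 0 (1 - (x + 0 *\<^sub>R axis i 1) \<bullet> (x + 0 *\<^sub>R axis i 1)) * (- 2 * x $ i))) (at 0)"
    unfolding bump_def by (rule has_vector_derivative_of_real)
  then show ?thesis by (simp add: has_partial_def algebra_simps)
qed

text \<open>The radial moments, with Jacobian r^2, of the bump and of its gradient up to sign, for
  fields of the degrees that occur below. Their ratio is d + 3, the constant in the divergence
  identity.\<close>

lemma integral_power_combination:
  "(LINT r:{0..1}|lborel. complex_of_real (r\<^sup>2) * of_real ((1 - r\<^sup>2)\<^sup>2 * r ^ d))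
     = of_real (8 / ((real d + 3) * (real d + 5) * (real d + 7)))"
  "(LINT r:{0..1}|lborel. complex_of_real (r\<^sup>2) * of_real (4 * (1 - r\<^sup>2) * r ^ (d + 2)))
     = of_real (8 / ((real d + 5) * (real d + 7)))"
proof -
  have D: "((\<lambda>r. r ^ Suc m / Suc m) has_real_derivative r ^ m) (at r within A)" for m r A
    using DERIV_cdivide[OF DERIV_pow[of "Suc m" r A], of "real (Suc m)"] by (simp del: of_nat_Suc power_Suc)
  have D': "((\<lambda>r. of_real (G r)) has_vector_derivative complex_of_real (g r)) (at r within A)"
    if "(G has_real_derivative g r) (at r within A)" for G g r A
    using that by (rule has_vector_derivative_of_real)
  have FTC: "(LINT r:{0..1}|lborel. complex_of_real (g r)) = of_real (G 1 - G 0)"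
    if "\<And>r. (G has_real_derivative g r) (at r within {0..1})" "continuous_on {0..1} g" for G g
    unfolding set_lebesgue_integral_def
    by (subst integral_FTC_Icc[where F = "\<lambda>r. of_real (G r)"])
      (auto intro!: D' that continuous_on_of_real)
  have eq1: "complex_of_real (r\<^sup>2) * of_real ((1 - r\<^sup>2)\<^sup>2 * r ^ d) =
      of_real (r ^ (d + 2) - 2 * r ^ (d + 4) + r ^ (d + 6))" for r
    unfolding of_real_mult[symmetric] of_real_eq_iff by (simp add: power_add eval_nat_numeral algebra_simps)
  have eq2: "complex_of_real (r\<^sup>2) * of_real (4 * (1 - r\<^sup>2) * r ^ (d + 2)) =
      of_real (4 * (r ^ (d + 4) - r ^ (d + 6)))" for r
    unfolding of_real_mult[symmetric] of_real_eq_iff by (simp add: power_add eval_nat_numeral algebra_simps)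
  have "(LINT r:{0..1}|lborel. complex_of_real (r ^ (d + 2) - 2 * r ^ (d + 4) + r ^ (d + 6)))
      = of_real ((1 ^ Suc (d + 2) / Suc (d + 2) - 2 * (1 ^ Suc (d + 4) / Suc (d + 4)) + 1 ^ Suc (d + 6) / Suc (d + 6))
         - (0 ^ Suc (d + 2) / Suc (d + 2) - 2 * (0 ^ Suc (d + 4) / Suc (d + 4)) + 0 ^ Suc (d + 6) / Suc (d + 6)))"
    by (rule FTC, intro DERIV_add DERIV_diff DERIV_cmult D) (intro continuous_intros)
  also have "\<dots> = of_real (1 / (real d + 3) - 2 * (1 / (real d + 5)) + 1 / (real d + 7))"
    by (simp only: power_0_Suc power_one) (simp add: add.commute)
  also have "1 / (real d + 3) - 2 * (1 / (real d + 5)) + 1 / (real d + 7) = 8 / ((real d + 3) * (real d + 5) * (real d + 7))"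
    by (simp add: divide_simps) (simp add: algebra_simps)
  finally show "(LINT r:{0..1}|lborel. complex_of_real (r\<^sup>2) * of_real ((1 - r\<^sup>2)\<^sup>2 * r ^ d))
     = of_real (8 / ((real d + 3) * (real d + 5) * (real d + 7)))"
    by (simp only: eq1)
  have "(LINT r:{0..1}|lborel. complex_of_real (4 * (r ^ (d + 4) - r ^ (d + 6))))
      = of_real (4 * (1 ^ Suc (d + 4) / Suc (d + 4) - 1 ^ Suc (d + 6) / Suc (d + 6))
         - 4 * (0 ^ Suc (d + 4) / Suc (d + 4) - 0 ^ Suc (d + 6) / Suc (d + 6)))"
    by (rule FTC, intro DERIV_add DERIV_diff DERIV_cmult D) (intro continuous_intros)
  also have "\<dots> = of_real (4 * (1 / (real d + 5) - 1 / (real d + 7)))"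
    by (simp only: power_0_Suc power_one) (simp add: add.commute)
  also have "4 * (1 / (real d + 5) - 1 / (real d + 7)) = 8 / ((real d + 5) * (real d + 7))"
    by (simp add: divide_simps)
  finally show "(LINT r:{0..1}|lborel. complex_of_real (r\<^sup>2) * of_real (4 * (1 - r\<^sup>2) * r ^ (d + 2)))
     = of_real (8 / ((real d + 5) * (real d + 7)))"
    by (simp only: eq2)
qed


lemma continuous_on_complex_poly:
  fixes p :: "real^3 \<Rightarrow> complex"
  shows "polynomial_function p \<Longrightarrow> continuous_on A p"
  by (rule continuous_on_polymonial_function)

lemma norm_scale_sgn: "x = norm x *\<^sub>R sgn (x :: real^3)"
  by (cases "x = 0") (simp_all add: sgn_div_norm)

text \<open>Testing against a radial bump function and integrating in polar coordinates avoids surface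
  integrals altogether.\<close>

lemma sphere_divergence:
  fixes F :: "3 \<Rightarrow> real^3 \<Rightarrow> complex"
  assumes poly: "\<And>i. polynomial_function (F i)"
    and hom: "\<And>i c x. c > 0 \<Longrightarrow> F i (c *\<^sub>R x) = of_real (c ^ Suc d) * F i x"
  shows "sphere_integral (\<lambda>x. \<Sum>i\<in>UNIV. partial i (F i) x) =
    of_nat (d + 3) * sphere_integral (\<lambda>x. \<Sum>i\<in>UNIV. of_real (x $ i) * F i x)"
proof -
  define Q1 where "Q1 x = (\<Sum>i\<in>UNIV. partial i (F i) x)" for x
  define Q2 where "Q2 x = (\<Sum>i\<in>UNIV. of_real (x $ i) * F i x)" for x
  have cQ: "continuous_on UNIV Q1" "continuous_on UNIV Q2"
    unfolding Q1_def Q2_def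
    by (intro continuous_on_complex_poly complex_poly_intros poly finite)+
  \<comment> \<open>The product rule for \<open>bump * F i\<close>, whose derivative has integral 0.
    Summed over \<open>i\<close>, the first term carries the divergence, of degree d, and the second
    the scalar product with x, of degree d + 2.\<close>
  define D where "D i x = bump x * partial i (F i) x + of_real (- 4 * max 0 (1 - x \<bullet> x) * x $ i) * F i x" for i x
  have out: "max 0 (1 - x \<bullet> x) = 0" if "norm x \<ge> 1" for x :: "real^3"
  proof -
    have "1 \<le> norm x ^ 2" using that by (simp add: power_le_one_iff one_le_power)
    then show ?thesis by (simp add: dot_square_norm)
  qed
  have hp: "has_partial (\<lambda>x. bump x * F i x) (D i x) i x" for i x
    unfolding D_def by (intro has_partial_mult bump_has_partial complex_poly_has_partial(2) poly)
  have cb: "continuous_on UNIV bump"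
    unfolding bump_def by (intro continuous_intros)
  have cD: "continuous_on UNIV (D i)" for i
    unfolding D_def by (intro continuous_intros cb continuous_on_complex_poly complex_poly_has_partial(1) poly)
  have D0: "D i x = 0" if "norm x \<ge> 1" for i x
    using out[OF that] by (simp add: D_def bump_def)
  have iD: "(\<integral>x. D i x \<partial>lborel) = 0" for i
  proof (rule integral_partial_eq_0[OF _ cD hp])
    show "continuous_on UNIV (\<lambda>x. bump x * F i x)"
      by (intro continuous_intros cb continuous_on_complex_poly poly)
    show "bump x * F i x = 0" if "norm x \<ge> 1" for x
      using out[OF that] by (simp add: bump_def)
  qed (rule D0)
  have cancel: "a = c * b" if "a * k = b * m" "m = c * k" "k \<noteq> 0" for a b c k m :: complex
    using that by (metis mult.assoc mult.commute mult_right_cancel)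
  have "(\<integral>x. (\<Sum>i\<in>UNIV. D i x) \<partial>lborel) = 0"
    by (subst Bochner_Integration.integral_sum) (auto intro!: integrable_compact_support cD D0 simp: iD)
  define f1 where "f1 r = complex_of_real ((1 - r\<^sup>2)\<^sup>2 * r ^ d)" for r
  define f2 where "f2 r = complex_of_real (4 * (1 - r\<^sup>2) * r ^ (d + 2))" for r
  have si: "set_integrable lborel {0..1} (\<lambda>r. of_real (r\<^sup>2) * f1 r)" "set_integrable lborel {0..1} (\<lambda>r. of_real (r\<^sup>2) * f2 r)"
    unfolding f1_def f2_def by (intro borel_integrable_atLeastAtMost' continuous_intros)+
  have "has_bochner_integral lborel
      (\<lambda>x. indicator {0..1} (norm x) *\<^sub>R (f1 (norm x) * Q1 (sgn x))
         - indicator {0..1} (norm x) *\<^sub>R (f2 (norm x) * Q2 (sgn x)))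
      (sphere_integral Q1 * (LINT r:{0..1}|lborel. of_real (r\<^sup>2) * f1 r)
        - sphere_integral Q2 * (LINT r:{0..1}|lborel. of_real (r\<^sup>2) * f2 r))" (is "has_bochner_integral _ ?f ?v")
    by (intro has_bochner_integral_diff polar_set cQ si) auto
  moreover have "(\<Sum>i\<in>UNIV. D i x) = ?f x" if "x \<noteq> 0" for x
  proof -
    define c where "c = norm x"
    have c: "c > 0" using that by (simp add: c_def)
    have x: "x = c *\<^sub>R sgn x" unfolding c_def by (rule norm_scale_sgn)
    have 1: "partial i (F i) x = of_real (c ^ d) * partial i (F i) (sgn x)" for i
    proof -
      have "of_real c * partial i (F i) (c *\<^sub>R sgn x) = of_real (c ^ Suc d) * partial i (F i) (sgn x)"
        by (rule partial_homogeneous_pos[OF complex_poly_has_partial(2)[OF poly] hom c]) assumption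
      then show ?thesis using c x by (simp add: mult.assoc)
    qed
    have 2: "of_real (x $ i) * F i x = of_real (c ^ (d + 2)) * (of_real (sgn x $ i) * F i (sgn x))" for i
    proof -
      have "x $ i = c * sgn x $ i"
        by (metis x vector_scaleR_component real_scaleR_def)
      moreover have "F i x = of_real (c ^ Suc d) * F i (sgn x)"
        using hom[OF c, of i "sgn x"] x by simp
      ultimately show ?thesis by simp
    qed
    have xx: "x \<bullet> x = c\<^sup>2" by (simp add: c_def dot_square_norm)
    have "(\<Sum>i\<in>UNIV. D i x) = bump x * (\<Sum>i\<in>UNIV. partial i (F i) x)
        - of_real (4 * max 0 (1 - c\<^sup>2)) * (\<Sum>i\<in>UNIV. of_real (x $ i) * F i x)"
    proof -
      have "D i x = bump x * partial i (F i) x - of_real (4 * max 0 (1 - c\<^sup>2)) * (of_real (x $ i) * F i x)" for i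
        unfolding D_def xx by simp
      then show ?thesis
        by (simp only: sum_subtractf sum_distrib_left)
    qed
    also have "(\<Sum>i\<in>UNIV. partial i (F i) x) = of_real (c ^ d) * Q1 (sgn x)"
      unfolding Q1_def sum_distrib_left by (intro sum.cong 1 refl)
    also have "(\<Sum>i\<in>UNIV. of_real (x $ i) * F i x) = of_real (c ^ (d + 2)) * Q2 (sgn x)"
      unfolding Q2_def sum_distrib_left by (intro sum.cong 2 refl)
    also have "bump x * (of_real (c ^ d) * Q1 (sgn x)) - of_real (4 * max 0 (1 - c\<^sup>2)) * (of_real (c ^ (d + 2)) * Q2 (sgn x))
       = indicator {0..1} c *\<^sub>R (f1 c * Q1 (sgn x)) - indicator {0..1} c *\<^sub>R (f2 c * Q2 (sgn x))"
    proof (cases "c \<le> 1")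
      case True
      then have "c\<^sup>2 \<le> 1" using c by (simp add: power_le_one)
      then show ?thesis using True c
        by (simp add: bump_def xx f1_def f2_def max_def)
    next
      case False
      then show ?thesis using out[of x] by (simp add: bump_def xx c_def[symmetric])
    qed
    finally show ?thesis by (simp add: c_def)
  qed
  then have "AE x in lborel. ?f x = (\<Sum>i\<in>UNIV. D i x)"
    using AE_lborel_singleton[of "0 :: real^3"] by (auto elim!: eventually_mono)
  moreover have "(\<lambda>x. \<Sum>i\<in>UNIV. D i x) \<in> borel_measurable lborel"
    using cD by (auto intro!: borel_measurable_continuous_onI continuous_on_sum)
  ultimately have "has_bochner_integral lborel (\<lambda>x. \<Sum>i\<in>UNIV. D i x) ?v"
    using has_bochner_integral_cong_AE[of ?f lborel "\<lambda>x. \<Sum>i\<in>UNIV. D i x" ?v]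
    by (meson borel_measurable_has_bochner_integral)
  then have "?v = 0"
    using \<open>(\<integral>x. (\<Sum>i\<in>UNIV. D i x) \<partial>lborel) = 0\<close> by (simp add: has_bochner_integral_iff)
  then have "sphere_integral Q1 * of_real (8 / ((real d + 3) * (real d + 5) * (real d + 7)))
      = sphere_integral Q2 * of_real (8 / ((real d + 5) * (real d + 7)))"
    unfolding f1_def f2_def integral_power_combination by simp
  moreover have "complex_of_real (8 / ((real d + 5) * (real d + 7))) = of_nat (d + 3) * of_real (8 / ((real d + 3) * (real d + 5) * (real d + 7)))"
  proof -
    have "8 / ((real d + 5) * (real d + 7)) = real (d + 3) * (8 / ((real d + 3) * (real d + 5) * (real d + 7)))"
      by (simp add: divide_simps)
    then show ?thesis by (simp only: of_real_mult of_real_of_nat_eq)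
  qed
  moreover have "complex_of_real (8 / ((real d + 3) * (real d + 5) * (real d + 7))) \<noteq> 0"
    unfolding of_real_eq_0_iff by simp
  ultimately have "sphere_integral Q1 = of_nat (d + 3) * sphere_integral Q2"
    by (rule cancel)
  then show ?thesis
    by (simp only: Q1_def[abs_def] Q2_def[abs_def])
qed

section \<open>Vector spherical harmonics\<close>

definition cdot :: "complex^3 \<Rightarrow> complex^3 \<Rightarrow> complex" where
  "cdot u v = (\<Sum>i\<in>UNIV. u $ i * cnj (v $ i))"

definition harm_poly :: "nat \<Rightarrow> (real^3 \<Rightarrow> complex) \<Rightarrow> bool" where
  "harm_poly n p \<longleftrightarrow> polynomial_function p \<and>
     (\<forall>c x. p (c *\<^sub>R x) = complex_of_real (c ^ n) * p x) \<and> (\<forall>x. laplacian p x = 0)"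

text \<open>For a harmonic homogeneous \<open>p\<close> of degree \<open>n\<close>, the restrictions of these three fields to the unit
  sphere are the vector spherical harmonics; \<open>tang_field\<close> is tangential only there.\<close>

definition cross_field :: "(real^3 \<Rightarrow> complex) \<Rightarrow> real^3 \<Rightarrow> complex^3" where
  "cross_field p x = vector
     [partial 2 p x * of_real (x $ 3) - partial 3 p x * of_real (x $ 2),
      partial 3 p x * of_real (x $ 1) - partial 1 p x * of_real (x $ 3),
      partial 1 p x * of_real (x $ 2) - partial 2 p x * of_real (x $ 1)]"

definition tang_field :: "nat \<Rightarrow> (real^3 \<Rightarrow> complex) \<Rightarrow> real^3 \<Rightarrow> complex^3" where
  "tang_field n p x = (\<chi> i. partial i p x - of_nat n * p x * of_real (x $ i))"

definition rad_field :: "(real^3 \<Rightarrow> complex) \<Rightarrow> real^3 \<Rightarrow> complex^3" where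
  "rad_field p x = p x *s cvec x"

lemma harm_polyD:
  assumes "harm_poly n p"
  shows "polynomial_function p" "p (c *\<^sub>R x) = complex_of_real (c ^ n) * p x"
    "(\<Sum>i\<in>UNIV. partial i (partial i p) x) = 0"
  using assms by (auto simp: harm_poly_def laplacian_def)

lemma harm_poly_partial:
  assumes "harm_poly n p"
  shows "polynomial_function (partial i p)" "has_partial p (partial i p x) i x"
    "polynomial_function (partial i (partial j p))" "has_partial (partial j p) (partial i (partial j p) x) i x"
    "partial i (partial j p) x = partial j (partial i p) x"
  using complex_poly_has_partial[OF harm_polyD(1)[OF assms]]
    complex_poly_has_partial[OF complex_poly_has_partial(1)[OF harm_polyD(1)[OF assms]]] by blast+

lemma harm_poly_partial_scale:
  assumes "harm_poly n p" "n \<ge> 1" "c > 0"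
  shows "partial i p (c *\<^sub>R x) = of_real (c ^ (n - 1)) * partial i p x"
proof -
  have "of_real c * partial i p (c *\<^sub>R x) = of_real (c ^ n) * partial i p x"
    by (rule partial_homogeneous_pos) (use harm_poly_partial(2)[OF assms(1)] harm_polyD(2)[OF assms(1)] assms in auto)
  moreover have "c ^ n = c * c ^ (n - 1)"
    using assms(2) by (cases n) auto
  ultimately show ?thesis using assms(3) by (simp add: mult.assoc)
qed

lemma harm_poly_euler:
  assumes "harm_poly n p"
  shows "(\<Sum>i\<in>UNIV. of_real (x $ i) * partial i p x) = of_nat n * p x"
  by (rule euler_homogeneous[OF harm_polyD(1,2)[OF assms]])

lemma partial_cnj:
  assumes "\<And>x. has_partial p (partial i p x) i x"
  shows "has_partial (\<lambda>x. cnj (p x)) (cnj (partial i p x)) i x"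
  by (rule has_partial_bounded_linear[OF bounded_linear_cnj assms])

section \<open>Integrals over the unit sphere and pairings of angular fields\<close>

lemma sphere_integral_add:
  assumes "continuous_on UNIV f" "continuous_on UNIV g"
  shows "sphere_integral (\<lambda>x. f x + g x) = sphere_integral f + sphere_integral g"
    and "sphere_integral (\<lambda>x. f x - g x) = sphere_integral f - sphere_integral g"
proof -
  have "integrable lborel (\<lambda>x. indicator (ball 0 1) x *\<^sub>R f (sgn x))" if f: "continuous_on UNIV f"
    for f :: "real^3 \<Rightarrow> complex"
  proof -
    obtain B where "\<And>x. norm (f (sgn x)) \<le> B"
      using continuous_direction_bounded[OF f] by blast
    then show ?thesis
      by (intro integrable_direction_ball borel_measurable_continuous_onI f)
  qed
  from this[OF assms(1)] this[OF assms(2)]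
  show "sphere_integral (\<lambda>x. f x + g x) = sphere_integral f + sphere_integral g"
    "sphere_integral (\<lambda>x. f x - g x) = sphere_integral f - sphere_integral g"
    unfolding sphere_integral_def set_lebesgue_integral_def
    by (simp_all add: scaleR_add_right scaleR_diff_right algebra_simps)
qed

lemma sphere_integral_cmult: "sphere_integral (\<lambda>x. c * f x) = c * sphere_integral f"
proof -
  have "(\<lambda>x. indicat_real (ball 0 1) x *\<^sub>R (c * f (sgn x))) = (\<lambda>x. c * (indicat_real (ball 0 1) x *\<^sub>R f (sgn x)))"
    by (simp add: fun_eq_iff scaleR_conv_of_real)
  then show ?thesis
    by (simp only: sphere_integral_def set_lebesgue_integral_def integral_mult_right_zero) simp
qed

text \<open>The cone measure also evaluates the integrand at \<open>sgn 0 = 0\<close>, off the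
  sphere. This concerns a single point, and altering one value preserves measurability.\<close>

lemma sphere_integral_cong:
  assumes f: "continuous_on UNIV f" and eq: "\<And>x. norm x = 1 \<Longrightarrow> g x = f x"
  shows "sphere_integral g = sphere_integral f"
proof -
  have [measurable]: "f \<in> borel_measurable borel"
    using f by (rule borel_measurable_continuous_onI)
  have 1: "(\<lambda>x. indicator (ball 0 1) x *\<^sub>R f (sgn x)) \<in> borel_measurable borel"
    by measurable
  then have "(\<lambda>x. if x = 0 then g 0 else indicator (ball 0 1) x *\<^sub>R f (sgn x)) \<in> borel_measurable borel"
    by measurable
  also have "(\<lambda>x. if x = 0 then g 0 else indicator (ball 0 1) x *\<^sub>R f (sgn x)) = (\<lambda>x. indicator (ball 0 1) x *\<^sub>R g (sgn x))"
    by (auto simp: fun_eq_iff eq norm_sgn indicator_def)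
  finally have 2: "(\<lambda>x. indicator (ball 0 1) x *\<^sub>R g (sgn x)) \<in> borel_measurable borel" .
  have "AE x in lborel. indicator (ball 0 1) x *\<^sub>R g (sgn x) = indicator (ball 0 1) x *\<^sub>R f (sgn x)"
    using AE_lborel_singleton[of "0 :: real^3"] by eventually_elim (simp add: eq norm_sgn)
  then show ?thesis
    unfolding sphere_integral_def set_lebesgue_integral_def using 1 2 by (subst integral_cong_AE) auto
qed

lemma sphere_integral_cnj: "sphere_integral (\<lambda>x. cnj (f x)) = cnj (sphere_integral f)"
proof -
  have eq: "(\<lambda>x. indicat_real (ball 0 1) x *\<^sub>R cnj (f (sgn x))) = (\<lambda>x. cnj (indicat_real (ball 0 1) x *\<^sub>R f (sgn x)))"
    by (simp add: fun_eq_iff scaleR_conv_of_real)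
  show ?thesis
    unfolding sphere_integral_def set_lebesgue_integral_def eq
    by (simp only: Bochner_Integration.integral_cnj complex_cnj_mult complex_cnj_numeral)
qed

text \<open>Apply the divergence identity to the gradient of p conj(q). By harmonicity its
  divergence is twice the scalar product of the gradients; by Euler its radial component is n + n'
  times p conj(q). Its degree n + n' - 1 is \<open>Suc d\<close>, so the factor d + 3 is n + n' +
  1.\<close>

lemma sphere_grad_grad:
  assumes p: "harm_poly n p" and q: "harm_poly n' q" and n: "n \<ge> 1" "n' \<ge> 1"
  shows "2 * sphere_integral (\<lambda>x. \<Sum>i\<in>UNIV. partial i p x * cnj (partial i q x)) =
     of_nat ((n + n') * (n + n' + 1)) * sphere_integral (\<lambda>x. p x * cnj (q x))"
proof -
  note pp = harm_polyD(1)[OF p] harm_polyD(1)[OF q] harm_poly_partial(1)[OF p] harm_poly_partial(1)[OF q]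
  define F where "F i x = partial i p x * cnj (q x) + p x * cnj (partial i q x)" for i x
  have hF: "has_partial (F i) ((partial i p x * cnj (partial i q x) + partial i (partial i p) x * cnj (q x))
      + (p x * cnj (partial i (partial i q) x) + partial i p x * cnj (partial i q x))) i x" for i x
    unfolding F_def
    by (intro has_partial_add has_partial_mult partial_cnj harm_poly_partial(2,4)[OF p] harm_poly_partial(2,4)[OF q])
  define d where "d = n + n' - 2"
  have d: "n + n' = d + 2" and d1: "d + 2 + 1 = d + 3" using n by (simp_all add: d_def)
  have "sphere_integral (\<lambda>x. \<Sum>i\<in>UNIV. partial i (F i) x) =
    of_nat (d + 3) * sphere_integral (\<lambda>x. \<Sum>i\<in>UNIV. of_real (x $ i) * F i x)"
  proof (rule sphere_divergence)
    show "polynomial_function (F i)" for i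
      unfolding F_def by (intro complex_poly_intros pp)
    show "F i (c *\<^sub>R x) = complex_of_real (c ^ Suc d) * F i x" if "c > 0" for i c x
    proof -
      have "n - 1 + n' = Suc d" "n + (n' - 1) = Suc d"
        using n by (auto simp: d_def)
      then have "c ^ (n - 1) * c ^ n' = c ^ Suc d" "c ^ n * c ^ (n' - 1) = c ^ Suc d"
        by (simp_all only: power_add[symmetric])
      then have *: "complex_of_real (c ^ (n - 1)) * of_real (c ^ n') = of_real (c ^ Suc d)"
        "complex_of_real (c ^ n) * of_real (c ^ (n' - 1)) = of_real (c ^ Suc d)"
        by (metis of_real_mult)+
      have "F i (c *\<^sub>R x) = (complex_of_real (c ^ (n - 1)) * of_real (c ^ n')) * (partial i p x * cnj (q x))
         + (complex_of_real (c ^ n) * of_real (c ^ (n' - 1))) * (p x * cnj (partial i q x))"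
        unfolding F_def harm_poly_partial_scale[OF p n(1) that] harm_poly_partial_scale[OF q n(2) that]
          harm_polyD(2)[OF p] harm_polyD(2)[OF q] complex_cnj_mult complex_cnj_complex_of_real
        by (simp only: mult_ac)
      then show ?thesis
        unfolding * F_def by (simp only: distrib_left)
    qed
  qed
  also have "(\<lambda>x. \<Sum>i\<in>UNIV. partial i (F i) x) = (\<lambda>x. 2 * (\<Sum>i\<in>UNIV. partial i p x * cnj (partial i q x)))"
  proof
    fix x
    have "(\<Sum>i\<in>UNIV. partial i (F i) x) = 2 * (\<Sum>i\<in>UNIV. partial i p x * cnj (partial i q x))
       + (\<Sum>i\<in>UNIV. partial i (partial i p) x) * cnj (q x) + p x * cnj (\<Sum>i\<in>UNIV. partial i (partial i q) x)"
      unfolding has_partial_eq[OF hF] by (simp add: sum_3 algebra_simps)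
    then show "(\<Sum>i\<in>UNIV. partial i (F i) x) = 2 * (\<Sum>i\<in>UNIV. partial i p x * cnj (partial i q x))"
      by (simp add: harm_polyD(3)[OF p] harm_polyD(3)[OF q])
  qed
  also have "(\<lambda>x. \<Sum>i\<in>UNIV. of_real (x $ i) * F i x) = (\<lambda>x. of_nat (n + n') * (p x * cnj (q x)))"
  proof
    fix x
    have "(\<Sum>i\<in>UNIV. of_real (x $ i) * F i x) = (\<Sum>i\<in>UNIV. of_real (x $ i) * partial i p x) * cnj (q x)
       + p x * cnj (\<Sum>i\<in>UNIV. of_real (x $ i) * partial i q x)"
      by (simp add: F_def sum_3 algebra_simps)
    then show "(\<Sum>i\<in>UNIV. of_real (x $ i) * F i x) = of_nat (n + n') * (p x * cnj (q x))"
      unfolding harm_poly_euler[OF p] harm_poly_euler[OF q] by (simp add: algebra_simps)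
  qed
  finally show ?thesis
    unfolding sphere_integral_cmult
    by (simp only: d d1 of_nat_mult mult.assoc mult.left_commute[of "of_nat (d + 3)"])
qed

text \<open>Apply the divergence identity to conj(q) times the gradient of p crossed with x. That
  cross product is orthogonal to x, so the right side vanishes; it is divergence free by symmetry of
  second derivatives, so only the derivatives falling on conj(q) remain.\<close>

lemma sphere_cross_grad:
  assumes p: "harm_poly n p" and q: "harm_poly n' q" and n: "n \<ge> 1" "n' \<ge> 1"
  shows "sphere_integral (\<lambda>x. \<Sum>i\<in>UNIV. cross_field p x $ i * cnj (partial i q x)) = 0"
proof -
  note pp = harm_polyD(1)[OF p] harm_polyD(1)[OF q] harm_poly_partial(1)[OF p] harm_poly_partial(1)[OF q]
  define F where "F i x = cross_field p x $ i * cnj (q x)" for i x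
  define G where "G a b x = partial a p x * complex_of_real (x $ b)" for a b x
  have hG: "has_partial (G a b) (partial a p x * (if i = b then 1 else 0) + partial i (partial a p) x * of_real (x $ b)) i x" for i a b x
    unfolding G_def by (intro has_partial_mult has_partial_coord harm_poly_partial(4)[OF p])
  have hH: "has_partial (\<lambda>x. (G a b x - G c e x) * cnj (q x))
     ((G a b x - G c e x) * cnj (partial i q x) +
      ((partial a p x * (if i = b then 1 else 0) + partial i (partial a p) x * of_real (x $ b))
       - (partial c p x * (if i = e then 1 else 0) + partial i (partial c p) x * of_real (x $ e))) * cnj (q x)) i x" for a b c e i x
    by (intro has_partial_mult has_partial_diff hG partial_cnj harm_poly_partial(2)[OF q])
  have F: "F 1 = (\<lambda>x. (G 2 3 x - G 3 2 x) * cnj (q x))" "F 2 = (\<lambda>x. (G 3 1 x - G 1 3 x) * cnj (q x))"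
     "F 3 = (\<lambda>x. (G 1 2 x - G 2 1 x) * cnj (q x))"
    by (auto simp: F_def G_def cross_field_def fun_eq_iff)
  have "sphere_integral (\<lambda>x. \<Sum>i\<in>UNIV. partial i (F i) x) =
    of_nat (n + n' - 1 + 3) * sphere_integral (\<lambda>x. \<Sum>i\<in>UNIV. of_real (x $ i) * F i x)"
  proof (rule sphere_divergence)
    have "polynomial_function (\<lambda>x. (G a b x - G c e x) * cnj (q x))" for a b c e
      unfolding G_def by (intro complex_poly_intros pp)
    then have "polynomial_function (F 1)" "polynomial_function (F 2)" "polynomial_function (F 3)"
      unfolding F by blast+
    then show "polynomial_function (F i)" for i
      using exhaust_3[of i] by auto
    show "F i (c *\<^sub>R x) = complex_of_real (c ^ Suc (n + n' - 1)) * F i x" if "c > 0" for i c x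
    proof -
      have "c ^ (n - 1) * c * c ^ n' = c ^ Suc (n + n' - 1)"
        using n by (cases n) (auto simp: power_add)
      then have *: "complex_of_real (c ^ (n - 1)) * of_real c * of_real (c ^ n') = of_real (c ^ Suc (n + n' - 1))"
        by (metis of_real_mult)
      have G: "G a b (c *\<^sub>R x) = (complex_of_real (c ^ (n - 1)) * of_real c) * G a b x" for a b
        unfolding G_def harm_poly_partial_scale[OF p n(1) that] vector_scaleR_component real_scaleR_def of_real_mult
        by (simp only: mult_ac)
      have "(G a b (c *\<^sub>R x) - G d e (c *\<^sub>R x)) * cnj (q (c *\<^sub>R x)) =
         (complex_of_real (c ^ (n - 1)) * of_real c * of_real (c ^ n')) * ((G a b x - G d e x) * cnj (q x))" for a b d e
        unfolding G harm_polyD(2)[OF q] complex_cnj_mult complex_cnj_complex_of_real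
        by (simp only: left_diff_distrib right_diff_distrib mult_ac)
      then show ?thesis unfolding * using exhaust_3[of i] by (auto simp: F)
    qed
  qed
  also have "(\<lambda>x. \<Sum>i\<in>UNIV. partial i (F i) x) = (\<lambda>x. \<Sum>i\<in>UNIV. cross_field p x $ i * cnj (partial i q x))"
  proof
    fix x
    have "partial 1 (partial 2 p) x = partial 2 (partial 1 p) x" "partial 1 (partial 3 p) x = partial 3 (partial 1 p) x"
      "partial 2 (partial 3 p) x = partial 3 (partial 2 p) x"
      by (rule harm_poly_partial(5)[OF p])+
    then show "(\<Sum>i\<in>UNIV. partial i (F i) x) = (\<Sum>i\<in>UNIV. cross_field p x $ i * cnj (partial i q x))"
      unfolding sum_3 F has_partial_eq[OF hH]
      by (simp add: G_def cross_field_def algebra_simps)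
  qed
  also have "(\<lambda>x. \<Sum>i\<in>UNIV. of_real (x $ i) * F i x) = (\<lambda>x. 0)"
    unfolding sum_3 F by (auto simp: fun_eq_iff G_def algebra_simps)
  finally show ?thesis by (simp add: sphere_integral_def)
qed

lemma norm_sq_3: "norm x = 1 \<Longrightarrow> complex_of_real (x $ 1) * of_real (x $ 1) + of_real (x $ 2) * of_real (x $ 2)
    + of_real (x $ 3) * of_real (x $ 3) = 1" for x :: "real^3"
proof -
  assume "norm x = 1"
  then have "x \<bullet> x = 1" by (simp add: dot_square_norm)
  then have "x $ 1 * x $ 1 + x $ 2 * x $ 2 + x $ 3 * x $ 3 = 1"
    by (simp add: inner_vec_def sum_3)
  then show ?thesis by (metis of_real_1 of_real_add of_real_mult)
qed

lemma continuous_angular: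
  assumes p: "harm_poly n p"
  shows "continuous_on UNIV (\<lambda>x. cross_field p x $ i)" "continuous_on UNIV (\<lambda>x. tang_field n p x $ i)"
    "continuous_on UNIV (\<lambda>x. rad_field p x $ i)"
proof -
  note pp = continuous_on_complex_poly[OF harm_polyD(1)[OF p]] continuous_on_complex_poly[OF harm_poly_partial(1)[OF p]]
  have "continuous_on UNIV (\<lambda>x. cross_field p x $ 1)" "continuous_on UNIV (\<lambda>x. cross_field p x $ 2)"
    "continuous_on UNIV (\<lambda>x. cross_field p x $ 3)"
    unfolding cross_field_def by (auto intro!: continuous_intros pp)
  then show "continuous_on UNIV (\<lambda>x. cross_field p x $ i)"
    using exhaust_3[of i] by auto
  show "continuous_on UNIV (\<lambda>x. tang_field n p x $ i)" "continuous_on UNIV (\<lambda>x. rad_field p x $ i)"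
    unfolding tang_field_def rad_field_def cvec_def by (auto intro!: continuous_intros pp)
qed

lemma continuous_cdot:
  assumes "\<And>i. continuous_on A (\<lambda>x. f x $ i)" "\<And>i. continuous_on A (\<lambda>x. g x $ i)"
  shows "continuous_on A (\<lambda>x. cdot (f x) (g x))"
  unfolding cdot_def by (intro continuous_intros assms)

text \<open>On the unit sphere the pairings of two cross fields and of two tangential fields are the
  same function \<open>A\<close>, by Lagrange's identity and by expanding the product, with radial
  parts given by Euler. Its integral is ((n + n') (n + n' + 1) / 2 - n n') J, which is n (n + 1) J
  for equal degrees and 0 when J is 0.\<close>

lemma sphere_pairings:
  assumes p: "harm_poly n p" and q: "harm_poly n' q" and n: "n \<ge> 1" "n' \<ge> 1"
    and J: "sphere_integral (\<lambda>x. p x * cnj (q x)) = J" "n = n' \<or> J = 0"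
  shows "sphere_integral (\<lambda>x. cdot (cross_field p x) (cross_field q x)) = of_nat (n * (n + 1)) * J"
    and "sphere_integral (\<lambda>x. cdot (tang_field n p x) (tang_field n' q x)) = of_nat (n * (n + 1)) * J"
    and "sphere_integral (\<lambda>x. cdot (rad_field p x) (rad_field q x)) = J"
    and "sphere_integral (\<lambda>x. cdot (cross_field p x) (tang_field n' q x)) = 0"
    and "sphere_integral (\<lambda>x. cdot (cross_field p x) (rad_field q x)) = 0"
    and "sphere_integral (\<lambda>x. cdot (tang_field n p x) (rad_field q x)) = 0"
proof -
  note cp = continuous_on_complex_poly[OF harm_polyD(1)[OF p]] continuous_on_complex_poly[OF harm_poly_partial(1)[OF p]]
    continuous_on_complex_poly[OF harm_polyD(1)[OF q]] continuous_on_complex_poly[OF harm_poly_partial(1)[OF q]]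
  have ep: "of_real (x $ 1) * partial 1 p x + of_real (x $ 2) * partial 2 p x + of_real (x $ 3) * partial 3 p x = of_nat n * p x" for x
    using harm_poly_euler[OF p, of x] by (simp add: sum_3)
  have eq: "of_real (x $ 1) * cnj (partial 1 q x) + of_real (x $ 2) * cnj (partial 2 q x) + of_real (x $ 3) * cnj (partial 3 q x) = of_nat n' * cnj (q x)" for x
    using arg_cong[OF harm_poly_euler[OF q, of x], of cnj] by (simp add: sum_3)
  define A where "A x = (\<Sum>i\<in>UNIV. partial i p x * cnj (partial i q x)) - of_nat (n * n') * (p x * cnj (q x))" for x
  have cA: "continuous_on UNIV A"
    unfolding A_def by (intro continuous_intros cp)
  have "2 * sphere_integral A = 2 * (of_nat (n * (n + 1)) * J)"
  proof -
    have "sphere_integral A = sphere_integral (\<lambda>x. \<Sum>i\<in>UNIV. partial i p x * cnj (partial i q x)) - of_nat (n * n') * J"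
      unfolding A_def J(1)[symmetric]
      by (subst sphere_integral_add(2), (intro continuous_intros cp)+)
        (simp only: sphere_integral_cmult)
    then have "2 * sphere_integral A = of_nat ((n + n') * (n + n' + 1)) * J - 2 * (of_nat (n * n') * J)"
      using sphere_grad_grad[OF p q n] by (simp add: J(1) right_diff_distrib)
    then show ?thesis using J(2) by (auto simp: algebra_simps)
  qed
  then have A: "sphere_integral A = of_nat (n * (n + 1)) * J" by simp
  have "sphere_integral (\<lambda>x. cdot (cross_field p x) (cross_field q x)) = sphere_integral A"
  proof (rule sphere_integral_cong[OF cA])
    fix x :: "real^3" assume x: "norm x = 1"
    have lagrange: "(p2 * z - p3 * y) * (q2 * z - q3 * y) + (p3 * x - p1 * z) * (q3 * x - q1 * z) + (p1 * y - p2 * x) * (q1 * y - q2 * x)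
       = (p1 * q1 + p2 * q2 + p3 * q3) * (x * x + y * y + z * z) - (x * p1 + y * p2 + z * p3) * (x * q1 + y * q2 + z * q3)"
      for x y z p1 p2 p3 q1 q2 q3 :: complex
      by (simp add: algebra_simps)
    show "cdot (cross_field p x) (cross_field q x) = A x"
      unfolding cdot_def sum_3 cross_field_def vector_3 complex_cnj_diff complex_cnj_mult complex_cnj_complex_of_real
        lagrange ep eq norm_sq_3[OF x] A_def by (simp add: algebra_simps)
  qed
  then show "sphere_integral (\<lambda>x. cdot (cross_field p x) (cross_field q x)) = of_nat (n * (n + 1)) * J"
    using A by simp
  have "sphere_integral (\<lambda>x. cdot (tang_field n p x) (tang_field n' q x)) = sphere_integral A"
  proof (rule sphere_integral_cong[OF cA])
    fix x :: "real^3" assume x: "norm x = 1"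
    have ident: "(p1 - a * x) * (q1 - b * x) + (p2 - a * y) * (q2 - b * y) + (p3 - a * z) * (q3 - b * z)
       = (p1 * q1 + p2 * q2 + p3 * q3) - a * (x * q1 + y * q2 + z * q3) - b * (x * p1 + y * p2 + z * p3) + a * b * (x * x + y * y + z * z)"
      for x y z a b p1 p2 p3 q1 q2 q3 :: complex
      by (simp add: algebra_simps)
    show "cdot (tang_field n p x) (tang_field n' q x) = A x"
      unfolding cdot_def sum_3 tang_field_def vec_lambda_beta complex_cnj_diff complex_cnj_mult complex_cnj_complex_of_real
        ident ep eq norm_sq_3[OF x] A_def by (simp add: algebra_simps)
  qed
  then show "sphere_integral (\<lambda>x. cdot (tang_field n p x) (tang_field n' q x)) = of_nat (n * (n + 1)) * J"
    using A by simp
  have "sphere_integral (\<lambda>x. cdot (rad_field p x) (rad_field q x)) = sphere_integral (\<lambda>x. p x * cnj (q x))"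
  proof (rule sphere_integral_cong)
    fix x :: "real^3" assume x: "norm x = 1"
    have ident: "a * x * (b * x) + a * y * (b * y) + a * z * (b * z) = a * b * (x * x + y * y + z * z)" for x y z a b :: complex
      by (simp add: algebra_simps)
    show "cdot (rad_field p x) (rad_field q x) = p x * cnj (q x)"
      unfolding cdot_def sum_3 rad_field_def vector_smult_component cvec_def vec_lambda_beta complex_cnj_mult complex_cnj_complex_of_real
        ident norm_sq_3[OF x] by simp
  qed (intro continuous_intros cp)
  then show "sphere_integral (\<lambda>x. cdot (rad_field p x) (rad_field q x)) = J"
    using J(1) by simp
  have "sphere_integral (\<lambda>x. cdot (cross_field p x) (tang_field n' q x)) =
      sphere_integral (\<lambda>x. \<Sum>i\<in>UNIV. cross_field p x $ i * cnj (partial i q x))"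
    by (rule sphere_integral_cong)
      (intro continuous_intros continuous_angular(1)[OF p] cp,
       simp add: cdot_def sum_3 cross_field_def tang_field_def algebra_simps)
  then show "sphere_integral (\<lambda>x. cdot (cross_field p x) (tang_field n' q x)) = 0"
    using sphere_cross_grad[OF p q n] by simp
  have "(\<lambda>x. cdot (cross_field p x) (rad_field q x)) = (\<lambda>x. 0)"
    by (simp add: fun_eq_iff cdot_def sum_3 cross_field_def rad_field_def cvec_def algebra_simps)
  then show "sphere_integral (\<lambda>x. cdot (cross_field p x) (rad_field q x)) = 0"
    by (simp add: sphere_integral_def)
  have "sphere_integral (\<lambda>x. cdot (tang_field n p x) (rad_field q x)) = sphere_integral (\<lambda>x. 0)"
  proof (rule sphere_integral_cong)
    fix x :: "real^3" assume x: "norm x = 1"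
    have ident: "(p1 - a * x) * (b * x) + (p2 - a * y) * (b * y) + (p3 - a * z) * (b * z)
       = b * (x * p1 + y * p2 + z * p3) - a * b * (x * x + y * y + z * z)"
      for x y z a b p1 p2 p3 :: complex
      by (simp add: algebra_simps)
    show "cdot (tang_field n p x) (rad_field q x) = 0"
      unfolding cdot_def sum_3 tang_field_def rad_field_def vector_smult_component cvec_def vec_lambda_beta complex_cnj_mult complex_cnj_complex_of_real
        ident ep norm_sq_3[OF x] by simp
  qed simp
  then show "sphere_integral (\<lambda>x. cdot (tang_field n p x) (rad_field q x)) = 0"
    by (simp add: sphere_integral_def)
qed

lemma cdot_commute: "cdot u v = cnj (cdot v u)"
  by (simp add: cdot_def mult.commute)

lemma sphere_integral_cdot_commute:
  "sphere_integral (\<lambda>x. cdot (f x) (g x)) = cnj (sphere_integral (\<lambda>x. cdot (g x) (f x)))"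
  by (subst sphere_integral_cnj[symmetric]) (simp add: cdot_commute[of "f _"])

section \<open>Curl of vector spherical waves\<close>

text \<open>\<open>vector_derivative\<close> is a choice from the set of derivatives, and functions
  that agree near the point have the same set, so no differentiability has to be known.\<close>

lemma partial_transform:
  assumes "open S" "x \<in> S" "\<And>y. y \<in> S \<Longrightarrow> f y = g y"
  shows "partial i f x = partial i g x"
proof -
  have "has_partial f d i x = has_partial g d i x" for d
    using has_partial_transform[OF _ assms(1,2), of f d i g] has_partial_transform[OF _ assms(1,2), of g d i f] assms(3)
    by (auto simp: assms(3))
  then show ?thesis
    unfolding partial_def vector_derivative_def has_partial_def by simp
qed

lemma curl_transform:
  assumes "open S" "x \<in> S" "\<And>y. y \<in> S \<Longrightarrow> F y = G y"
  shows "curl F x = curl G x"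
proof -
  have "partial i (\<lambda>y. F y $ j) x = partial i (\<lambda>y. G y $ j) x" for i j
    by (rule partial_transform[OF assms(1,2)]) (simp add: assms(3))
  then show ?thesis by (simp add: curl_def)
qed

lemma curl_eqI:
  assumes "\<And>i j. has_partial (\<lambda>y. F y $ j) (D i j) i x"
  shows "curl F x = vector [D 2 3 - D 3 2, D 3 1 - D 1 3, D 1 2 - D 2 1]"
  unfolding curl_def has_partial_eq[OF assms] ..

lemma has_partial_radial:
  fixes G :: "real \<Rightarrow> complex"
  assumes "(G has_vector_derivative G') (at (norm x))" "x \<noteq> 0"
  shows "has_partial (\<lambda>y. G (norm y)) (G' * of_real (x $ i / norm x)) i x"
proof -
  have "((\<lambda>t. (x + t *\<^sub>R axis i 1) \<bullet> (x + t *\<^sub>R axis i 1)) has_real_derivative 2 * x $ i) (at 0)"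
    unfolding inner_add_left inner_add_right inner_scaleR_left inner_scaleR_right
    by (auto intro!: derivative_eq_intros simp: inner_axis inner_axis')
  then have 1: "((\<lambda>t. (x + t *\<^sub>R axis i 1) \<bullet> (x + t *\<^sub>R axis i 1)) has_real_derivative 2 * x $ i) (at 0 within UNIV)"
    by simp
  have sq: "(sqrt has_real_derivative inverse (sqrt (x \<bullet> x)) / 2) (at ((x + 0 *\<^sub>R axis i 1) \<bullet> (x + 0 *\<^sub>R axis i 1)))"
    using DERIV_real_sqrt[of "x \<bullet> x"] assms(2) by simp
  have "((\<lambda>t. norm (x + t *\<^sub>R axis i 1)) has_real_derivative inverse (norm x) / 2 * (2 * x $ i)) (at 0)"
  proof -
    define \<rho> where "\<rho> t = (x + t *\<^sub>R axis i 1) \<bullet> (x + t *\<^sub>R axis i 1)" for t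
    have "(\<rho> has_real_derivative 2 * x $ i) (at 0 within UNIV)"
      using 1 by (simp only: \<rho>_def[abs_def])
    moreover have "(sqrt has_real_derivative inverse (sqrt (x \<bullet> x)) / 2) (at (\<rho> 0))"
      using sq by (simp only: \<rho>_def)
    ultimately have "((\<lambda>t. sqrt (\<rho> t)) has_real_derivative inverse (sqrt (x \<bullet> x)) / 2 * (2 * x $ i)) (at 0 within UNIV)"
      by (intro DERIV_chain2[where f = sqrt and g = \<rho>])
    then show ?thesis
      by (simp only: \<rho>_def norm_eq_sqrt_inner)
  qed
  moreover have "inverse (norm x) / 2 * (2 * x $ i) = x $ i / norm x"
    using assms(2) by (simp add: field_simps)
  ultimately have "((\<lambda>t. norm (x + t *\<^sub>R axis i 1)) has_real_derivative x $ i / norm x) (at 0)"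
    by (simp only:)
  then have n: "((\<lambda>t. norm (x + t *\<^sub>R axis i 1)) has_vector_derivative x $ i / norm x) (at 0)"
    by (simp add: has_real_derivative_iff_has_vector_derivative)
  have "((G \<circ> (\<lambda>t. norm (x + t *\<^sub>R axis i 1))) has_vector_derivative (x $ i / norm x) *\<^sub>R G') (at 0)"
    by (rule vector_diff_chain_at[OF n]) (use assms in simp)
  then show ?thesis
    by (simp add: has_partial_def o_def scaleR_conv_of_real mult.commute)
qed

text \<open>With \<open>r = norm x\<close>, the function \<open>g\<close> is the radial function divided by \<open>r ^ n\<close> and
  \<open>a = (n + 1) g + r g'\<close>, so that \<open>r ^ n a\<close> is the derivative of \<open>r\<close> times the radial function;
  \<open>h = k\<^sup>2 g\<close> for a spherical Bessel function of \<open>k r\<close>.  The system is linear in \<open>(g, a, h)\<close>.\<close>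

definition radial_system ::
  "nat \<Rightarrow> (real \<Rightarrow> complex) \<Rightarrow> (real \<Rightarrow> complex) \<Rightarrow> (real \<Rightarrow> complex) \<Rightarrow> bool" where
  "radial_system n g a h \<longleftrightarrow> (\<forall>r>0.
     (g has_vector_derivative (a r - of_nat (n + 1) * g r) / of_real r) (at r) \<and>
     (a has_vector_derivative
        of_nat n * (of_nat (n + 1) * g r - a r) / of_real r - of_real r * h r) (at r))"

text \<open>Closed form, away from the origin, of the curl of g p x for \<open>l = 1\<close> and of
  its iterated curl for \<open>l = 2\<close>, without the factor 1/k of \<open>wave\<close>. For
  \<open>l = 2\<close> the tangential amplitude comes from \<open>a\<close> and the radial one from
  n (n + 1) \<open>g\<close>, as \<open>vfield_polar\<close> makes explicit.\<close>

definition vfield ::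
  "nat \<Rightarrow> nat \<Rightarrow> (real^3 \<Rightarrow> complex) \<Rightarrow> (real \<Rightarrow> complex) \<Rightarrow> (real \<Rightarrow> complex) \<Rightarrow> real^3 \<Rightarrow> complex^3" where
  "vfield l n p g a x =
     (if l = 1 then g (norm x) *s cross_field p x
      else (\<chi> i. a (norm x) * partial i p x
         - of_nat n / of_real ((norm x)\<^sup>2) * (a (norm x) - of_nat (n + 1) * g (norm x)) * p x * of_real (x $ i)))"

lemma radial_systemD:
  assumes "radial_system n g a h" "r > 0"
  shows "(g has_vector_derivative (a r - of_nat (n + 1) * g r) / of_real r) (at r)"
    "(a has_vector_derivative
        of_nat n * (of_nat (n + 1) * g r - a r) / of_real r - of_real r * h r) (at r)"
  using assms by (auto simp: radial_system_def)

lemma open_nonzero: "open (- {0 :: real^3})"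
  by (simp add: open_Compl)

lemma sum_3_euler:
  assumes "harm_poly n p"
  shows "of_real (x $ 1) * partial 1 p x + of_real (x $ 2) * partial 2 p x + of_real (x $ 3) * partial 3 p x = of_nat n * p x"
  using harm_poly_euler[OF assms, of x] by (simp add: sum_3)

text \<open>Euler's identity differentiated along axis \<open>j\<close>: the term where the
  coordinate itself is differentiated lowers n to n - 1, a complex subtraction and so not
  truncated.\<close>

lemma euler_partial:
  assumes p: "harm_poly n p"
  shows "of_real (x $ 1) * partial j (partial 1 p) x + of_real (x $ 2) * partial j (partial 2 p) x
      + of_real (x $ 3) * partial j (partial 3 p) x = (of_nat n - 1) * partial j p x"
proof -
  have 1: "has_partial (\<lambda>x. of_real (x $ 1) * partial 1 p x + of_real (x $ 2) * partial 2 p x + of_real (x $ 3) * partial 3 p x)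
     ((of_real (x $ 1) * partial j (partial 1 p) x + (if j = 1 then 1 else 0) * partial 1 p x)
     + (of_real (x $ 2) * partial j (partial 2 p) x + (if j = 2 then 1 else 0) * partial 2 p x)
     + (of_real (x $ 3) * partial j (partial 3 p) x + (if j = 3 then 1 else 0) * partial 3 p x)) j x"
    by (intro has_partial_add has_partial_mult has_partial_coord harm_poly_partial(4)[OF p])
  have 2: "has_partial (\<lambda>x. of_nat n * p x) (of_nat n * partial j p x + 0 * p x) j x"
    by (intro has_partial_mult has_partial_const harm_poly_partial(2)[OF p])
  have "(of_real (x $ 1) * partial j (partial 1 p) x + (if j = 1 then 1 else 0) * partial 1 p x)
     + (of_real (x $ 2) * partial j (partial 2 p) x + (if j = 2 then 1 else 0) * partial 2 p x)
     + (of_real (x $ 3) * partial j (partial 3 p) x + (if j = 3 then 1 else 0) * partial 3 p x) = of_nat n * partial j p x"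
    using has_partial_eq[OF 1[unfolded sum_3_euler[OF p]]] has_partial_eq[OF 2] by simp
  then show ?thesis
    using exhaust_3[of j] by (auto simp: algebra_simps)
qed

text \<open>The curl of f x is the gradient of f crossed with x; the part of the gradient that comes
  from g is parallel to x and drops out.\<close>

lemma curl_radial_position:
  assumes p: "harm_poly n p" and g: "(g has_vector_derivative g') (at (norm x))" and x: "x \<noteq> 0"
  shows "curl (\<lambda>y. (g (norm y) * p y) *s cvec y) x = g (norm x) *s cross_field p x"
proof -
  define D where "D i j = g (norm x) * p x * (if i = j then 1 else 0)
     + (g (norm x) * partial i p x + g' * of_real (x $ i / norm x) * p x) * of_real (x $ j)" for i j
  have "has_partial (\<lambda>y. ((g (norm y) * p y) *s cvec y) $ j) (D i j) i x" for i j
    unfolding vector_smult_component cvec_def vec_lambda_beta D_def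
    by (intro has_partial_mult has_partial_coord has_partial_radial g x harm_poly_partial(2)[OF p])
  from curl_eqI[where D = D, OF this] show ?thesis
    by (simp add: vec_eq_iff forall_3 cross_field_def D_def algebra_simps)
qed

lemma vec_eq_3: "u = v \<longleftrightarrow> u $ 1 = v $ 1 \<and> u $ 2 = v $ 2 \<and> u $ 3 = v $ 3" for u v :: "complex^3"
  by (simp add: vec_eq_iff forall_3)

lemma norm_sq_sum_3: "complex_of_real ((norm x)\<^sup>2) = of_real (x $ 1) * of_real (x $ 1)
    + of_real (x $ 2) * of_real (x $ 2) + of_real (x $ 3) * of_real (x $ 3)" for x :: "real^3"
  by (simp add: power2_norm_eq_inner inner_vec_def sum_3)

text \<open>Harmonicity removes one second derivative and Euler's identity for the partial
  derivatives turns the others into (n - 1) times the gradient of p, so the terms with g sum to (n +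
  1) g times that gradient. The terms with g' form a double cross product with x. With a = (n + 1) g
  + r g' this is the field for \<open>l = 2\<close>.\<close>

lemma curl_vfield_1:
  assumes p: "harm_poly n p" and s: "radial_system n g a h" and x: "x \<noteq> 0"
  shows "curl (vfield 1 n p g a) x = vfield 2 n p g a x"
proof -
  define r where "r = norm x"
  have r: "r > 0" "complex_of_real r \<noteq> 0" using x by (simp_all add: r_def)
  define g' where "g' = (a r - of_nat (n + 1) * g r) / of_real r"
  have a: "a r = of_nat (n + 1) * g r + of_real r * g'"
    using r by (simp add: g'_def)
  have g: "(g has_vector_derivative g') (at (norm x))"
    using radial_systemD(1)[OF s r(1)] by (simp add: g'_def r_def)
  define G where "G b c x = partial b p x * complex_of_real (x $ c)" for b c x
  define dG where "dG i b c = partial b p x * (if i = c then 1 else 0) + partial i (partial b p) x * of_real (x $ c)" for i b c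
  have hG: "has_partial (\<lambda>y. g (norm y) * (G b c y - G d e y))
     (g r * (dG i b c - dG i d e) + g' * of_real (x $ i / r) * (G b c x - G d e x)) i x" for i b c d e
    unfolding G_def dG_def r_def
    by (intro has_partial_mult has_partial_diff has_partial_radial g x has_partial_coord harm_poly_partial(4)[OF p])
  have comp: "(\<lambda>y. vfield 1 n p g a y $ 1) = (\<lambda>y. g (norm y) * (G 2 3 y - G 3 2 y))"
    "(\<lambda>y. vfield 1 n p g a y $ 2) = (\<lambda>y. g (norm y) * (G 3 1 y - G 1 3 y))"
    "(\<lambda>y. vfield 1 n p g a y $ 3) = (\<lambda>y. g (norm y) * (G 1 2 y - G 2 1 y))"
    by (simp_all add: vfield_def cross_field_def G_def)
  have comm: "partial 1 (partial 2 p) x = partial 2 (partial 1 p) x" "partial 1 (partial 3 p) x = partial 3 (partial 1 p) x"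
    "partial 2 (partial 3 p) x = partial 3 (partial 2 p) x"
    by (rule harm_poly_partial(5)[OF p])+
  have lap: "partial 1 (partial 1 p) x = - partial 2 (partial 2 p) x - partial 3 (partial 3 p) x"
    using harm_polyD(3)[OF p, of x] by (simp add: sum_3 eq_diff_eq add_eq_0_iff2 algebra_simps)
  define q1 q2 q3 where "q1 = partial 1 p x" and "q2 = partial 2 p x" and "q3 = partial 3 p x"
  define X Y Z where "X = complex_of_real (x $ 1)" and "Y = complex_of_real (x $ 2)" and "Z = complex_of_real (x $ 3)"
  have eu: "X * q1 + Y * q2 + Z * q3 = of_nat n * p x"
    unfolding X_def Y_def Z_def q1_def q2_def q3_def by (rule sum_3_euler[OF p])
  note ep = euler_partial[OF p, of x 1] euler_partial[OF p, of x 2] euler_partial[OF p, of x 3]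
  have rr: "complex_of_real r * of_real r = X * X + Y * Y + Z * Z"
    using norm_sq_sum_3[of x] by (simp add: X_def Y_def Z_def r_def power2_eq_square)
  have V2: "vfield 2 n p g a x $ i = (of_nat (n + 1) * g r + of_real r * g') * partial i p x
      - of_nat n * g' / of_real r * p x * of_real (x $ i)" for i
    unfolding vfield_def r_def[symmetric] a using r by (simp add: power2_eq_square)
  \<comment> \<open>Writing r^2 and n p back in coordinates turns both sides of the goal into the
    same polynomial expression in coordinates and derivatives.\<close>
  have key: "q * (of_real r * g') - of_nat n * g' / of_real r * p x * W
      = g' / of_real r * (q * (X * X + Y * Y + Z * Z) - W * (X * q1 + Y * q2 + Z * q3))" for q W
    unfolding eu rr[symmetric] using r by (simp add: field_simps)
  have V2': "vfield 2 n p g a x $ i = of_nat (n + 1) * g r * partial i p x +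
     g' / of_real r * (partial i p x * (X * X + Y * Y + Z * Z) - of_real (x $ i) * (X * q1 + Y * q2 + Z * q3))" for i
    unfolding V2 key[symmetric] by (simp add: algebra_simps)
  have C: "curl (vfield 1 n p g a) x = vector
     [partial 2 (\<lambda>y. g (norm y) * (G 1 2 y - G 2 1 y)) x - partial 3 (\<lambda>y. g (norm y) * (G 3 1 y - G 1 3 y)) x,
      partial 3 (\<lambda>y. g (norm y) * (G 2 3 y - G 3 2 y)) x - partial 1 (\<lambda>y. g (norm y) * (G 1 2 y - G 2 1 y)) x,
      partial 1 (\<lambda>y. g (norm y) * (G 3 1 y - G 1 3 y)) x - partial 2 (\<lambda>y. g (norm y) * (G 2 3 y - G 3 2 y)) x]"
    unfolding curl_def comp ..
  have n1: "of_nat (n + 1) * q = 2 * q + (of_nat n - 1) * q" for q :: complex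
    by (simp add: algebra_simps)
  have sub: "vfield 2 n p g a x $ i = g r * (2 * partial i p x + (of_nat n - 1) * partial i p x) +
     g' / of_real r * (partial i p x * (X * X + Y * Y + Z * Z) - of_real (x $ i) * (X * q1 + Y * q2 + Z * q3))" for i
    unfolding V2' by (simp add: algebra_simps)
  have dv: "complex_of_real (w / r) = of_real w / of_real r" for w by simp
  show ?thesis
    unfolding vec_eq_3 C vector_3 has_partial_eq[OF hG]
    unfolding sub
    unfolding ep[symmetric]
    unfolding dG_def comm lap
      X_def[symmetric] Y_def[symmetric] Z_def[symmetric] q1_def[symmetric] q2_def[symmetric] q3_def[symmetric] G_def
      dv
    by (simp add: algebra_simps add_divide_distrib diff_divide_distrib)
qed

text \<open>Write the field as a times the gradient of p minus B p x. The curl of the first part is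
  - (a' / r) times the cross field, that of the second gives - B times it, and the second equation
  of the system states that h is their sum.\<close>

lemma curl_vfield_2:
  assumes p: "harm_poly n p" and s: "radial_system n g a h" and x: "x \<noteq> 0"
  shows "curl (vfield 2 n p g a) x = vfield 1 n p h b x"
proof -
  define r where "r = norm x"
  have r: "r > 0" "complex_of_real r \<noteq> 0" using x by (simp_all add: r_def)
  define B where "B r = of_nat n * (a r - of_nat (n + 1) * g r) * (1 / of_real r) * (1 / of_real r)" for r
  define a' where "a' = of_nat n * (of_nat (n + 1) * g r - a r) / of_real r - of_real r * h r"
  note sd = radial_systemD[OF s r(1)]
  have a: "(a has_vector_derivative a') (at (norm x))"
    using sd(2) by (simp add: a'_def r_def)
  have inv: "((\<lambda>r. 1 / complex_of_real r) has_vector_derivative of_real (- (1 / r\<^sup>2))) (at r)"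
  proof -
    have "((\<lambda>r. 1 / r) has_real_derivative - (1 / r\<^sup>2)) (at r)"
      using r by (auto intro!: derivative_eq_intros simp: power2_eq_square)
    then have "((\<lambda>r. complex_of_real (1 / r)) has_vector_derivative complex_of_real (- (1 / r\<^sup>2))) (at r)"
      by (rule has_vector_derivative_of_real)
    then show ?thesis by simp
  qed
  \<comment> \<open>Existence is enough: the derivative of B multiplies a vector parallel to x and
    cancels in the curl.\<close>
  have "\<exists>B'. (B has_vector_derivative B') (at r)"
    unfolding B_def
    by (rule exI) (rule has_vector_derivative_mult[OF has_vector_derivative_mult[OF has_vector_derivative_mult[OF
      has_vector_derivative_const has_vector_derivative_diff[OF sd(2) has_vector_derivative_mult[OF
      has_vector_derivative_const sd(1)]]] inv] inv])
  then obtain B' where B: "(B has_vector_derivative B') (at (norm x))" by (auto simp: r_def)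
  define D where "D i j = (a r * partial i (partial j p) x + a' * of_real (x $ i / r) * partial j p x)
     - (B r * p x * (if i = j then 1 else 0)
        + (B r * partial i p x + B' * of_real (x $ i / r) * p x) * of_real (x $ j))" for i j
  have "has_partial (\<lambda>y. vfield 2 n p g a y $ j) (D i j) i x" for i j
  proof -
    have "(\<lambda>y. vfield 2 n p g a y $ j) = (\<lambda>y. a (norm y) * partial j p y - B (norm y) * p y * of_real (y $ j))"
      by (simp add: fun_eq_iff vfield_def B_def power2_eq_square)
    then show ?thesis
      unfolding D_def r_def
      by (simp only:) (intro has_partial_mult has_partial_diff has_partial_radial a B x has_partial_coord harm_poly_partial(2,4)[OF p])
  qed
  from curl_eqI[where D = D, OF this]
  have C: "curl (vfield 2 n p g a) x = vector [D 2 3 - D 3 2, D 3 1 - D 1 3, D 1 2 - D 2 1]" .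
  have comm: "partial 1 (partial 2 p) x = partial 2 (partial 1 p) x" "partial 1 (partial 3 p) x = partial 3 (partial 1 p) x"
    "partial 2 (partial 3 p) x = partial 3 (partial 2 p) x"
    by (rule harm_poly_partial(5)[OF p])+
  have "h r = - B r - a' / of_real r"
    using r by (simp add: B_def a'_def field_simps)
  then have h: "h (norm x) = - B r - a' / of_real r" by (simp add: r_def)
  have dv: "complex_of_real (w / r) = of_real w / of_real r" for w by simp
  show ?thesis
    unfolding vec_eq_3 C vector_3 D_def comm dv vfield_def h cross_field_def
    by (simp add: algebra_simps)
qed

text \<open>The homogeneous extension of the angular function absorbs the power r^n, so f(r) S(x /
  r) becomes g(r) p(x) and polynomials are differentiated instead of \<open>sgn\<close>. Equality is
  required for r > 0 only, as Rayleigh's formulas fix nothing at 0.\<close>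

lemma wave_eq_vfield:
  assumes p: "harm_poly n p" and S: "\<And>y. norm y = 1 \<Longrightarrow> S y = p y"
    and s: "radial_system n g a h" and f: "\<And>r. r > 0 \<Longrightarrow> f r = of_real (r ^ n) * g r"
    and x: "x \<noteq> 0" and l: "l \<in> {1, 2}"
  shows "wave k f S l x = (if l = 1 then 1 else 1 / k) *s vfield l n p g a x"
proof -
  have W: "curl (\<lambda>x. (f (norm x) * S (sgn x)) *s cvec x) y = vfield 1 n p g a y" if y: "y \<noteq> 0" for y
  proof -
    have "f (norm z) * S (sgn z) = g (norm z) * p z" if "z \<noteq> 0" for z
    proof -
      have "p z = of_real (norm z ^ n) * p (sgn z)"
        using harm_polyD(2)[OF p, of "norm z" "sgn z"] norm_scale_sgn[of z] by simp
      then show ?thesis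
        using that f[of "norm z"] S[of "sgn z"] by (simp add: norm_sgn)
    qed
    then have "curl (\<lambda>x. (f (norm x) * S (sgn x)) *s cvec x) y = curl (\<lambda>x. (g (norm x) * p x) *s cvec x) y"
      by (intro curl_transform[OF open_nonzero]) (use y in auto)
    also have "\<dots> = vfield 1 n p g a y"
      using curl_radial_position[OF p radial_systemD(1)[OF s] y] y by (simp add: vfield_def)
    finally show ?thesis .
  qed
  show ?thesis
  proof (cases "l = 1")
    case True
    then show ?thesis using W[OF x] by (simp add: wave_def Let_def)
  next
    case False
    then have l: "l = 2" using l by simp
    have "curl (curl (\<lambda>x. (f (norm x) * S (sgn x)) *s cvec x)) x = curl (vfield 1 n p g a) x"
      by (rule curl_transform[OF open_nonzero]) (use x W in auto)
    then show ?thesis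
      using l curl_vfield_1[OF p s x] by (simp add: wave_def Let_def)
  qed
qed

section \<open>Orthogonality of vector spherical waves\<close>

lemma has_bochner_integral_except_0:
  fixes f h :: "real^3 \<Rightarrow> 'b::{banach, second_countable_topology}"
  assumes f: "has_bochner_integral lborel f v" and eq: "\<And>x. x \<noteq> 0 \<Longrightarrow> f x = h x"
  shows "has_bochner_integral lborel h v"
proof -
  have [measurable]: "f \<in> borel_measurable borel"
    using borel_measurable_has_bochner_integral[OF f] by simp
  have "(\<lambda>x. if x = 0 then h 0 else f x) \<in> borel_measurable borel"
    by measurable
  also have "(\<lambda>x. if x = 0 then h 0 else f x) = h"
    using eq by (auto simp: fun_eq_iff)
  finally have h: "h \<in> borel_measurable lborel" by simp
  have "AE x in lborel. f x = h x"
    using AE_lborel_singleton[of "0 :: real^3"] by eventually_elim (rule eq)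
  then show ?thesis
    using has_bochner_integral_cong_AE[OF _ h, of f v] f by simp
qed

lemma cdot_smult: "cdot (a *s u) (b *s v) = a * cnj b * cdot u v"
  by (simp add: cdot_def sum_3 algebra_simps)

lemma cdot_add: "cdot (u + v) w = cdot u w + cdot v w" "cdot w (u + v) = cdot w u + cdot w v"
  by (simp_all add: cdot_def sum_3 algebra_simps)

lemma cdot_self: "cdot v v = of_real ((norm v)\<^sup>2)"
proof -
  have "(norm v)\<^sup>2 = (\<Sum>i\<in>UNIV. (cmod (v $ i))\<^sup>2)"
    by (simp add: norm_vec_def L2_set_def sum_nonneg)
  then show ?thesis
    by (simp add: cdot_def complex_norm_square del: of_real_power)
qed

lemma vfield_polar:
  assumes p: "harm_poly n p" and n: "n \<ge> 1" and x: "x \<noteq> 0"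
  shows "vfield 1 n p g a x = (g (norm x) * of_real (norm x ^ n)) *s cross_field p (sgn x)"
    and "vfield 2 n p g a x = (a (norm x) * of_real (norm x ^ (n - 1))) *s tang_field n p (sgn x)
      + (of_nat (n * (n + 1)) * g (norm x) * of_real (norm x ^ (n - 1))) *s rad_field p (sgn x)"
proof -
  define r where "r = norm x"
  have r: "r > 0" using x by (simp add: r_def)
  have xs: "x = r *\<^sub>R sgn x" unfolding r_def by (rule norm_scale_sgn)
  have d: "partial i p x = of_real (r ^ (n - 1)) * partial i p (sgn x)" for i
    using harm_poly_partial_scale[OF p n r, of i "sgn x"] xs by simp
  have c: "x $ i = r * sgn x $ i" for i
    by (metis xs vector_scaleR_component real_scaleR_def)
  have px: "p x = of_real (r ^ n) * p (sgn x)"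
    using harm_polyD(2)[OF p, of r "sgn x"] xs by simp
  have rn: "complex_of_real (r ^ n) = of_real (r ^ (n - 1)) * of_real r"
    using n by (cases n) auto
  show "vfield 1 n p g a x = (g (norm x) * of_real (norm x ^ n)) *s cross_field p (sgn x)"
    unfolding vfield_def r_def[symmetric] rn
    by (simp add: vec_eq_3 cross_field_def d c algebra_simps)
  have "complex_of_real (r ^ (n - 1)) * of_real r * of_real r / of_real (r\<^sup>2) = of_real (r ^ (n - 1))"
    using r by (simp add: power2_eq_square)
  then have k: "of_nat n / of_real (r\<^sup>2) * (a r - of_nat (n + 1) * g r) * p x * of_real (x $ i)
     = of_nat n * (a r - of_nat (n + 1) * g r) * of_real (r ^ (n - 1)) * (p (sgn x) * of_real (sgn x $ i))" for i
    unfolding px c rn using r by (simp add: power2_eq_square field_simps)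
  have vi: "vfield 2 n p g a x $ i = a r * partial i p x
      - of_nat n * (a r - of_nat (n + 1) * g r) * of_real (r ^ (n - 1)) * (p (sgn x) * of_real (sgn x $ i))" for i
    unfolding k[symmetric] by (simp add: vfield_def r_def)
  show "vfield 2 n p g a x = (a (norm x) * of_real (norm x ^ (n - 1))) *s tang_field n p (sgn x)
      + (of_nat (n * (n + 1)) * g (norm x) * of_real (norm x ^ (n - 1))) *s rad_field p (sgn x)"
    unfolding vec_eq_iff vi r_def[symmetric]
    by (simp add: d tang_field_def rad_field_def cvec_def algebra_simps)
qed

text \<open>What remains of a product of two fields after angular integration, with the common
  factor n (n + 1) removed and the Jacobian r^2 merged into the power of r. Conjugation is left to
  the arguments, so that Hermitian and bilinear integrals are both covered.\<close>

definition mode_density ::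
  "nat \<Rightarrow> nat \<Rightarrow> (real \<Rightarrow> complex) \<Rightarrow> (real \<Rightarrow> complex) \<Rightarrow> (real \<Rightarrow> complex) \<Rightarrow> (real \<Rightarrow> complex) \<Rightarrow> real \<Rightarrow> complex" where
  "mode_density l n g a g' a' r =
     (if l = 1 then g r * g' r * of_real (r ^ (2 * n + 2))
      else (a r * a' r + of_nat (n * (n + 1)) * g r * g' r) * of_real (r ^ (2 * n)))"

lemma polar_cdot:
  assumes A: "A \<in> sets borel" "A \<subseteq> {u..v}" "0 \<le> u"
    and c: "continuous_on {u..v} \<alpha>" "continuous_on {u..v} \<beta>"
    and F: "\<And>i. continuous_on UNIV (\<lambda>x. F x $ i)" "\<And>i. continuous_on UNIV (\<lambda>x. G x $ i)"
  shows "has_bochner_integral lborel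
     (\<lambda>x. indicator A (norm x) *\<^sub>R cdot (\<alpha> (norm x) *s F (sgn x)) (\<beta> (norm x) *s G (sgn x)))
     (sphere_integral (\<lambda>x. cdot (F x) (G x)) * (LINT r:A|lborel. of_real (r\<^sup>2) * (\<alpha> r * cnj (\<beta> r))))"
  unfolding cdot_smult
proof (rule polar_set[where q = "\<lambda>x. cdot (F x) (G x)" and f = "\<lambda>r. \<alpha> r * cnj (\<beta> r)"])
  have "set_integrable lborel {u..v} (\<lambda>r. of_real (r\<^sup>2) * (\<alpha> r * cnj (\<beta> r)))"
    by (intro borel_integrable_atLeastAtMost' continuous_intros c)
  then show "set_integrable lborel A (\<lambda>r. of_real (r\<^sup>2) * (\<alpha> r * cnj (\<beta> r)))"
    by (rule set_integrable_subset) (use A in auto)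
qed (use A continuous_cdot[OF F] in auto)

text \<open>Each field is a radial combination of vector spherical harmonics, whose pairings are
  known. Different degrees force J = 0, so the density on the right can be written with
  \<open>n\<close> alone.\<close>

lemma vfield_integral:
  assumes p: "harm_poly n p" and q: "harm_poly n' q" and n: "n \<ge> 1" "n' \<ge> 1"
    and J: "sphere_integral (\<lambda>x. p x * cnj (q x)) = J" "n = n' \<or> J = 0"
    and A: "A \<in> sets borel" "A \<subseteq> {u..v}" "0 \<le> u"
    and c: "continuous_on {u..v} g" "continuous_on {u..v} a" "continuous_on {u..v} g'" "continuous_on {u..v} a'"
    and l: "l \<in> {1, 2}" "l' \<in> {1, 2}"
  shows "has_bochner_integral lborel
     (\<lambda>x. indicator A (norm x) *\<^sub>R cdot (vfield l n p g a x) (vfield l' n' q g' a' x))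
     (if l = l' then of_nat (n * (n + 1)) * J *
        (LINT r:A|lborel. mode_density l n g a (\<lambda>r. cnj (g' r)) (\<lambda>r. cnj (a' r)) r) else 0)"
proof -
  note cf = continuous_angular[OF p] continuous_angular[OF q]
  note sp = sphere_pairings[OF p q n J]
  have J': "sphere_integral (\<lambda>x. q x * cnj (p x)) = cnj J"
    unfolding J(1)[symmetric] sphere_integral_cnj[symmetric] by (simp add: mult.commute)
  have J'': "n' = n \<or> cnj J = 0" using J(2) by auto
  have z: "sphere_integral (\<lambda>x. cdot (tang_field n p x) (cross_field q x)) = 0"
    "sphere_integral (\<lambda>x. cdot (rad_field p x) (cross_field q x)) = 0"
    "sphere_integral (\<lambda>x. cdot (rad_field p x) (tang_field n' q x)) = 0"
    using sphere_pairings(4-6)[OF q p n(2,1) J' J'']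
    by (subst sphere_integral_cdot_commute, simp)+
  define e1 e2 e3 where "e1 = (\<lambda>r. g r * complex_of_real (r ^ n))" and "e2 = (\<lambda>r. a r * complex_of_real (r ^ (n - 1)))"
    and "e3 = (\<lambda>r. of_nat (n * (n + 1)) * g r * complex_of_real (r ^ (n - 1)))"
  define e1' e2' e3' where "e1' = (\<lambda>r. g' r * complex_of_real (r ^ n'))" and "e2' = (\<lambda>r. a' r * complex_of_real (r ^ (n' - 1)))"
    and "e3' = (\<lambda>r. of_nat (n' * (n' + 1)) * g' r * complex_of_real (r ^ (n' - 1)))"
  have ce: "continuous_on {u..v} e1" "continuous_on {u..v} e2" "continuous_on {u..v} e3"
    "continuous_on {u..v} e1'" "continuous_on {u..v} e2'" "continuous_on {u..v} e3'"
    unfolding e1_def e2_def e3_def e1'_def e2'_def e3'_def by (intro continuous_intros c)+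
  have V1: "vfield 1 n p g a x = e1 (norm x) *s cross_field p (sgn x)"
    and V2: "vfield 2 n p g a x = e2 (norm x) *s tang_field n p (sgn x) + e3 (norm x) *s rad_field p (sgn x)"
    and V1': "vfield 1 n' q g' a' x = e1' (norm x) *s cross_field q (sgn x)"
    and V2': "vfield 2 n' q g' a' x = e2' (norm x) *s tang_field n' q (sgn x) + e3' (norm x) *s rad_field q (sgn x)"
    if "x \<noteq> 0" for x
    unfolding vfield_polar[OF p n(1) that] vfield_polar[OF q n(2) that] e1_def e2_def e3_def e1'_def e2'_def e3'_def
    by (rule refl)+
  note P = polar_cdot[OF A]
  consider "l = 1" "l' = 1" | "l = 1" "l' = 2" | "l = 2" "l' = 1" | "l = 2" "l' = 2"
    using l by auto
  then show ?thesis
  proof cases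
    case 1
    have "has_bochner_integral lborel
       (\<lambda>x. indicator A (norm x) *\<^sub>R cdot (e1 (norm x) *s cross_field p (sgn x)) (e1' (norm x) *s cross_field q (sgn x)))
       (of_nat (n * (n + 1)) * J * (LINT r:A|lborel. of_real (r\<^sup>2) * (e1 r * cnj (e1' r))))"
      using P[OF ce(1,4) cf(1,4)] unfolding sp(1) .
    moreover have "J * (LINT r:A|lborel. of_real (r\<^sup>2) * (e1 r * cnj (e1' r))) =
        J * (LINT r:A|lborel. mode_density 1 n g a (\<lambda>r. cnj (g' r)) (\<lambda>r. cnj (a' r)) r)"
    proof (cases "J = 0")
      case False
      then have "n' = n" using J(2) by simp
      then have "of_real (r\<^sup>2) * (e1 r * cnj (e1' r)) = mode_density 1 n g a (\<lambda>r. cnj (g' r)) (\<lambda>r. cnj (a' r)) r" for r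
      proof -
        have e: "complex_of_real (r ^ (2 * n + 2)) = of_real (r\<^sup>2) * (of_real (r ^ n) * of_real (r ^ n))"
          by (simp add: power_add mult_2 power2_eq_square)
        show ?thesis
          unfolding mode_density_def e e1_def e1'_def \<open>n' = n\<close>
          by (simp only: mult_ac complex_cnj_mult complex_cnj_complex_of_real if_True refl)
      qed
      then show ?thesis by simp
    qed simp
    ultimately have "has_bochner_integral lborel
       (\<lambda>x. indicator A (norm x) *\<^sub>R cdot (e1 (norm x) *s cross_field p (sgn x)) (e1' (norm x) *s cross_field q (sgn x)))
       (of_nat (n * (n + 1)) * J * (LINT r:A|lborel. mode_density 1 n g a (\<lambda>r. cnj (g' r)) (\<lambda>r. cnj (a' r)) r))"
      by (simp only: mult.assoc)
    then show ?thesis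
      using 1 by (auto intro: has_bochner_integral_except_0 simp del: One_nat_def simp: V1 V1')
  next
    case 2
    have "has_bochner_integral lborel
       (\<lambda>x. indicator A (norm x) *\<^sub>R cdot (e1 (norm x) *s cross_field p (sgn x)) (e2' (norm x) *s tang_field n' q (sgn x))
          + indicator A (norm x) *\<^sub>R cdot (e1 (norm x) *s cross_field p (sgn x)) (e3' (norm x) *s rad_field q (sgn x))) (0 + 0)"
      by (intro has_bochner_integral_add)
        (use P[OF ce(1,5) cf(1,5)] P[OF ce(1,6) cf(1,6)] in \<open>simp_all add: sp(4,5)\<close>)
    then show ?thesis
      using 2 by (auto intro: has_bochner_integral_except_0 simp del: One_nat_def simp: V1 V2' cdot_add scaleR_add_right)
  next
    case 3
    have "has_bochner_integral lborel
       (\<lambda>x. indicator A (norm x) *\<^sub>R cdot (e2 (norm x) *s tang_field n p (sgn x)) (e1' (norm x) *s cross_field q (sgn x))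
          + indicator A (norm x) *\<^sub>R cdot (e3 (norm x) *s rad_field p (sgn x)) (e1' (norm x) *s cross_field q (sgn x))) (0 + 0)"
      by (intro has_bochner_integral_add)
        (use P[OF ce(2,4) cf(2,4)] P[OF ce(3,4) cf(3,4)] in \<open>simp_all add: z(1,2)\<close>)
    then show ?thesis
      using 3 by (auto intro: has_bochner_integral_except_0 simp del: One_nat_def simp: V1' V2 cdot_add scaleR_add_right)
  next
    case 4
    let ?T = "LINT r:A|lborel. of_real (r\<^sup>2) * (e2 r * cnj (e2' r))"
    let ?R = "LINT r:A|lborel. of_real (r\<^sup>2) * (e3 r * cnj (e3' r))"
    have I: "has_bochner_integral lborel
       (\<lambda>x. (indicator A (norm x) *\<^sub>R cdot (e2 (norm x) *s tang_field n p (sgn x)) (e2' (norm x) *s tang_field n' q (sgn x))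
          + indicator A (norm x) *\<^sub>R cdot (e2 (norm x) *s tang_field n p (sgn x)) (e3' (norm x) *s rad_field q (sgn x)))
         + (indicator A (norm x) *\<^sub>R cdot (e3 (norm x) *s rad_field p (sgn x)) (e2' (norm x) *s tang_field n' q (sgn x))
          + indicator A (norm x) *\<^sub>R cdot (e3 (norm x) *s rad_field p (sgn x)) (e3' (norm x) *s rad_field q (sgn x))))
       ((of_nat (n * (n + 1)) * J * ?T + 0) + (0 + J * ?R))"
      by (intro has_bochner_integral_add)
        (use P[OF ce(2,5) cf(2,5)] P[OF ce(2,6) cf(2,6)] P[OF ce(3,5) cf(3,5)] P[OF ce(3,6) cf(3,6)] in
          \<open>simp_all only: sp z mult_zero_left\<close>)
    have "(of_nat (n * (n + 1)) * J * ?T + 0) + (0 + J * ?R) =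
       of_nat (n * (n + 1)) * J * (LINT r:A|lborel. mode_density 2 n g a (\<lambda>r. cnj (g' r)) (\<lambda>r. cnj (a' r)) r)"
    proof (cases "J = 0")
      case False
      then have n': "n' = n" using J(2) by simp
      have rr: "complex_of_real (r\<^sup>2) * (of_real (r ^ (n - 1)) * of_real (r ^ (n - 1))) = of_real (r ^ (2 * n))" for r
      proof -
        have "2 * n = 2 + ((n - 1) + (n - 1))" using n(1) by simp
        then show ?thesis by (simp only: power_add of_real_mult)
      qed
      define N where "N = complex_of_nat (n * (n + 1))"
      \<comment> \<open>The radial amplitudes bring n (n + 1) twice and the tangential pairing
        brings it once; taking out one factor leaves the density for \<open>l = 2\<close>.\<close>
      have md: "N * mode_density 2 n g a (\<lambda>r. cnj (g' r)) (\<lambda>r. cnj (a' r)) r =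
          N * (of_real (r\<^sup>2) * (e2 r * cnj (e2' r))) + of_real (r\<^sup>2) * (e3 r * cnj (e3' r))" for r
      proof -
        have "N * (of_real (r\<^sup>2) * (e2 r * cnj (e2' r))) + of_real (r\<^sup>2) * (e3 r * cnj (e3' r)) =
           (N * (a r * cnj (a' r)) + N * N * (g r * cnj (g' r))) *
             (complex_of_real (r\<^sup>2) * (of_real (r ^ (n - 1)) * of_real (r ^ (n - 1))))"
          unfolding e2_def e2'_def e3_def e3'_def n' N_def[symmetric]
          by (simp add: N_def[symmetric] algebra_simps) (simp add: N_def algebra_simps)
        then show ?thesis
          unfolding rr by (simp add: mode_density_def N_def algebra_simps)
      qed
      have sub: "set_integrable lborel A f" if "set_integrable lborel {u..v} f" for f :: "real \<Rightarrow> complex"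
        using that by (rule set_integrable_subset) (use A in auto)
      have i: "set_integrable lborel A (\<lambda>r. of_real (r\<^sup>2) * (e2 r * cnj (e2' r)))"
         "set_integrable lborel A (\<lambda>r. of_real (r\<^sup>2) * (e3 r * cnj (e3' r)))"
        by (intro sub borel_integrable_atLeastAtMost' continuous_intros ce)+
      have "N * (LINT r:A|lborel. mode_density 2 n g a (\<lambda>r. cnj (g' r)) (\<lambda>r. cnj (a' r)) r) = N * ?T + ?R"
        unfolding set_integral_mult_right[symmetric] md
        by (rule set_integral_add(2)) (use i in auto)
      moreover have "(c * J * T + 0) + (0 + J * S) = c * J * M" if "c * M = c * T + S" for c T S M
      proof -
        have "(c * J * T + 0) + (0 + J * S) = J * (c * T + S)"
          by (simp add: algebra_simps)
        then show ?thesis by (simp add: that[symmetric])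
      qed
      ultimately show ?thesis by (simp only: N_def)
    qed simp
    with I show ?thesis
      using 4 by (auto intro: has_bochner_integral_except_0 simp del: One_nat_def simp: V2 V2' cdot_add scaleR_add_right)
  qed
qed

section \<open>Radial functions\<close>

lemma ent_sin_has_derivative:
  assumes "z \<noteq> 0"
  shows "(ent_sin n has_field_derivative - (z * ent_sin (Suc n) z)) (at z)"
proof -
  have "(ray_sin n has_field_derivative - (z * ent_sin (Suc n) z)) (at z)"
    using ray_sin_has_derivative[OF assms] ray_sin_eq_ent_sin[OF assms] by (simp del: ent_sin.simps)
  then show ?thesis
    by (rule has_field_derivative_transform_within_open[of _ _ _ "- {0}"])
      (use assms in \<open>auto simp: ray_sin_eq_ent_sin\<close>)
qed

lemma ent_sin_recurrence:
  "z \<noteq> 0 \<Longrightarrow> ent_sin n z = of_nat (2 * n + 3) * ent_sin (Suc n) z - z\<^sup>2 * ent_sin (Suc (Suc n)) z"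
  using ray_sin_recurrence[of z n] by (simp only: ray_sin_eq_ent_sin simp_thms)

definition rad_g :: "(nat \<Rightarrow> complex \<Rightarrow> complex) \<Rightarrow> complex \<Rightarrow> nat \<Rightarrow> real \<Rightarrow> complex" where
  "rad_g \<phi> k n r = k ^ n * \<phi> n (k * of_real r)"

text \<open>This is (n + 1) g + r g' with the derivative eliminated by the rule that the derivative
  of \<phi> n is - z \<phi> (n + 1).\<close>

definition rad_a :: "(nat \<Rightarrow> complex \<Rightarrow> complex) \<Rightarrow> complex \<Rightarrow> nat \<Rightarrow> real \<Rightarrow> complex" where
  "rad_a \<phi> k n r = k ^ n * (of_nat (n + 1) * \<phi> n (k * of_real r)
     - (k * of_real r)\<^sup>2 * \<phi> (Suc n) (k * of_real r))"

text \<open>The derivative rule yields the first equation; the recurrence, which stands for the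
  spherical Bessel equation, yields the second. Entire and singular solutions share this
  argument.\<close>

lemma radial_system_rad:
  assumes D: "\<And>n z. z \<noteq> 0 \<Longrightarrow> (\<phi> n has_field_derivative - (z * \<phi> (Suc n) z)) (at z)"
    and R: "\<And>n z. z \<noteq> 0 \<Longrightarrow> \<phi> n z = of_nat (2 * n + 3) * \<phi> (Suc n) z - z\<^sup>2 * \<phi> (Suc (Suc n)) z"
    and k: "k \<noteq> 0"
  shows "radial_system n (rad_g \<phi> k n) (rad_a \<phi> k n) (\<lambda>r. k\<^sup>2 * rad_g \<phi> k n r)"
  unfolding radial_system_def
proof (intro allI impI conjI)
  fix r :: real assume r: "r > 0"
  define z where "z = k * of_real r"
  have z: "z \<noteq> 0" using r k by (simp add: z_def)
  have kz: "k = z / of_real r" using r by (simp add: z_def)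
  have lin: "((\<lambda>r. k * complex_of_real r) has_vector_derivative k) (at r)"
    by (rule has_vector_derivative_eq_rhs, rule has_vector_derivative_mult_right)
      (auto intro!: derivative_eq_intros)
  have d: "((\<lambda>r. \<phi> m (k * of_real r)) has_vector_derivative - (z * \<phi> (Suc m) z) * k) (at r)" for m
    using field_vector_diff_chain_at[OF lin, of "\<phi> m" "- (z * \<phi> (Suc m) z)"] D[OF z, of m]
    by (simp add: o_def z_def mult.commute)
  have "((\<lambda>r. k ^ n * \<phi> n (k * of_real r)) has_vector_derivative k ^ n * (- (z * \<phi> (Suc n) z) * k)) (at r)"
    by (rule has_vector_derivative_mult_right[OF d])
  moreover have "k ^ n * (- (z * \<phi> (Suc n) z) * k) = (rad_a \<phi> k n r - of_nat (n + 1) * rad_g \<phi> k n r) / of_real r"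
    unfolding rad_a_def rad_g_def z_def[symmetric] using r
    by (simp add: z_def field_simps power2_eq_square)
  ultimately show "(rad_g \<phi> k n has_vector_derivative (rad_a \<phi> k n r - of_nat (n + 1) * rad_g \<phi> k n r) / of_real r) (at r)"
    unfolding rad_g_def[abs_def] by simp
  have "((\<lambda>r. k ^ n * (of_nat (n + 1) * \<phi> n (k * of_real r) - k * of_real r * (k * of_real r) * \<phi> (Suc n) (k * of_real r)))
     has_vector_derivative k ^ n * (of_nat (n + 1) * (- (z * \<phi> (Suc n) z) * k)
       - (z * z * (- (z * \<phi> (Suc (Suc n)) z) * k) + (z * k + k * z) * \<phi> (Suc n) z))) (at r)"
    unfolding z_def
    by (intro has_vector_derivative_mult_right has_vector_derivative_diff has_vector_derivative_mult lin d[unfolded z_def])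
  moreover have "k ^ n * (of_nat (n + 1) * (- (z * \<phi> (Suc n) z) * k)
       - (z * z * (- (z * \<phi> (Suc (Suc n)) z) * k) + (z * k + k * z) * \<phi> (Suc n) z)) =
      of_nat n * (of_nat (n + 1) * rad_g \<phi> k n r - rad_a \<phi> k n r) / of_real r - of_real r * (k\<^sup>2 * rad_g \<phi> k n r)"
  proof -
    have "of_nat n * (of_nat (n + 1) * rad_g \<phi> k n r - rad_a \<phi> k n r) / of_real r - of_real r * (k\<^sup>2 * rad_g \<phi> k n r)
       = k ^ n * (of_nat n * z * k * \<phi> (Suc n) z - z * k * \<phi> n z)"
      unfolding rad_a_def rad_g_def z_def[symmetric] using r
      by (simp add: z_def field_simps power2_eq_square)
    then show ?thesis
      unfolding R[OF z, of n] by (simp add: algebra_simps power2_eq_square)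
  qed
  ultimately show "(rad_a \<phi> k n has_vector_derivative
      of_nat n * (of_nat (n + 1) * rad_g \<phi> k n r - rad_a \<phi> k n r) / of_real r - of_real r * (k\<^sup>2 * rad_g \<phi> k n r)) (at r)"
    unfolding rad_a_def[abs_def] power2_eq_square[of "k * complex_of_real _"] by simp
qed

lemmas radial_system_sin = radial_system_rad[of ent_sin, OF ent_sin_has_derivative ent_sin_recurrence]
lemmas radial_system_cos = radial_system_rad[of ray_cos, OF ray_cos_has_derivative ray_cos_recurrence]

lemma radial_system_linear:
  assumes "radial_system n g a h" "radial_system n g' a' h'"
  shows "radial_system n (\<lambda>r. c * g r + c' * g' r) (\<lambda>r. c * a r + c' * a' r) (\<lambda>r. c * h r + c' * h' r)"
  unfolding radial_system_def
proof (intro allI impI conjI)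
  fix r :: real assume r: "r > 0"
  note d = radial_systemD[OF assms(1) r] radial_systemD[OF assms(2) r]
  show "((\<lambda>r. c * g r + c' * g' r) has_vector_derivative
      (c * a r + c' * a' r - of_nat (n + 1) * (c * g r + c' * g' r)) / of_real r) (at r)"
    using has_vector_derivative_add[OF has_vector_derivative_mult_right[OF d(1), of c] has_vector_derivative_mult_right[OF d(3), of c']]
    by (simp add: algebra_simps add_divide_distrib diff_divide_distrib)
  show "((\<lambda>r. c * a r + c' * a' r) has_vector_derivative
      of_nat n * (of_nat (n + 1) * (c * g r + c' * g' r) - (c * a r + c' * a' r)) / of_real r
        - of_real r * (c * h r + c' * h' r)) (at r)"
    using has_vector_derivative_add[OF has_vector_derivative_mult_right[OF d(2), of c] has_vector_derivative_mult_right[OF d(4), of c']]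
    by (simp add: algebra_simps add_divide_distrib diff_divide_distrib)
qed

lemma radial_system_cnj:
  assumes "radial_system n g a h"
  shows "radial_system n (\<lambda>r. cnj (g r)) (\<lambda>r. cnj (a r)) (\<lambda>r. cnj (h r))"
  unfolding radial_system_def
proof (intro allI impI conjI)
  fix r :: real assume r: "r > 0"
  note d = radial_systemD[OF assms r]
  show "((\<lambda>r. cnj (g r)) has_vector_derivative (cnj (a r) - of_nat (n + 1) * cnj (g r)) / of_real r) (at r)"
    using has_vector_derivative_cnj[OF d(1)] by simp
  show "((\<lambda>r. cnj (a r)) has_vector_derivative
      of_nat n * (of_nat (n + 1) * cnj (g r) - cnj (a r)) / of_real r - of_real r * cnj (h r)) (at r)"
    using has_vector_derivative_cnj[OF d(2)] by simp
qed

text \<open>Lommel's integrals for two waves with squared wave numbers \<open>q\<close> and \<open>q'\<close>.\<close>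

definition lommel ::
  "nat \<Rightarrow> nat \<Rightarrow> complex \<Rightarrow> complex \<Rightarrow> (real \<Rightarrow> complex) \<Rightarrow> (real \<Rightarrow> complex) \<Rightarrow> (real \<Rightarrow> complex) \<Rightarrow> (real \<Rightarrow> complex) \<Rightarrow> real \<Rightarrow> complex" where
  "lommel l n q q' g a g' a' r = of_real (r ^ (2 * n + 1)) *
     ((if l = 1 then 1 else q) * (g r * a' r) - (if l = 1 then 1 else q') * (a r * g' r)) / (q - q')"

text \<open>The power r^(2n+1) cancels the terms of the system with 2n + 1. For \<open>l = 1\<close>
  the products a a' and n (n + 1) g g' cancel and (q - q') r^2 g g' stays. The weights q and q' used
  for \<open>l = 2\<close> reverse this: the r^2 terms cancel and q - q' multiplies a a' + n (n + 1)
  g g'.\<close>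

lemma lommel_has_derivative:
  assumes g: "radial_system n g a (\<lambda>r. q * g r)" and g': "radial_system n g' a' (\<lambda>r. q' * g' r)"
    and r: "r > 0" and q: "q \<noteq> q'"
  shows "(lommel l n q q' g a g' a' has_vector_derivative mode_density l n g a g' a' r) (at r)"
proof -
  note d = radial_systemD[OF g r] radial_systemD[OF g' r]
  have pw: "((\<lambda>r. complex_of_real (r ^ (2 * n + 1))) has_vector_derivative of_real (real (2 * n + 1) * r ^ (2 * n))) (at r)"
    by (rule has_vector_derivative_of_real) (use DERIV_pow[of "2 * n + 1" r UNIV] in simp)
  define c c' where "c = (if l = 1 then 1 else q)" and "c' = (if l = 1 then 1 else q')"
  define R where "R = complex_of_real r"
  have R: "R \<noteq> 0" using r by (simp add: R_def)
  define G' A' H' B' where "G' = (a r - of_nat (n + 1) * g r) / R" and "A' = of_nat n * (of_nat (n + 1) * g r - a r) / R - R * (q * g r)"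
    and "H' = (a' r - of_nat (n + 1) * g' r) / R" and "B' = of_nat n * (of_nat (n + 1) * g' r - a' r) / R - R * (q' * g' r)"
  have "((\<lambda>r. inverse (q - q') * (of_real (r ^ (2 * n + 1)) * (c * (g r * a' r) - c' * (a r * g' r)))) has_vector_derivative
     inverse (q - q') * (of_real (r ^ (2 * n + 1)) * (c * (g r * B' + G' * a' r) - c' * (a r * H' + A' * g' r))
       + of_real (real (2 * n + 1) * r ^ (2 * n)) * (c * (g r * a' r) - c' * (a r * g' r)))) (at r)"
    unfolding G'_def A'_def H'_def B'_def R_def
    by (intro has_vector_derivative_mult_right has_vector_derivative_mult has_vector_derivative_diff pw d)
  moreover have "of_real (r ^ (2 * n + 1)) * (c * (g r * B' + G' * a' r) - c' * (a r * H' + A' * g' r))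
       + of_real (real (2 * n + 1) * r ^ (2 * n)) * (c * (g r * a' r) - c' * (a r * g' r))
      = (q - q') * mode_density l n g a g' a' r"
  proof -
    have 1: "R * (g r * B' + G' * a' r) = a r * a' r - of_nat (2 * n + 1) * (g r * a' r) + of_nat (n * (n + 1)) * (g r * g' r) - q' * R * R * (g r * g' r)"
      unfolding G'_def B'_def using R by (simp add: field_simps)
    have 2: "R * (a r * H' + A' * g' r) = a r * a' r - of_nat (2 * n + 1) * (a r * g' r) + of_nat (n * (n + 1)) * (g r * g' r) - q * R * R * (g r * g' r)"
      unfolding H'_def A'_def using R by (simp add: field_simps)
    have "of_real (r ^ (2 * n + 1)) * (c * (g r * B' + G' * a' r) - c' * (a r * H' + A' * g' r))
       = of_real (r ^ (2 * n)) * (c * (R * (g r * B' + G' * a' r)) - c' * (R * (a r * H' + A' * g' r)))"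
      by (simp add: R_def algebra_simps)
    also have "\<dots> + of_real (real (2 * n + 1) * r ^ (2 * n)) * (c * (g r * a' r) - c' * (a r * g' r))
       = of_real (r ^ (2 * n)) * ((c - c') * (a r * a' r + of_nat (n * (n + 1)) * (g r * g' r)) + (c' * q - c * q') * R * R * (g r * g' r))"
      unfolding 1 2 by (simp add: algebra_simps)
    also have "\<dots> = (q - q') * mode_density l n g a g' a' r"
      by (cases "l = 1") (simp_all add: c_def c'_def mode_density_def R_def algebra_simps)
    finally show ?thesis .
  qed
  ultimately have "((\<lambda>r. inverse (q - q') * (of_real (r ^ (2 * n + 1)) * (c * (g r * a' r) - c' * (a r * g' r)))) has_vector_derivative
     mode_density l n g a g' a' r) (at r)"
    using q by (simp only: mult.assoc[symmetric] left_inverse right_minus_eq simp_thms mult_1_left)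
  moreover have "lommel l n q q' g a g' a' = (\<lambda>r. inverse (q - q') * (of_real (r ^ (2 * n + 1)) * (c * (g r * a' r) - c' * (a r * g' r))))"
    by (simp add: fun_eq_iff lommel_def c_def c'_def divide_inverse mult.commute)
  ultimately show ?thesis by simp
qed

text \<open>Origin of the weights in \<open>l_extend\<close>. Here A, B, C have index n - 1, n, n +
  1. With X the term containing C, the recurrence reads A = (2n+1) B - X, and then 2n + 1 times the
  density in B and X equals (n + 1) A A' + n X X': the mixed products cancel.\<close>

lemma mode_density_neighbours:
  fixes A B C A' B' C' k K :: complex and r :: real
  assumes n: "n \<ge> 1" and k: "k \<noteq> 0" "K \<noteq> 0"
    and R: "A = of_nat (2 * n + 1) * B - (k * of_real r)\<^sup>2 * C" "A' = of_nat (2 * n + 1) * B' - (K * of_real r)\<^sup>2 * C'"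
  shows "((k ^ n * (of_nat (n + 1) * B - (k * of_real r)\<^sup>2 * C)) * (K ^ n * (of_nat (n + 1) * B' - (K * of_real r)\<^sup>2 * C'))
       + of_nat (n * (n + 1)) * (k ^ n * B) * (K ^ n * B')) * of_real (r ^ (2 * n)) / (k * K)
     = (of_nat n + 1) / (2 * of_nat n + 1) * ((k ^ (n - 1) * A) * (K ^ (n - 1) * A') * of_real (r ^ (2 * (n - 1) + 2)))
       + of_nat n / (2 * of_nat n + 1) * ((k ^ (n + 1) * C) * (K ^ (n + 1) * C') * of_real (r ^ (2 * (n + 1) + 2)))"
proof -
  define N where "N = complex_of_nat n"
  define X where "X = (k * of_real r)\<^sup>2 * C"
  define X' where "X' = (K * of_real r)\<^sup>2 * C'"
  define P where "P = k ^ (n - 1) * K ^ (n - 1) * complex_of_real (r ^ (2 * n))"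
  have kn: "k ^ n = k * k ^ (n - 1)" "K ^ n = K * K ^ (n - 1)"
    using n by (cases n; simp)+
  have N1: "2 * N + 1 \<noteq> 0"
  proof -
    have "complex_of_nat (2 * n + 1) \<noteq> 0" unfolding of_nat_eq_0_iff by simp
    then show ?thesis by (simp add: N_def add.commute)
  qed
  have rn: "2 * (n - 1) + 2 = 2 * n" using n by simp
  have A: "A = (2 * N + 1) * B - X" "A' = (2 * N + 1) * B' - X'"
    using R by (simp_all add: N_def X_def X'_def)
  have "((k ^ n * (of_nat (n + 1) * B - X)) * (K ^ n * (of_nat (n + 1) * B' - X'))
       + of_nat (n * (n + 1)) * (k ^ n * B) * (K ^ n * B')) * of_real (r ^ (2 * n)) / (k * K)
     = P * (((N + 1) * B - X) * ((N + 1) * B' - X') + N * (N + 1) * B * B')"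
    unfolding kn P_def N_def using k by (simp add: field_simps)
  also have "\<dots> = P * (((N + 1) * (A * A') + N * (X * X')) / (2 * N + 1))"
  proof -
    have "(2 * N + 1) * (((N + 1) * B - X) * ((N + 1) * B' - X') + N * (N + 1) * B * B') = (N + 1) * (A * A') + N * (X * X')"
      unfolding A by (simp add: algebra_simps)
    then show ?thesis using N1 by (metis nonzero_mult_div_cancel_left)
  qed
  also have "\<dots> = (N + 1) / (2 * N + 1) * (P * (A * A')) + N / (2 * N + 1) * (P * (X * X'))"
    by (simp add: add_divide_distrib algebra_simps)
  also have "P * (A * A') = (k ^ (n - 1) * A) * (K ^ (n - 1) * A') * of_real (r ^ (2 * (n - 1) + 2))"
    unfolding P_def rn by (simp add: mult_ac)
  also have "P * (X * X') = (k ^ (n + 1) * C) * (K ^ (n + 1) * C') * of_real (r ^ (2 * (n + 1) + 2))"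
    unfolding P_def X_def X'_def power_add power_one_right kn by (simp add: power2_eq_square power_add mult_ac)
  finally show ?thesis
    unfolding X_def X'_def N_def .
qed

text \<open>The radial pairs \<open>(g, a)\<close> of \<open>j\<^sub>n\<close> and \<open>y\<^sub>n\<close>.  The first is built from \<open>ent_sin\<close> so as to be
  continuous at \<open>0\<close>, where \<open>sph_j\<close> has a junk value.\<close>

definition Jg :: "complex \<Rightarrow> nat \<Rightarrow> real \<Rightarrow> complex" where "Jg = rad_g ent_sin"
definition Ja :: "complex \<Rightarrow> nat \<Rightarrow> real \<Rightarrow> complex" where "Ja = rad_a ent_sin"
definition Yg :: "complex \<Rightarrow> nat \<Rightarrow> real \<Rightarrow> complex" where "Yg k n r = - rad_g ray_cos k n r"
definition Ya :: "complex \<Rightarrow> nat \<Rightarrow> real \<Rightarrow> complex" where "Ya k n r = - rad_a ray_cos k n r"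

abbreviation (input) cJg :: "complex \<Rightarrow> nat \<Rightarrow> real \<Rightarrow> complex" where "cJg k n \<equiv> \<lambda>r. cnj (Jg k n r)"
abbreviation (input) cJa :: "complex \<Rightarrow> nat \<Rightarrow> real \<Rightarrow> complex" where "cJa k n \<equiv> \<lambda>r. cnj (Ja k n r)"

lemma J_system: "k \<noteq> 0 \<Longrightarrow> radial_system n (Jg k n) (Ja k n) (\<lambda>r. k\<^sup>2 * Jg k n r)"
  unfolding Jg_def Ja_def by (rule radial_system_sin)

lemma Y_system: "k \<noteq> 0 \<Longrightarrow> radial_system n (Yg k n) (Ya k n) (\<lambda>r. k\<^sup>2 * Yg k n r)"
  using radial_system_linear[OF radial_system_cos radial_system_cos, of k k n "- 1" 0]
  by (simp add: Yg_def[abs_def] Ya_def[abs_def])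

lemma J_cnj_system:
  "k \<noteq> 0 \<Longrightarrow> radial_system n (cJg k n) (cJa k n) (\<lambda>r. (cnj k)\<^sup>2 * cnj (Jg k n r))"
  using radial_system_cnj[OF J_system, of k n] by simp

lemma continuous_on_ent: "continuous_on A (\<lambda>r. ent_sin n (k * complex_of_real r))"
    "continuous_on A (\<lambda>r. ent_cos n (k * complex_of_real r))"
proof -
  have c: "continuous_on A (\<lambda>r. f (k * complex_of_real r))" if "continuous_on UNIV f" for f
    by (rule continuous_on_compose2[OF that]) (intro continuous_intros, simp)
  have "continuous_on UNIV (ent_sin n)" "continuous_on UNIV (ent_cos n)"
    by (intro holomorphic_on_imp_continuous_on ent_sin_holomorphic ent_cos_holomorphic)+
  then show "continuous_on A (\<lambda>r. ent_sin n (k * complex_of_real r))"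
    "continuous_on A (\<lambda>r. ent_cos n (k * complex_of_real r))"
    using c by blast+
qed

lemma continuous_on_J: "continuous_on A (Jg k n)" "continuous_on A (Ja k n)"
  unfolding Jg_def Ja_def rad_g_def[abs_def] rad_a_def[abs_def]
  by (intro continuous_intros continuous_on_ent)+

lemma continuous_on_Y:
  assumes "k \<noteq> 0" "u > 0"
  shows "continuous_on {u..v} (Yg k n)" "continuous_on {u..v} (Ya k n)"
proof -
  have c: "continuous_on {u..v} (\<lambda>r. ray_cos n (k * complex_of_real r))" for n
    by (rule continuous_on_eq[of _ "\<lambda>r. ent_cos n (k * complex_of_real r) / (k * complex_of_real r) ^ (2 * n + 1)"])
      (use assms in \<open>auto simp: ray_cos_eq_ent_cos intro!: continuous_intros continuous_on_ent\<close>)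
  show "continuous_on {u..v} (Yg k n)" "continuous_on {u..v} (Ya k n)"
    unfolding Yg_def[abs_def] Ya_def[abs_def] rad_g_def[abs_def] rad_a_def[abs_def]
    by (intro continuous_intros c)+
qed

lemma sph_eq_radial:
  assumes "k \<noteq> 0" "r > 0"
  shows "sph_j n (k * of_real r) = of_real (r ^ n) * Jg k n r"
    and "sph_y n (k * of_real r) = of_real (r ^ n) * Yg k n r"
    and "sph_h n (k * of_real r) = of_real (r ^ n) * (Jg k n r + \<i> * Yg k n r)"
  using assms
  by (simp_all add: sph_h_def sph_j_eq sph_y_eq Jg_def Yg_def rad_g_def ray_sin_eq_ent_sin power_mult_distrib algebra_simps)

text \<open>In terms of the pairs (g, a), the weight r^(2n+1) gives r^2 times the Wronskian in r of
  j_n(k r) and y_n(k r), which is constant.\<close>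

lemma radial_wronskian:
  assumes "k \<noteq> 0" "r > 0"
  shows "of_real (r ^ (2 * n + 1)) * (Jg k n r * Ya k n r - Yg k n r * Ja k n r) = 1 / k"
proof -
  define z where "z = k * complex_of_real r"
  have z: "z \<noteq> 0" using assms by (simp add: z_def)
  have "Jg k n r * Ya k n r - Yg k n r * Ja k n r = k ^ (2 * n) * z\<^sup>2 *
     (ray_sin n z * ray_cos (Suc n) z - ray_sin (Suc n) z * ray_cos n z)"
  proof -
    have "k ^ (2 * n) = k ^ n * k ^ n" by (simp add: mult_2 power_add)
    then show ?thesis
      unfolding Jg_def Ja_def Yg_def Ya_def rad_g_def rad_a_def z_def[symmetric] ray_sin_eq_ent_sin[OF z, symmetric]
      by (simp only:) (simp add: algebra_simps)
  qed
  also have "\<dots> = k ^ (2 * n) * z\<^sup>2 * (1 / z ^ (2 * n + 3))"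
    by (simp only: ray_wronskian[OF z])
  also have "z ^ (2 * n + 3) = z\<^sup>2 * (k ^ (2 * n) * of_real (r ^ (2 * n + 1)) * k)"
    by (simp add: z_def power_mult_distrib power_add eval_nat_numeral)
  finally show ?thesis using assms z by (simp add: field_simps)
qed

section \<open>Radial integrals and the coefficients of the statement\<close>

lemma set_integral_interval:
  fixes f :: "real \<Rightarrow> 'a::{banach, second_countable_topology}"
  assumes "{u<..<v} \<subseteq> A" "A \<subseteq> {u..v}"
  shows "(LINT r:A|lborel. f r) = (LINT r:{u..v}|lborel. f r)"
proof (rule set_integral_discrete_difference[where X = "{u, v}"])
  show "(A - {u..v}) \<union> ({u..v} - A) \<subseteq> {u, v}"
  proof
    fix x assume "x \<in> (A - {u..v}) \<union> ({u..v} - A)"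
    then have "x \<in> {u..v} - A" using assms(2) by auto
    then have "u \<le> x" "x \<le> v" "x \<notin> {u<..<v}" using assms(1) by auto
    then show "x \<in> {u, v}" by auto
  qed
qed (use assms(2) in auto)

text \<open>Discards the point 0, where \<open>sph_j\<close> and \<open>sph_y\<close> have arbitrary
  values.\<close>

lemma set_integral_pos_cong:
  fixes f g :: "real \<Rightarrow> 'a::{banach, second_countable_topology}"
  assumes "\<And>r. 0 < r \<Longrightarrow> r \<le> R \<Longrightarrow> f r = g r"
  shows "(LINT r:{0..R}|lborel. f r) = (LINT r:{0..R}|lborel. g r)"
proof -
  have "(LINT r:{0<..R}|lborel. f r) = (LINT r:{0<..R}|lborel. g r)"
    by (rule set_lebesgue_integral_cong) (use assms in auto)
  moreover have "(LINT r:{0<..R}|lborel. h r) = (LINT r:{0..R}|lborel. h r)" for h :: "real \<Rightarrow> 'a"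
    by (rule set_integral_interval) auto
  ultimately show ?thesis by metis
qed

text \<open>The radial system holds for r > 0 only, so at a left end point 0 a primitive is
  available by continuity but not by differentiation.\<close>

lemma set_integral_FTC_interior:
  fixes f :: "real \<Rightarrow> complex"
  assumes "a \<le> b" "continuous_on {a..b} f" "continuous_on {a..b} P"
    and "\<And>x. a < x \<Longrightarrow> x < b \<Longrightarrow> (P has_vector_derivative f x) (at x)"
  shows "(LINT r:{a..b}|lborel. f r) = P b - P a"
proof -
  have "set_integrable lborel {a..b} f"
    by (rule borel_integrable_atLeastAtMost') fact
  then have "(LINT r:{a..b}|lborel. f r) = integral {a..b} f"
    by (rule set_borel_integral_eq_integral(2))
  also have "(f has_integral (P b - P a)) {a..b}"
    by (rule fundamental_theorem_of_calculus_interior) (use assms in auto)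
  then have "integral {a..b} f = P b - P a"
    by (rule integral_unique)
  finally show ?thesis .
qed

definition kap :: "nat \<Rightarrow> complex \<Rightarrow> complex" where
  "kap l k = (if l = 1 then 1 else 1 / k)"

lemma ent_neighbours:
  assumes "k \<noteq> 0" "r > 0" "n \<ge> 1"
  shows "ent_sin (n - 1) (k * of_real r) = of_nat (2 * n + 1) * ent_sin n (k * of_real r) - (k * of_real r)\<^sup>2 * ent_sin (Suc n) (k * of_real r)"
    and "ray_cos (n - 1) (k * of_real r) = of_nat (2 * n + 1) * ray_cos n (k * of_real r) - (k * of_real r)\<^sup>2 * ray_cos (Suc n) (k * of_real r)"
proof -
  have "k * of_real r \<noteq> 0" "2 * (n - 1) + 3 = 2 * n + 1" "Suc (n - 1) = n"
    using assms by auto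
  then show "ent_sin (n - 1) (k * of_real r) = of_nat (2 * n + 1) * ent_sin n (k * of_real r) - (k * of_real r)\<^sup>2 * ent_sin (Suc n) (k * of_real r)"
    and "ray_cos (n - 1) (k * of_real r) = of_nat (2 * n + 1) * ray_cos n (k * of_real r) - (k * of_real r)\<^sup>2 * ray_cos (Suc n) (k * of_real r)"
    using ent_sin_recurrence[of "k * of_real r" "n - 1"] ray_cos_recurrence[of "k * of_real r" "n - 1"] by metis+
qed

text \<open>Links the densities of the waves to the integrands of the coefficients; for
  \<open>l = 2\<close> the normalisation 1/k of each factor is what
  \<open>mode_density_neighbours\<close> divides by.\<close>

lemma mode_density_extend:
  assumes k: "k \<noteq> 0" and r: "r > 0" and n: "n \<ge> 1" and l: "l \<in> {1, 2}"
  shows "kap l k * kap l (cnj k) * mode_density l n (Jg k n) (Ja k n) (cJg k n) (cJa k n) r =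
      l_extend (\<lambda>n. Jg k n r * cnj (Jg k n r) * of_real (r ^ (2 * n + 2))) n l"
    and "kap l k * kap l (cnj k) * mode_density l n (Yg k n) (Ya k n) (cJg k n) (cJa k n) r =
      l_extend (\<lambda>n. Yg k n r * cnj (Jg k n r) * of_real (r ^ (2 * n + 2))) n l"
    and "kap l k * kap l k * mode_density l n (Jg k n) (Ja k n) (Jg k n) (Ja k n) r =
      l_extend (\<lambda>n. Jg k n r * Jg k n r * of_real (r ^ (2 * n + 2))) n l"
proof -
  have cn: "cnj (ent_sin (n - 1) (k * of_real r)) = of_nat (2 * n + 1) * cnj (ent_sin n (k * of_real r))
      - (cnj k * of_real r)\<^sup>2 * cnj (ent_sin (Suc n) (k * of_real r))"
    by (subst ent_neighbours(1)[OF k r n]) simp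
  have k': "cnj k \<noteq> 0" using k by simp
  have A: "kap l k * kap l (cnj k) * mode_density l n (rad_g \<phi> k n) (rad_a \<phi> k n) (cJg k n) (cJa k n) r =
      l_extend (\<lambda>n. rad_g \<phi> k n r * cnj (Jg k n r) * of_real (r ^ (2 * n + 2))) n l"
    if "\<phi> (n - 1) (k * of_real r) = of_nat (2 * n + 1) * \<phi> n (k * of_real r) - (k * of_real r)\<^sup>2 * \<phi> (Suc n) (k * of_real r)" for \<phi>
  proof (cases "l = 1")
    case True
    then show ?thesis by (simp add: kap_def mode_density_def l_extend_def)
  next
    case False
    have "kap l k * kap l (cnj k) * M = M / (k * cnj k)" for M
      using False by (simp add: kap_def)
    then show ?thesis
      using mode_density_neighbours[OF n k k' that cn] False
      by (simp add: mode_density_def l_extend_def Jg_def Ja_def rad_g_def rad_a_def del: ent_sin.simps)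
  qed
  show "kap l k * kap l (cnj k) * mode_density l n (Jg k n) (Ja k n) (cJg k n) (cJa k n) r =
      l_extend (\<lambda>n. Jg k n r * cnj (Jg k n r) * of_real (r ^ (2 * n + 2))) n l"
    using A[of ent_sin, OF ent_neighbours(1)[OF k r n]] unfolding Jg_def Ja_def .
  have "mode_density l n (Yg k n) (Ya k n) (cJg k n) (cJa k n) r =
      - mode_density l n (rad_g ray_cos k n) (rad_a ray_cos k n) (cJg k n) (cJa k n) r"
    by (simp add: mode_density_def Yg_def Ya_def algebra_simps)
  moreover have "l_extend (\<lambda>n. Yg k n r * cnj (Jg k n r) * of_real (r ^ (2 * n + 2))) n l =
     - l_extend (\<lambda>n. rad_g ray_cos k n r * cnj (Jg k n r) * of_real (r ^ (2 * n + 2))) n l"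
    by (simp add: l_extend_def Yg_def)
  ultimately show "kap l k * kap l (cnj k) * mode_density l n (Yg k n) (Ya k n) (cJg k n) (cJa k n) r =
      l_extend (\<lambda>n. Yg k n r * cnj (Jg k n r) * of_real (r ^ (2 * n + 2))) n l"
    using A[of ray_cos, OF ent_neighbours(2)[OF k r n]] by simp
  show "kap l k * kap l k * mode_density l n (Jg k n) (Ja k n) (Jg k n) (Ja k n) r =
      l_extend (\<lambda>n. Jg k n r * Jg k n r * of_real (r ^ (2 * n + 2))) n l"
  proof (cases "l = 1")
    case True
    then show ?thesis by (simp add: kap_def mode_density_def l_extend_def)
  next
    case False
    have "kap l k * kap l k * M = M / (k * k)" for M
      using False by (simp add: kap_def)
    then show ?thesis
      using mode_density_neighbours[OF n k k ent_neighbours(1)[OF k r n] ent_neighbours(1)[OF k r n]] False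
      by (simp add: mode_density_def l_extend_def Jg_def Ja_def rad_g_def rad_a_def del: ent_sin.simps)
  qed
qed

lemma l_extend_integral:
  fixes f :: "nat \<Rightarrow> real \<Rightarrow> complex"
  assumes "\<And>n. continuous_on {0..R} (f n)"
  shows "(LINT r:{0..R}|lborel. l_extend (\<lambda>n. f n r) n l) = l_extend (\<lambda>n. LINT r:{0..R}|lborel. f n r) n l"
proof -
  have i: "set_integrable lborel {0..R} (\<lambda>r. c * f n r)" for c n
    by (intro borel_integrable_atLeastAtMost' continuous_intros assms)
  show ?thesis
  proof (cases "l = 1")
    case False
    show ?thesis
      unfolding l_extend_def if_not_P[OF False] set_integral_add(2)[OF i i] set_integral_mult_right ..
  qed (simp add: l_extend_def)
qed

lemma continuous_l_extend:
  fixes f :: "nat \<Rightarrow> real \<Rightarrow> complex"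
  assumes "\<And>n. continuous_on A (f n)"
  shows "continuous_on A (\<lambda>r. l_extend (\<lambda>n. f n r) n l)"
proof (cases "l = 1")
  case False
  then show ?thesis
    unfolding l_extend_def if_not_P[OF False]
    by (intro continuous_on_add continuous_on_mult continuous_on_const assms)
qed (simp add: l_extend_def assms)

lemma I_jjs_eq:
  assumes k: "k \<noteq> 0" and n: "n \<ge> 1" and l: "l \<in> {1, 2}"
  shows "complex_of_real (I_jjs k R n l) = kap l k * kap l (cnj k) *
    (LINT r:{0..R}|lborel. mode_density l n (Jg k n) (Ja k n) (cJg k n) (cJa k n) r)"
proof -
  have b: "complex_of_real (LINT r:{0..R}|lborel. (cmod (sph_j n (k * of_real r)))\<^sup>2 * r\<^sup>2) =
      (LINT r:{0..R}|lborel. Jg k n r * cnj (Jg k n r) * of_real (r ^ (2 * n + 2)))" for n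
    unfolding set_integral_complex_of_real[symmetric]
  proof (rule set_integral_pos_cong)
    fix r :: real assume "0 < r" "r \<le> R"
    have eq: "complex_of_real ((cmod (sph_j n (k * of_real r)))\<^sup>2 * r\<^sup>2) = sph_j n (k * of_real r) * cnj (sph_j n (k * of_real r)) * of_real (r\<^sup>2)"
      by (simp only: of_real_mult complex_norm_square)
    show "complex_of_real ((cmod (sph_j n (k * of_real r)))\<^sup>2 * r\<^sup>2) = Jg k n r * cnj (Jg k n r) * of_real (r ^ (2 * n + 2))"
      unfolding eq unfolding sph_eq_radial(1)[OF k \<open>0 < r\<close>] by (simp add: power_add mult_2 power2_eq_square)
  qed
  have "complex_of_real (I_jjs k R n l) = l_extend (\<lambda>n. complex_of_real (LINT r:{0..R}|lborel. (cmod (sph_j n (k * of_real r)))\<^sup>2 * r\<^sup>2)) n l"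
    by (simp add: I_jjs_def l_extend_def)
  also have "\<dots> = (LINT r:{0..R}|lborel. l_extend (\<lambda>n. Jg k n r * cnj (Jg k n r) * of_real (r ^ (2 * n + 2))) n l)"
    unfolding b by (rule l_extend_integral[symmetric]) (intro continuous_intros continuous_on_J)
  also have "\<dots> = (LINT r:{0..R}|lborel. kap l k * kap l (cnj k) *
      mode_density l n (Jg k n) (Ja k n) (cJg k n) (cJa k n) r)"
    by (rule set_integral_pos_cong) (simp only: mode_density_extend(1)[OF k _ n l])
  finally show ?thesis by simp
qed

lemma I_jj_eq:
  assumes k: "k \<noteq> 0" and n: "n \<ge> 1" and l: "l \<in> {1, 2}"
  shows "I_jj k R n l = kap l k * kap l k *
    (LINT r:{0..R}|lborel. mode_density l n (Jg k n) (Ja k n) (Jg k n) (Ja k n) r)"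
proof -
  have b: "(LINT r:{0..R}|lborel. (sph_j n (k * of_real r))\<^sup>2 * of_real (r\<^sup>2)) =
      (LINT r:{0..R}|lborel. Jg k n r * Jg k n r * of_real (r ^ (2 * n + 2)))" for n
  proof (rule set_integral_pos_cong)
    fix r :: real assume "0 < r" "r \<le> R"
    show "(sph_j n (k * of_real r))\<^sup>2 * of_real (r\<^sup>2) = Jg k n r * Jg k n r * of_real (r ^ (2 * n + 2))"
      unfolding sph_eq_radial(1)[OF k \<open>0 < r\<close>] by (simp add: power_add mult_2 power2_eq_square)
  qed
  have "I_jj k R n l = (LINT r:{0..R}|lborel. l_extend (\<lambda>n. Jg k n r * Jg k n r * of_real (r ^ (2 * n + 2))) n l)"
    unfolding I_jj_def b by (rule l_extend_integral[symmetric]) (intro continuous_intros continuous_on_J)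
  also have "\<dots> = (LINT r:{0..R}|lborel. kap l k * kap l k *
      mode_density l n (Jg k n) (Ja k n) (Jg k n) (Ja k n) r)"
    by (rule set_integral_pos_cong) (simp only: mode_density_extend(3)[OF k _ n l])
  finally show ?thesis by simp
qed

abbreviation lommel_J :: "complex \<Rightarrow> nat \<Rightarrow> nat \<Rightarrow> real \<Rightarrow> complex" where
  "lommel_J k l n \<equiv> lommel l n (k\<^sup>2) ((cnj k)\<^sup>2) (Jg k n) (Ja k n) (cJg k n) (cJa k n)"

abbreviation lommel_Y :: "complex \<Rightarrow> nat \<Rightarrow> nat \<Rightarrow> real \<Rightarrow> complex" where
  "lommel_Y k l n \<equiv> lommel l n (k\<^sup>2) ((cnj k)\<^sup>2) (Yg k n) (Ya k n) (cJg k n) (cJa k n)"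

abbreviation density_J :: "complex \<Rightarrow> nat \<Rightarrow> nat \<Rightarrow> real \<Rightarrow> complex" where
  "density_J k l n \<equiv> mode_density l n (Jg k n) (Ja k n) (cJg k n) (cJa k n)"

abbreviation density_Y :: "complex \<Rightarrow> nat \<Rightarrow> nat \<Rightarrow> real \<Rightarrow> complex" where
  "density_Y k l n \<equiv> mode_density l n (Yg k n) (Ya k n) (cJg k n) (cJa k n)"

lemma continuous_mode_density:
  assumes "continuous_on A g" "continuous_on A a" "continuous_on A g'" "continuous_on A a'"
  shows "continuous_on A (mode_density l n g a g' a')"
  unfolding mode_density_def[abs_def] by (cases "l = 1") (simp_all, (intro continuous_intros assms)+)

lemma continuous_lommel:
  assumes "continuous_on A g" "continuous_on A a" "continuous_on A g'" "continuous_on A a'"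
  shows "continuous_on A (lommel l n q q' g a g' a')"
  unfolding lommel_def[abs_def] divide_inverse by (intro continuous_intros assms)

text \<open>Source of the constant 4 k1' k1'': the difference of squared wave numbers in Lommel's
  denominator for a wave and its conjugate.\<close>

lemma square_diff_cnj: "k\<^sup>2 - (cnj k)\<^sup>2 = \<i> * of_real (4 * Re k * Im k)"
  by (simp add: complex_eq_iff power2_eq_square)

lemma integral_density_J:
  assumes k: "k \<noteq> 0" "k\<^sup>2 \<noteq> (cnj k)\<^sup>2" and "0 \<le> u" "u \<le> v"
  shows "(LINT r:{u..v}|lborel. density_J k l n r) = lommel_J k l n v - lommel_J k l n u"
  by (rule set_integral_FTC_interior)
    (use assms in \<open>auto intro!: continuous_mode_density continuous_lommel continuous_on_J continuous_intros
       lommel_has_derivative J_system J_cnj_system\<close>)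

lemma integral_density_Y:
  assumes k: "k \<noteq> 0" "k\<^sup>2 \<noteq> (cnj k)\<^sup>2" and "0 < u" "u \<le> v"
  shows "(LINT r:{u..v}|lborel. density_Y k l n r) = lommel_Y k l n v - lommel_Y k l n u"
  by (rule set_integral_FTC_interior)
    (use assms in \<open>auto intro!: continuous_mode_density continuous_lommel continuous_on_J continuous_on_Y continuous_intros
       lommel_has_derivative Y_system J_cnj_system\<close>)

lemma I_jjs_lommel:
  assumes k: "k \<noteq> 0" "k\<^sup>2 \<noteq> (cnj k)\<^sup>2" and n: "n \<ge> 1" and l: "l \<in> {1, 2}" and R: "R \<ge> 0"
  shows "complex_of_real (I_jjs k R n l) = kap l k * kap l (cnj k) * lommel_J k l n R"
  unfolding I_jjs_eq[OF k(1) n l] integral_density_J[OF k order_refl R] by (simp add: lommel_def)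

text \<open>The weight r^(2n+1) in \<open>lommel\<close> matches the order of the pole of
  \<open>Yg\<close>, so the weighted functions extend continuously to 0.\<close>

lemma Y_eq_ent_cos:
  assumes "k \<noteq> 0" "r > 0"
  shows "of_real (r ^ (2 * n + 1)) * Yg k n r = - (ent_cos n (k * of_real r) / k ^ (n + 1))"
    and "of_real (r ^ (2 * n + 1)) * Ya k n r =
      - ((of_nat (n + 1) * ent_cos n (k * of_real r) - ent_cos (Suc n) (k * of_real r)) / k ^ (n + 1))"
proof -
  define z where "z = k * complex_of_real r"
  have z: "z \<noteq> 0" using assms by (simp add: z_def)
  define c where "c = z ^ (2 * n + 1)"
  have c: "c \<noteq> 0" using z by (simp add: c_def)
  have rk: "of_real (r ^ (2 * n + 1)) * k ^ n = c / k ^ (n + 1)"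
  proof -
    have "k ^ (2 * n + 1) = k ^ n * k ^ (n + 1)" by (simp flip: power_add add: mult_2)
    then have "c = of_real (r ^ (2 * n + 1)) * k ^ n * k ^ (n + 1)"
      by (simp only: c_def z_def power_mult_distrib of_real_power mult_ac)
    then show ?thesis using assms(1) by simp
  qed
  have R: "ray_cos n z = ent_cos n z / c" "z\<^sup>2 * ray_cos (Suc n) z = ent_cos (Suc n) z / c"
  proof -
    have "z ^ (2 * Suc n + 1) = z\<^sup>2 * c" by (simp add: c_def power2_eq_square)
    then show "z\<^sup>2 * ray_cos (Suc n) z = ent_cos (Suc n) z / c"
      unfolding ray_cos_eq_ent_cos[OF z] using z by simp
  qed (simp add: ray_cos_eq_ent_cos[OF z] c_def)
  have "of_real (r ^ (2 * n + 1)) * Yg k n r = - ((of_real (r ^ (2 * n + 1)) * k ^ n) * ray_cos n z)"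
    by (simp add: Yg_def rad_g_def z_def)
  then show "of_real (r ^ (2 * n + 1)) * Yg k n r = - (ent_cos n (k * of_real r) / k ^ (n + 1))"
    unfolding rk R z_def[symmetric] using c by simp
  have "of_real (r ^ (2 * n + 1)) * Ya k n r = - ((of_real (r ^ (2 * n + 1)) * k ^ n) * (of_nat (n + 1) * ray_cos n z - z\<^sup>2 * ray_cos (Suc n) z))"
    by (simp add: Ya_def rad_a_def z_def)
  moreover have "of_real (r ^ (2 * n + 1)) * Ya k n r =
      - ((of_nat (n + 1) * ent_cos n (k * of_real r) - ent_cos (Suc n) (k * of_real r)) / k ^ (n + 1))"
    if *: "of_real (r ^ (2 * n + 1)) * Ya k n r = - ((of_real (r ^ (2 * n + 1)) * k ^ n) * (of_nat (n + 1) * ray_cos n z - z\<^sup>2 * ray_cos (Suc n) z))"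
  proof -
    have "(c / m) * (A * (T / c) - U / c) = (A * T - U) / m" for A T U m
      using c by (simp flip: diff_divide_distrib add: times_divide_eq_right)
    then show ?thesis
      unfolding * rk R z_def[symmetric] by (simp only:)
  qed
  ultimately show "of_real (r ^ (2 * n + 1)) * Ya k n r =
      - ((of_nat (n + 1) * ent_cos n (k * of_real r) - ent_cos (Suc n) (k * of_real r)) / k ^ (n + 1))"
    by blast
qed

text \<open>The boundary term at \<open>0\<close> is where \<open>E_coeff\<close> comes from: \<open>lommel_Y\<close> has a nonzero limit there
  although the integrand is continuous.\<close>

lemma I_yjs_lommel:
  assumes k: "k \<noteq> 0" "k\<^sup>2 \<noteq> (cnj k)\<^sup>2" and n: "n \<ge> 1" and l: "l \<in> {1, 2}" and R: "R > 0"
  shows "I_yjs k R n l = kap l k * kap l (cnj k) * lommel_Y k l n R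
     + kap l k * kap l (cnj k) * (cnj k ^ n / k ^ (n + 1)) *
       ((if l = 1 then 1 else k\<^sup>2) * of_nat (n + 1) + (if l = 1 then 1 else (cnj k)\<^sup>2) * of_nat n)
       / (of_nat (2 * n + 1) * (k\<^sup>2 - (cnj k)\<^sup>2))"
proof -
  \<comment> \<open>The integrand with y_n expressed through \<open>ent_cos\<close>: it agrees with
    the original for r > 0 and is continuous at 0.\<close>
  define f where "f \<nu> r = - (ent_cos \<nu> (k * complex_of_real r) * cnj (Jg k \<nu> r) * of_real r / k ^ (\<nu> + 1))" for \<nu> r
  define c c' where "c = (if l = 1 then 1 else k\<^sup>2)" and "c' = (if l = 1 then 1 else (cnj k)\<^sup>2)"
  define \<kappa> where "\<kappa> = kap l k * kap l (cnj k)"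
  \<comment> \<open>Likewise the continuous extension to 0 of the primitive \<open>lommel_Y\<close>,
    normalised by the factors of the two waves.\<close>
  define P where "P r = \<kappa> * (- (1 / k ^ (n + 1)) * (c * (ent_cos n (k * complex_of_real r) * cnj (Ja k n r))
     - c' * ((of_nat (n + 1) * ent_cos n (k * of_real r) - ent_cos (Suc n) (k * of_real r)) * cnj (Jg k n r))) / (k\<^sup>2 - (cnj k)\<^sup>2))" for r
  have cf: "continuous_on A (f \<nu>)" for \<nu> A
    unfolding f_def[abs_def] divide_inverse by (intro continuous_intros continuous_on_ent continuous_on_J)
  have cP: "continuous_on A P" for A
    unfolding P_def[abs_def] divide_inverse by (intro continuous_intros continuous_on_ent continuous_on_J)
  have f: "f \<nu> r = Yg k \<nu> r * cnj (Jg k \<nu> r) * of_real (r ^ (2 * \<nu> + 2))" if "r > 0" for \<nu> r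
  proof -
    have "Yg k \<nu> r * cnj (Jg k \<nu> r) * of_real (r ^ (2 * \<nu> + 2)) =
        (of_real (r ^ (2 * \<nu> + 1)) * Yg k \<nu> r) * cnj (Jg k \<nu> r) * of_real r"
      by simp
    then show ?thesis
      unfolding Y_eq_ent_cos(1)[OF k(1) that] f_def by simp
  qed
  have PY: "P r = \<kappa> * lommel_Y k l n r" if "r > 0" for r
  proof -
    have "lommel_Y k l n r = (c * ((of_real (r ^ (2 * n + 1)) * Yg k n r) * cnj (Ja k n r))
       - c' * ((of_real (r ^ (2 * n + 1)) * Ya k n r) * cnj (Jg k n r))) / (k\<^sup>2 - (cnj k)\<^sup>2)"
      unfolding lommel_def c_def c'_def by (simp only: right_diff_distrib mult_ac)
    moreover have "(c * (- (T / m) * A) - c' * (- (U / m) * B)) / d = - (1 / m) * (c * (T * A) - c' * (U * B)) / d"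
      for T U A B d m :: complex
      by (simp add: divide_inverse algebra_simps)
    ultimately show ?thesis
      unfolding Y_eq_ent_cos[OF k(1) that] P_def by (simp only:)
  qed
  have b: "(LINT r:{0..R}|lborel. sph_y \<nu> (k * of_real r) * cnj (sph_j \<nu> (k * of_real r)) * of_real (r\<^sup>2)) = (LINT r:{0..R}|lborel. f \<nu> r)" for \<nu>
  proof (rule set_integral_pos_cong)
    fix r :: real assume r: "0 < r" "r \<le> R"
    show "sph_y \<nu> (k * of_real r) * cnj (sph_j \<nu> (k * of_real r)) * of_real (r\<^sup>2) = f \<nu> r"
      unfolding sph_eq_radial[OF k(1) r(1)] f[OF r(1)] by (simp add: power_add mult_2 power2_eq_square)
  qed
  have "I_yjs k R n l = (LINT r:{0..R}|lborel. l_extend (\<lambda>\<nu>. f \<nu> r) n l)"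
    unfolding I_yjs_def b by (rule l_extend_integral[symmetric]) (rule cf)
  also have "\<dots> = P R - P 0"
  proof (rule set_integral_FTC_interior)
    fix r assume r: "0 < r" "r < R"
    have "((\<lambda>r. \<kappa> * lommel_Y k l n r) has_vector_derivative \<kappa> * density_Y k l n r) (at r)"
      by (intro has_vector_derivative_mult_right lommel_has_derivative Y_system J_cnj_system k r)
    moreover have "\<kappa> * density_Y k l n r = l_extend (\<lambda>\<nu>. f \<nu> r) n l"
      unfolding \<kappa>_def mode_density_extend(2)[OF k(1) r(1) n l] l_extend_def by (simp only: f[OF r(1)])
    ultimately have "((\<lambda>r. \<kappa> * lommel_Y k l n r) has_vector_derivative l_extend (\<lambda>\<nu>. f \<nu> r) n l) (at r)"
      by simp
    then show "(P has_vector_derivative l_extend (\<lambda>\<nu>. f \<nu> r) n l) (at r)"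
      by (rule has_vector_derivative_transform_within_open[of _ _ _ "{0<..}"]) (use r PY in auto)
  qed (use R in \<open>auto intro!: continuous_l_extend cf cP\<close>)
  also have "P R = \<kappa> * lommel_Y k l n R" by (rule PY[OF R])
  \<comment> \<open>At 0 the conjugate of \<open>Ja\<close> is (n + 1) times that of
    \<open>Jg\<close>. The recursion of \<open>ent_cos\<close> gives the factor 2n + 1 at 0, so the
    companion of Ya contributes n + 1 - (2n + 1) = - n. Hence the weights n + 1 and n.\<close>
  also have "P 0 = - (\<kappa> * (cnj k ^ n / k ^ (n + 1)) * (c * of_nat (n + 1) + c' * of_nat n) / (of_nat (2 * n + 1) * (k\<^sup>2 - (cnj k)\<^sup>2)))"
  proof -
    define T S where "T = ent_cos n 0" and "S = cnj (ent_sin n 0)"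
    have J0: "cnj (Ja k n 0) = cnj k ^ n * (of_nat (n + 1) * S)" "cnj (Jg k n 0) = cnj k ^ n * S"
      by (simp_all add: Ja_def Jg_def rad_a_def rad_g_def S_def del: ent_sin.simps)
    have "P 0 = - (\<kappa> * (cnj k ^ n / k ^ (n + 1)) * ((T * S) * (c * of_nat (n + 1) + c' * of_nat n)) / (k\<^sup>2 - (cnj k)\<^sup>2))"
      unfolding P_def J0 by (simp add: T_def[symmetric] algebra_simps diff_divide_distrib add_divide_distrib)
    also have "T * S = 1 / of_nat (2 * n + 1)"
      unfolding T_def S_def by (rule ent_cos_cnj_ent_sin_0)
    finally show ?thesis by (simp add: mult_ac)
  qed
  finally show ?thesis by (simp add: \<kappa>_def c_def c'_def)
qed

text \<open>The subtraction of \<open>E_coeff\<close> in F removes exactly the contribution of the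
  origin to \<open>I_yjs\<close>, so F involves the primitives at the outer radius only.\<close>

lemma F_coeff_lommel:
  assumes k: "Re k > 0" "Im k > 0" and n: "n \<ge> 1" and l: "l \<in> {1, 2}" and R: "R > 0"
  shows "F_coeff k0 k R n l = k * (kap l k * kap l (cnj k)) *
    ((1 + scat k0 k R n l) * lommel_J k l n R + \<i> * lommel_Y k l n R)"
proof -
  define \<Delta> where "\<Delta> = complex_of_real (4 * Re k * Im k)"
  have \<Delta>: "\<Delta> \<noteq> 0" using k by (simp add: \<Delta>_def)
  have sq: "k\<^sup>2 - (cnj k)\<^sup>2 = \<i> * \<Delta>" by (simp only: square_diff_cnj \<Delta>_def)
  have k0: "k \<noteq> 0" "cnj k \<noteq> 0" using k by auto
  have kk: "k\<^sup>2 \<noteq> (cnj k)\<^sup>2" using sq \<Delta> by auto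
  define N where "N = complex_of_nat n"
  have N1: "2 * N + 1 \<noteq> 0"
  proof -
    have "complex_of_nat (2 * n + 1) \<noteq> 0" unfolding of_nat_eq_0_iff by simp
    then show ?thesis by (simp add: N_def add.commute)
  qed
  define \<kappa> where "\<kappa> = kap l k * kap l (cnj k)"
  define X where "X = (if l = 1 then 1 else k\<^sup>2) * of_nat (n + 1) + (if l = 1 then 1 else (cnj k)\<^sup>2) * of_nat n"
  \<comment> \<open>For \<open>l = 1\<close> the weights add up to 2n + 1, which cancels. For
    \<open>l = 2\<close> the squares k^2 and conj(k)^2, divided by k conj(k), shift the exponent n
    to n - 1 and n + 1, the two neighbours in \<open>l_extend\<close>.\<close>
  have E: "E_coeff k n l = \<kappa> * (cnj k ^ n / k ^ n) * X / of_nat (2 * n + 1)"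
  proof (cases "l = 1")
    case True
    have "X = of_nat (2 * n + 1)" using True by (simp add: X_def)
    moreover have "of_nat (2 * n + 1) \<noteq> (0 :: complex)" unfolding of_nat_eq_0_iff by simp
    ultimately show ?thesis
      using True by (simp add: E_coeff_def l_extend_def \<kappa>_def kap_def power_int_minus divide_inverse mult.commute)
  next
    case False
    have kn: "k ^ n = k * k ^ (n - 1)" "cnj k ^ n = cnj k * cnj k ^ (n - 1)"
      using n by (cases n; simp)+
    have p: "k powi (- int m) = 1 / k ^ m" for m
      by (simp add: power_int_minus divide_inverse)
    have "E_coeff k n l = (N + 1) / (2 * N + 1) * (1 / k ^ (n - 1) * cnj k ^ (n - 1)) + N / (2 * N + 1) * (1 / k ^ (n + 1) * cnj k ^ (n + 1))"
      using False unfolding E_coeff_def l_extend_def p N_def by (simp only: if_False)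
    also have "\<dots> = 1 / (k * cnj k) * (cnj k ^ n / k ^ n) * (k\<^sup>2 * (N + 1) + (cnj k)\<^sup>2 * N) / (2 * N + 1)"
    proof -
      have "(N + 1) / M * (1 / a * b) + N / M * (1 / (k * a * k) * (cnj k * b * cnj k))
          = 1 / (k * cnj k) * (cnj k * b / (k * a)) * (k\<^sup>2 * (N + 1) + (cnj k)\<^sup>2 * N) / M"
        if "M \<noteq> 0" "a \<noteq> 0" for M a b
        using k0 that by (simp add: field_simps power2_eq_square)
      from this[OF N1, of "k ^ (n - 1)" "cnj k ^ (n - 1)"] show ?thesis
        unfolding power_add power_one_right kn using k0 by simp
    qed
    finally show ?thesis
      using False by (simp add: \<kappa>_def kap_def X_def N_def add.commute)
  qed
  have "D_coeff k0 k R n l = k * ((1 + scat k0 k R n l) * (\<kappa> * lommel_J k l n R)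
      + \<i> * (\<kappa> * lommel_Y k l n R + \<kappa> * (cnj k ^ n / k ^ (n + 1)) * X / (of_nat (2 * n + 1) * (\<i> * \<Delta>))))"
    unfolding D_coeff_def I_jjs_lommel[OF k0(1) kk n l less_imp_le[OF R]] I_yjs_lommel[OF k0(1) kk n l R]
      sq \<kappa>_def[symmetric] X_def[symmetric] ..
  moreover have "k * (\<i> * (\<kappa> * (cnj k ^ n / k ^ (n + 1)) * X / (of_nat (2 * n + 1) * (\<i> * \<Delta>)))) = E_coeff k n l / \<Delta>"
    unfolding E using k0 by (simp add: divide_inverse mult_ac)
  ultimately show ?thesis
    unfolding F_coeff_def \<Delta>_def[symmetric] \<kappa>_def[symmetric] by (simp only: distrib_left) (simp add: mult_ac)
qed

text \<open>Needed because the source is divided by its norm. A vanishing integral would make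
  \<open>Jg\<close> vanish on (0, R), then \<open>Ja\<close> by the first equation of the system,
  against the Wronskian 1/k.\<close>

lemma I_jjs_pos:
  assumes k: "k \<noteq> 0" and n: "n \<ge> 1" and l: "l \<in> {1, 2}" and R: "R > 0"
  shows "I_jjs k R n l > 0"
proof -
  have pos: "(LINT r:{0..R}|lborel. (cmod (sph_j n (k * of_real r)))\<^sup>2 * r\<^sup>2) > 0" for n
  proof -
    define f where "f r = (cmod (Jg k n r))\<^sup>2 * r ^ (2 * n + 2)" for r
    have cf: "continuous_on {0..R} f"
      unfolding f_def[abs_def] by (intro continuous_intros continuous_on_J)
    have "(LINT r:{0..R}|lborel. (cmod (sph_j n (k * of_real r)))\<^sup>2 * r\<^sup>2) = (LINT r:{0..R}|lborel. f r)"
    proof (rule set_integral_pos_cong)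
      fix r :: real assume r: "0 < r" "r \<le> R"
      show "(cmod (sph_j n (k * of_real r)))\<^sup>2 * r\<^sup>2 = f r"
        unfolding sph_eq_radial[OF k r(1)] f_def
        using r by (simp add: norm_mult norm_power power_mult_distrib power_add mult_2 power2_eq_square)
    qed
    also have "\<dots> = integral {0..R} f"
      by (rule set_borel_integral_eq_integral(2)) (rule borel_integrable_atLeastAtMost'[OF cf])
    also have "\<dots> > 0"
    proof -
      have nn: "integral {0..R} f \<ge> 0"
        by (rule integral_nonneg[OF integrable_continuous_real[OF cf]]) (simp add: f_def)
      moreover have "integral {0..R} f \<noteq> 0"
      proof
        assume "integral {0..R} f = 0"
        then have "(f has_integral 0) (cbox 0 R)"
          using integrable_integral[OF integrable_continuous_real[OF cf]] by simp
        then have z: "f r = 0" if "0 \<le> r" "r \<le> R" for r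
          using has_integral_0_cbox_imp_0[of 0 R f r] cf that R by (auto simp: f_def)
        have g0: "Jg k n r = 0" if "0 < r" "r < R" for r
          using z[of r] that by (simp add: f_def)
        define r where "r = R / 2"
        have r: "0 < r" "r < R" using R by (auto simp: r_def)
        have "((\<lambda>r. 0) has_vector_derivative (Ja k n r - of_nat (n + 1) * Jg k n r) / of_real r) (at r)"
          by (rule has_vector_derivative_transform_within_open[OF radial_systemD(1)[OF J_system[OF k] r(1)], of "{0<..<R}"])
            (use r g0 in auto)
        then have "(Ja k n r - of_nat (n + 1) * Jg k n r) / of_real r = 0"
          using vector_derivative_unique_at has_vector_derivative_const by blast
        then have "Ja k n r = 0" using r g0[OF r] by simp
        then show False
          using radial_wronskian[OF k r(1), of n] g0[OF r] k by simp
      qed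
      ultimately show ?thesis by simp
    qed
    finally show ?thesis .
  qed
  show ?thesis
    unfolding I_jjs_def l_extend_def
    using pos[of n] pos[of "n - 1"] pos[of "n + 1"] n
    by (auto intro!: add_pos_pos mult_pos_pos divide_pos_pos)
qed

section \<open>The field of a single mode\<close>

lemma dyad_mult: "dyad a b *v v = cdot v b *s a"
  by (simp add: dyad_def matrix_vector_mult_def cdot_def vec_eq_iff sum_distrib_left mult_ac)

lemma sum_matrix_vector: "finite I \<Longrightarrow> (\<Sum>i\<in>I. A i) *v v = (\<Sum>i\<in>I. A i *v (v :: complex^3))" for A :: "'i \<Rightarrow> complex^3^3"
  by (induction rule: finite_induct) (simp_all add: matrix_vector_mult_add_rdistrib)

lemma bounded_linear_smult_vec: "bounded_linear (\<lambda>c. c *s (v :: complex^3))"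
proof (rule bounded_linear_intro[where K = "norm v"])
  show "norm (c *s v) \<le> norm c * norm v" for c
  proof -
    have "norm (c *s v) = norm c * norm v"
      unfolding norm_vec_def L2_set_def vector_smult_component norm_mult power_mult_distrib sum_distrib_left[symmetric]
      by (simp add: real_sqrt_mult)
    then show ?thesis by simp
  qed
qed (simp_all add: vec_eq_iff algebra_simps)

lemma scaleR_smult: "a *\<^sub>R (v :: complex^3) = of_real a *s v"
  by (simp add: vec_eq_iff scaleR_conv_of_real[symmetric])

lemma vfield_cong:
  assumes "g (norm x) = g' (norm x)" "a (norm x) = a' (norm x)"
  shows "vfield l n p g a x = vfield l n p g' a' x"
  using assms by (simp add: vfield_def)

lemma vfield_smult: "c *s vfield l n p g a x = vfield l n p (\<lambda>r. c * g r) (\<lambda>r. c * a r) x"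
  by (simp add: vfield_def vec_eq_iff algebra_simps add_divide_distrib diff_divide_distrib)

lemma vfield_add: "vfield l n p g a x + vfield l n p g' a' x = vfield l n p (\<lambda>r. g r + g' r) (\<lambda>r. a r + a' r) x"
  by (simp add: vfield_def vec_eq_iff algebra_simps add_divide_distrib diff_divide_distrib)

lemma mode_density_commute: "mode_density l n g a g' a' r = mode_density l n g' a' g a r"
  by (simp add: mode_density_def mult_ac)

lemma kap_cnj: "kap l (cnj k) = cnj (kap l k)"
  by (simp add: kap_def)

text \<open>With \<open>a\<close> set to 0 the field for \<open>l = 2\<close> reduces to n (n + 1) g
  p x / r^2, the radial part; for \<open>l = 1\<close> the field is orthogonal to x.\<close>

lemma radial_projection_vfield:
  assumes p: "harm_poly n p" and x: "x \<noteq> 0" and l: "l \<in> {1, 2}"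
  shows "dyad (cvec (sgn x)) (cvec (sgn x)) *v vfield l n p g a x =
    (if l = 1 then 0 else vfield 2 n p g (\<lambda>_. 0) x)"
proof -
  define r where "r = complex_of_real (norm x)"
  have r: "r \<noteq> 0" using x by (simp add: r_def)
  have s: "complex_of_real (sgn x $ i) = of_real (x $ i) / r" for i
    by (simp add: sgn_div_norm r_def divide_inverse mult.commute)
  have rr: "of_real (x $ 1) * of_real (x $ 1) + of_real (x $ 2) * of_real (x $ 2) + of_real (x $ 3) * of_real (x $ 3) = r * r"
    using norm_sq_sum_3[of x] by (simp add: r_def power2_eq_square)
  have eu: "of_real (x $ 1) * partial 1 p x + of_real (x $ 2) * partial 2 p x + of_real (x $ 3) * partial 3 p x = of_nat n * p x"
    by (rule sum_3_euler[OF p])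
  have c: "cdot v (cvec (sgn x)) = (v $ 1 * of_real (x $ 1) + v $ 2 * of_real (x $ 2) + v $ 3 * of_real (x $ 3)) / r" for v
    by (simp add: cdot_def sum_3 cvec_def s add_divide_distrib) (simp add: r_def)
  show ?thesis
  proof (cases "l = 1")
    case True
    have "cdot (vfield l n p g a x) (cvec (sgn x)) = 0"
      unfolding c by (simp add: True vfield_def cross_field_def algebra_simps)
    then show ?thesis using True by (simp add: dyad_mult)
  next
    case False
    define B where "B = of_nat n / of_real ((norm x)\<^sup>2) * (a (norm x) - of_nat (n + 1) * g (norm x)) * p x"
    have ident: "(A * p1 - B * x1) * x1 + (A * p2 - B * x2) * x2 + (A * p3 - B * x3) * x3
      = A * (x1 * p1 + x2 * p2 + x3 * p3) - B * (x1 * x1 + x2 * x2 + x3 * x3)" for A p1 p2 p3 x1 x2 x3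
      by (simp add: algebra_simps)
    have "cdot (vfield l n p g a x) (cvec (sgn x)) = (a (norm x) * (of_nat n * p x) - B * (r * r)) / r"
      unfolding c vfield_def if_not_P[OF False] vec_lambda_beta B_def[symmetric] ident eu rr ..
    also have "B * (r * r) = of_nat n * (a (norm x) - of_nat (n + 1) * g (norm x)) * p x"
      using r by (simp add: B_def r_def power2_eq_square)
    finally have "cdot (vfield l n p g a x) (cvec (sgn x)) = of_nat n * of_nat (n + 1) * g (norm x) * p x / r"
      by (simp add: algebra_simps)
    then show ?thesis
      using False r by (simp add: dyad_mult vec_eq_iff vfield_def cvec_def s) (simp add: r_def power2_eq_square)
  qed
qed

text \<open>\<open>P\<close> fixes the harmonic polynomials that extend the given spherical
  harmonics, whose definition supplies them only existentially. Orthonormality is restated for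
  \<open>P\<close>, so that all later arguments work with polynomials.\<close>

locale lossy_ball =
  fixes k :: complex and R k0 :: real and Y P :: "nat \<Rightarrow> int \<Rightarrow> real^3 \<Rightarrow> complex"
  assumes re_k: "Re k > 0" and im_k: "Im k > 0" and R: "R > 0"
    and P: "\<And>n m. m \<in> {- int n..int n} \<Longrightarrow> harm_poly n (P n m)"
    and YP: "\<And>n m x. m \<in> {- int n..int n} \<Longrightarrow> norm x = 1 \<Longrightarrow> Y n m x = P n m x"
    and orth: "\<And>n n' m m'. m \<in> {- int n..int n} \<Longrightarrow> m' \<in> {- int n'..int n'} \<Longrightarrow>
      sphere_integral (\<lambda>x. P n m x * cnj (P n' m' x)) = (if n = n' \<and> m = m' then 1 else 0)"
begin

lemma k: "k \<noteq> 0" "cnj k \<noteq> 0"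
  using re_k by auto

definition \<Delta> :: complex where "\<Delta> = of_real (4 * Re k * Im k)"

lemma \<Delta>: "\<Delta> \<noteq> 0" "k\<^sup>2 - (cnj k)\<^sup>2 = \<i> * \<Delta>" "k\<^sup>2 \<noteq> (cnj k)\<^sup>2"
proof -
  show 1: "\<Delta> \<noteq> 0" using re_k im_k by (simp add: \<Delta>_def)
  show 2: "k\<^sup>2 - (cnj k)\<^sup>2 = \<i> * \<Delta>" by (simp only: square_diff_cnj \<Delta>_def)
  show "k\<^sup>2 \<noteq> (cnj k)\<^sup>2" using 1 2 by auto
qed

lemma waves:
  assumes m: "m \<in> {- int n..int n}" and l: "l \<in> {1, 2}" and x: "x \<noteq> 0"
  shows "V_wave Y n m l k x = kap l k *s vfield l n (P n m) (Jg k n) (Ja k n) x"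
    and "U_wave Y n m l k x = kap l k *s vfield l n (P n m) (\<lambda>r. Jg k n r + \<i> * Yg k n r) (\<lambda>r. Ja k n r + \<i> * Ya k n r) x"
    and "V_star Y n m l k x = kap l (cnj k) *s vfield l n (P n m) (cJg k n) (cJa k n) x"
    and "U_star Y n m l k x = kap l (cnj k) *s vfield l n (P n m) (\<lambda>r. cnj (Jg k n r + \<i> * Yg k n r)) (\<lambda>r. cnj (Ja k n r + \<i> * Ya k n r)) x"
proof -
  have h: "radial_system n (\<lambda>r. Jg k n r + \<i> * Yg k n r) (\<lambda>r. Ja k n r + \<i> * Ya k n r) (\<lambda>r. k\<^sup>2 * Jg k n r + \<i> * (k\<^sup>2 * Yg k n r))"
    using radial_system_linear[OF J_system[OF k(1)] Y_system[OF k(1)], of n 1 \<i>] by simp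
  have W: "wave \<kappa> f (Y n m) l x = kap l \<kappa> *s vfield l n (P n m) g a x"
    if "radial_system n g a h" "\<And>r. r > 0 \<Longrightarrow> f r = of_real (r ^ n) * g r" for \<kappa> f g a h
    unfolding kap_def by (rule wave_eq_vfield[OF P[OF m] YP[OF m] that x l])
  show "V_wave Y n m l k x = kap l k *s vfield l n (P n m) (Jg k n) (Ja k n) x"
    unfolding V_wave_def by (rule W[OF J_system[OF k(1)] sph_eq_radial(1)[OF k(1)]])
  show "U_wave Y n m l k x = kap l k *s vfield l n (P n m) (\<lambda>r. Jg k n r + \<i> * Yg k n r) (\<lambda>r. Ja k n r + \<i> * Ya k n r) x"
    unfolding U_wave_def by (rule W[OF h sph_eq_radial(3)[OF k(1)]])
  show "V_star Y n m l k x = kap l (cnj k) *s vfield l n (P n m) (cJg k n) (cJa k n) x"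
    unfolding V_star_def by (rule W[OF J_cnj_system[OF k(1)]]) (simp add: sph_eq_radial(1)[OF k(1)])
  show "U_star Y n m l k x = kap l (cnj k) *s vfield l n (P n m) (\<lambda>r. cnj (Jg k n r + \<i> * Yg k n r)) (\<lambda>r. cnj (Ja k n r + \<i> * Ya k n r)) x"
    unfolding U_star_def by (rule W[OF radial_system_cnj[OF h]]) (simp add: sph_eq_radial(3)[OF k(1)])
qed

text \<open>The factor n (n + 1) will cancel 1 / (n (n + 1)) in the Green function.\<close>

definition pairing :: "nat \<Rightarrow> nat \<Rightarrow> complex" where
  "pairing l n = of_nat (n * (n + 1)) * (kap l k * kap l (cnj k))"

text \<open>\<open>W\<close> is one of the conjugate waves on the right of the dyads; conjugating it
  in \<open>cdot\<close> brings back \<open>g\<close> and \<open>a\<close>. The freedom in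
  \<open>A\<close> covers both regions of the Green function: the inner one contains the sphere
  through the field point, the outer one does not.\<close>

lemma pairing_integral:
  assumes m: "m \<in> {- int n..int n}" "m' \<in> {- int n'..int n'}" and n: "n \<ge> 1" "n' \<ge> 1"
    and l: "l \<in> {1, 2}" "l' \<in> {1, 2}"
    and A: "A \<in> sets borel" "{u<..<v} \<subseteq> A" "A \<subseteq> {u..v}" "0 \<le> u"
    and c: "continuous_on {u..v} g" "continuous_on {u..v} a"
    and W: "\<And>x. x \<noteq> 0 \<Longrightarrow> W x = kap l' (cnj k) *s vfield l' n' (P n' m') (\<lambda>r. cnj (g r)) (\<lambda>r. cnj (a r)) x"
  shows "has_bochner_integral lborel (\<lambda>x. indicator A (norm x) *\<^sub>R cdot (V_star Y n m l k x) (W x))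
    (if l = l' \<and> n = n' \<and> m = m' then pairing l n *
       (LINT r:{u..v}|lborel. mode_density l n g a (cJg k n) (cJa k n) r) else 0)"
proof -
  define J where "J = (if n = n' \<and> m = m' then 1 else (0 :: complex))"
  have J: "sphere_integral (\<lambda>x. P n m x * cnj (P n' m' x)) = J" "n = n' \<or> J = 0"
    by (auto simp: J_def orth[OF m])
  have cc: "continuous_on {u..v} (\<lambda>r. cnj (g r))" "continuous_on {u..v} (\<lambda>r. cnj (a r))"
    "continuous_on {u..v} (cJg k n)" "continuous_on {u..v} (cJa k n)"
    by (intro continuous_intros c continuous_on_J)+
  have "has_bochner_integral lborel
     (\<lambda>x. (kap l (cnj k) * kap l' k) * (indicator A (norm x) *\<^sub>R
        cdot (vfield l n (P n m) (cJg k n) (cJa k n) x)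
             (vfield l' n' (P n' m') (\<lambda>r. cnj (g r)) (\<lambda>r. cnj (a r)) x)))
     ((kap l (cnj k) * kap l' k) * (if l = l' then of_nat (n * (n + 1)) * J *
        (LINT r:A|lborel. mode_density l n (cJg k n) (cJa k n) (\<lambda>r. cnj (cnj (g r))) (\<lambda>r. cnj (cnj (a r))) r) else 0))"
    by (intro has_bochner_integral_mult_right)
      (rule vfield_integral[OF P[OF m(1)] P[OF m(2)] n J A(1,3,4) cc(3,4,1,2) l])
  moreover have "(kap l (cnj k) * kap l' k) * (if l = l' then of_nat (n * (n + 1)) * J *
        (LINT r:A|lborel. mode_density l n (cJg k n) (cJa k n) (\<lambda>r. cnj (cnj (g r))) (\<lambda>r. cnj (cnj (a r))) r) else 0)
     = (if l = l' \<and> n = n' \<and> m = m' then pairing l n *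
       (LINT r:{u..v}|lborel. mode_density l n g a (cJg k n) (cJa k n) r) else 0)"
    unfolding complex_cnj_cnj set_integral_interval[OF A(2,3)] mode_density_commute[of l n "\<lambda>r. cnj (Jg k n r)"]
    by (simp add: J_def pairing_def)
  ultimately have I: "has_bochner_integral lborel
     (\<lambda>x. (kap l (cnj k) * kap l' k) * (indicator A (norm x) *\<^sub>R
        cdot (vfield l n (P n m) (cJg k n) (cJa k n) x)
             (vfield l' n' (P n' m') (\<lambda>r. cnj (g r)) (\<lambda>r. cnj (a r)) x)))
     (if l = l' \<and> n = n' \<and> m = m' then pairing l n *
       (LINT r:{u..v}|lborel. mode_density l n g a (cJg k n) (cJa k n) r) else 0)"
    by (simp only:)
  show ?thesis
    by (rule has_bochner_integral_except_0[OF I])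
      (simp add: waves(3)[OF m(1) l(1)] W cdot_smult kap_cnj scaleR_conv_of_real mult_ac)
qed

text \<open>Integral over the shell between \<open>u\<close> and \<open>v\<close> of the density of
  the Hankel wave against the conjugate regular wave, by linearity of the primitives.\<close>

definition U_radial :: "nat \<Rightarrow> nat \<Rightarrow> real \<Rightarrow> real \<Rightarrow> complex" where
  "U_radial l n u v = (lommel_J k l n v - lommel_J k l n u) + \<i> * (lommel_Y k l n v - lommel_Y k l n u)"

lemma pairing_V_star:
  assumes m: "m \<in> {- int n..int n}" "m' \<in> {- int n'..int n'}" and n: "n \<ge> 1" "n' \<ge> 1"
    and l: "l \<in> {1, 2}" "l' \<in> {1, 2}"
    and A: "A \<in> sets borel" "{u<..<v} \<subseteq> A" "A \<subseteq> {u..v}" "0 \<le> u" "u \<le> v"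
  shows "has_bochner_integral lborel (\<lambda>x. indicator A (norm x) *\<^sub>R cdot (V_star Y n m l k x) (V_star Y n' m' l' k x))
    (if l = l' \<and> n = n' \<and> m = m' then pairing l n * (lommel_J k l n v - lommel_J k l n u) else 0)"
proof -
  have "has_bochner_integral lborel (\<lambda>x. indicator A (norm x) *\<^sub>R cdot (V_star Y n m l k x) (V_star Y n' m' l' k x))
    (if l = l' \<and> n = n' \<and> m = m' then pairing l n *
       (LINT r:{u..v}|lborel. mode_density l n (Jg k n') (Ja k n') (cJg k n) (cJa k n) r) else 0)"
    by (rule pairing_integral[OF m n l A(1-4)]) (intro continuous_on_J, intro continuous_on_J, rule waves(3)[OF m(2) l(2)])
  then show ?thesis
    using integral_density_J[OF k(1) \<Delta>(3) A(4,5), of l n] by (auto split: if_splits cong: if_cong)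
qed

lemma pairing_U_star:
  assumes m: "m \<in> {- int n..int n}" "m' \<in> {- int n'..int n'}" and n: "n \<ge> 1" "n' \<ge> 1"
    and l: "l \<in> {1, 2}" "l' \<in> {1, 2}"
    and A: "A \<in> sets borel" "{u<..<v} \<subseteq> A" "A \<subseteq> {u..v}" "0 < u" "u \<le> v"
  shows "has_bochner_integral lborel (\<lambda>x. indicator A (norm x) *\<^sub>R cdot (V_star Y n m l k x) (U_star Y n' m' l' k x))
    (if l = l' \<and> n = n' \<and> m = m' then pairing l n * U_radial l n u v else 0)"
proof -
  have u: "0 \<le> u" using A by simp
  have I: "has_bochner_integral lborel (\<lambda>x. indicator A (norm x) *\<^sub>R cdot (V_star Y n m l k x) (U_star Y n' m' l' k x))
    (if l = l' \<and> n = n' \<and> m = m' then pairing l n *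
       (LINT r:{u..v}|lborel. mode_density l n (\<lambda>r. Jg k n' r + \<i> * Yg k n' r) (\<lambda>r. Ja k n' r + \<i> * Ya k n' r)
          (cJg k n) (cJa k n) r) else 0)"
    by (rule pairing_integral[OF m n l A(1-3) u])
      (intro continuous_intros continuous_on_J continuous_on_Y k A, intro continuous_intros continuous_on_J continuous_on_Y k A,
        rule waves(4)[OF m(2) l(2)])
  have "mode_density l n (\<lambda>r. Jg k n r + \<i> * Yg k n r) (\<lambda>r. Ja k n r + \<i> * Ya k n r) (cJg k n) (cJa k n) r
     = density_J k l n r + \<i> * density_Y k l n r" for r
    by (simp add: mode_density_def algebra_simps)
  moreover have "(LINT r:{u..v}|lborel. density_J k l n r + \<i> * density_Y k l n r) = U_radial l n u v"
  proof -
    have i: "set_integrable lborel {u..v} (density_J k l n)" "set_integrable lborel {u..v} (\<lambda>r. \<i> * density_Y k l n r)"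
      by (intro borel_integrable_atLeastAtMost' continuous_intros continuous_mode_density continuous_on_J continuous_on_Y k A)+
    show ?thesis
      unfolding set_integral_add(2)[OF i] set_integral_mult_right U_radial_def
        integral_density_J[OF k(1) \<Delta>(3) u A(5)] integral_density_Y[OF k(1) \<Delta>(3) A(4,5)] ..
  qed
  ultimately show ?thesis
    using I by (auto split: if_splits cong: if_cong)
qed

text \<open>The first summand comes from source points inside the radius of the field point, the
  other two from the shell outside it.\<close>

abbreviation green_bracket :: "nat \<Rightarrow> int \<Rightarrow> nat \<Rightarrow> real^3 \<Rightarrow> complex^3" where
  "green_bracket n m l x \<equiv>
     lommel_J k l n (norm x) *s (U_wave Y n m l k x + scat k0 k R n l *s V_wave Y n m l k x)
     + U_radial l n (norm x) R *s V_wave Y n m l k x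
     + (lommel_J k l n R - lommel_J k l n (norm x)) *s (scat k0 k R n l *s V_wave Y n m l k x)"

text \<open>The ball is cut at the radius of the field point, where \<open>g_dyadic\<close> switches
  form. That radius is positive, so the singular waves are integrated over a shell that stays away
  from the origin. Orthogonality leaves the order m of the source.\<close>

lemma green_mode_integral:
  assumes m: "m \<in> {- int n..int n}" and n: "n \<ge> 1" "n' \<ge> 1"
    and l: "l \<in> {1, 2}" "l' \<in> {1, 2}" and x: "0 < norm x" "norm x < R"
  shows "(LINT y:ball 0 R|lborel. g_dyadic Y k0 k R n' l' x y *v (c *s V_star Y n m l k y)) =
    (if l = l' \<and> n = n' then (c * pairing l n) *s
       green_bracket n m l x else 0)"
proof -
  define \<rho> where "\<rho> = norm x"
  have \<rho>: "0 < \<rho>" "\<rho> < R" using x by (simp_all add: \<rho>_def)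
  define A where "A m' = U_wave Y n' m' l' k x + scat k0 k R n' l' *s V_wave Y n' m' l' k x" for m'
  define B where "B m' = V_wave Y n' m' l' k x" for m'
  define C where "C m' = scat k0 k R n' l' *s V_wave Y n' m' l' k x" for m'
  define S where "S = V_star Y n m l k"
  define a where "a m' y = indicator {0..\<rho>} (norm y) *\<^sub>R cdot (S y) (V_star Y n' m' l' k y)" for m' y
  define b where "b m' y = indicator {\<rho><..<R} (norm y) *\<^sub>R cdot (S y) (U_star Y n' m' l' k y)" for m' y
  define d where "d m' y = indicator {\<rho><..<R} (norm y) *\<^sub>R cdot (S y) (V_star Y n' m' l' k y)" for m' y
  have int: "indicator (ball 0 R) y *\<^sub>R (g_dyadic Y k0 k R n' l' x y *v (c *s S y)) =
     (\<Sum>m'\<in>{- int n'..int n'}. (c * a m' y) *s A m' + (c * b m' y) *s B m' + (c * d m' y) *s C m')" for y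
  proof -
    have "g_dyadic Y k0 k R n' l' x y *v (c *s S y) = (\<Sum>m'\<in>{- int n'..int n'}.
       if norm y \<le> \<rho> then (c * cdot (S y) (V_star Y n' m' l' k y)) *s A m'
       else (c * cdot (S y) (U_star Y n' m' l' k y)) *s B m' + (c * cdot (S y) (V_star Y n' m' l' k y)) *s C m')"
      unfolding g_dyadic_def sum_matrix_vector[OF finite_atLeastAtMost_int] \<rho>_def[symmetric]
    proof (rule sum.cong[OF refl])
      fix m'
      have "cdot (c *s S y) w = c * cdot (S y) w" for w
        using cdot_smult[of c "S y" 1 w] by simp
      then show "(if norm y \<le> \<rho> then dyad (U_wave Y n' m' l' k x + scat k0 k R n' l' *s V_wave Y n' m' l' k x) (V_star Y n' m' l' k y)
          else dyad (V_wave Y n' m' l' k x) (U_star Y n' m' l' k y) +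
             dyad (scat k0 k R n' l' *s V_wave Y n' m' l' k x) (V_star Y n' m' l' k y)) *v (c *s S y) =
         (if norm y \<le> \<rho> then (c * cdot (S y) (V_star Y n' m' l' k y)) *s A m'
       else (c * cdot (S y) (U_star Y n' m' l' k y)) *s B m' + (c * cdot (S y) (V_star Y n' m' l' k y)) *s C m')"
        by (simp add: dyad_mult matrix_vector_mult_add_rdistrib A_def B_def C_def)
    qed
    then show ?thesis
      using \<rho> by (auto simp: indicator_def a_def b_def d_def intro!: sum.neutral sum.cong)
  qed
  define Q where "Q m' \<longleftrightarrow> l = l' \<and> n = n' \<and> m = m'" for m'
  define LA LB LC where "LA = pairing l n * lommel_J k l n \<rho>" and "LB = pairing l n * U_radial l n \<rho> R"
    and "LC = pairing l n * (lommel_J k l n R - lommel_J k l n \<rho>)"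
  have l0: "lommel_J k l n 0 = 0" by (simp add: lommel_def)
  have ha: "has_bochner_integral lborel (a m') (if Q m' then LA else 0)" if "m' \<in> {- int n'..int n'}" for m'
    using pairing_V_star[OF m that n l, of "{0..\<rho>}" 0 \<rho>] \<rho> unfolding a_def S_def Q_def LA_def l0
    by (simp add: greaterThanLessThan_subseteq_atLeastAtMost_iff cong: if_cong)
  have hb: "has_bochner_integral lborel (b m') (if Q m' then LB else 0)" if "m' \<in> {- int n'..int n'}" for m'
    using pairing_U_star[OF m that n l, of "{\<rho><..<R}" \<rho> R] \<rho> unfolding b_def S_def Q_def LB_def
    by (simp add: greaterThanLessThan_subseteq_atLeastAtMost_iff cong: if_cong)
  have hd: "has_bochner_integral lborel (d m') (if Q m' then LC else 0)" if "m' \<in> {- int n'..int n'}" for m'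
    using pairing_V_star[OF m that n l, of "{\<rho><..<R}" \<rho> R] \<rho> unfolding d_def S_def Q_def LC_def
    by (simp add: greaterThanLessThan_subseteq_atLeastAtMost_iff cong: if_cong)
  have sm: "has_bochner_integral lborel (\<lambda>y. (c * f y) *s w) ((c * v) *s w)"
    if "has_bochner_integral lborel f v" for f v and w :: "complex^3"
    by (rule has_bochner_integral_bounded_linear[OF bounded_linear_smult_vec has_bochner_integral_mult_right[OF that]])
  have "has_bochner_integral lborel
     (\<lambda>y. \<Sum>m'\<in>{- int n'..int n'}. (c * a m' y) *s A m' + (c * b m' y) *s B m' + (c * d m' y) *s C m')
     (\<Sum>m'\<in>{- int n'..int n'}. (c * (if Q m' then LA else 0)) *s A m' + (c * (if Q m' then LB else 0)) *s B m'
        + (c * (if Q m' then LC else 0)) *s C m')"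
    by (intro has_bochner_integral_sum has_bochner_integral_add sm ha hb hd)
  then have "(LINT y:ball 0 R|lborel. g_dyadic Y k0 k R n' l' x y *v (c *s S y)) =
     (\<Sum>m'\<in>{- int n'..int n'}. (c * (if Q m' then LA else 0)) *s A m' + (c * (if Q m' then LB else 0)) *s B m'
        + (c * (if Q m' then LC else 0)) *s C m')"
    unfolding set_lebesgue_integral_def int by (rule has_bochner_integral_integral_eq)
  also have "\<dots> = (\<Sum>m'\<in>{- int n'..int n'}. if m' = m then
      (if l = l' \<and> n = n' then (c * LA) *s A m + (c * LB) *s B m + (c * LC) *s C m else 0) else 0)"
    by (rule sum.cong) (auto simp: Q_def)
  also have "\<dots> = (if l = l' \<and> n = n' then (c * LA) *s A m + (c * LB) *s B m + (c * LC) *s C m else 0)"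
    using m by (auto simp: sum.delta)
  finally show ?thesis
    unfolding S_def[symmetric] \<rho>_def[symmetric] LA_def LB_def LC_def A_def B_def C_def
    by (auto simp: vec_eq_iff algebra_simps)
qed

text \<open>The series collapses to one term, at index n - 1 because the degree is
  \<open>Suc i\<close>, and there 1 / (n (n + 1)) cancels against \<open>pairing\<close>.\<close>

lemma green_apply_mode:
  assumes m: "m \<in> {- int n..int n}" and n: "n \<ge> 1" and l: "l \<in> {1, 2}" and x: "0 < norm x" "norm x < R"
  shows "green_apply Y k0 k R (\<lambda>y. c *s V_star Y n m l k y) x =
     (\<i> * k * c * (kap l k * kap l (cnj k))) *s
       green_bracket n m l x
     - (1 / k\<^sup>2) *s (dyad (cvec (sgn x)) (cvec (sgn x)) *v (c *s V_star Y n m l k x))"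
proof -
  define Z where "Z = green_bracket n m l x"
  define nn where "nn = complex_of_nat n * (of_nat n + 1)"
  have nn: "nn \<noteq> 0"
  proof -
    have "complex_of_nat (n * (n + 1)) \<noteq> 0" unfolding of_nat_eq_0_iff using n by simp
    moreover have "complex_of_nat (n * (n + 1)) = nn" by (simp add: nn_def algebra_simps)
    ultimately show ?thesis by simp
  qed
  have trm: "(let n' = Suc i in \<Sum>l'\<in>{1, 2}. (1 / (of_nat n' * (of_nat n' + 1))) *s
        (LINT y:ball 0 R|lborel. g_dyadic Y k0 k R n' l' x y *v (c *s V_star Y n m l k y)))
     = (if i = n - 1 then (c * (kap l k * kap l (cnj k))) *s Z else 0)" for i
  proof -
    have G: "(LINT y:ball 0 R|lborel. g_dyadic Y k0 k R (Suc i) l' x y *v (c *s V_star Y n m l k y)) =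
       (if l = l' \<and> n = Suc i then (c * pairing l n) *s Z else 0)" if "l' \<in> {1, 2}" for l'
      unfolding Z_def by (rule green_mode_integral[OF m n(1) _ l that x]) simp
    define w where "w = 1 / (complex_of_nat (Suc i) * (of_nat (Suc i) + 1))"
    have w: "w * (c * pairing l n) = c * (kap l k * kap l (cnj k))" if "n = Suc i"
    proof -
      have "complex_of_nat (n * (n + 1)) = nn" by (simp add: nn_def algebra_simps)
      then show ?thesis
        using nn unfolding w_def that[symmetric] nn_def[symmetric] pairing_def by simp
    qed
    have "(\<Sum>l'\<in>{1, 2}. w *s
        (LINT y:ball 0 R|lborel. g_dyadic Y k0 k R (Suc i) l' x y *v (c *s V_star Y n m l k y)))
      = (\<Sum>l'\<in>{1, 2}. if l' = l then (if n = Suc i then (c * (kap l k * kap l (cnj k))) *s Z else 0) else 0)"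
    proof (rule sum.cong[OF refl])
      fix l' :: nat assume "l' \<in> {1, 2}"
      then show "w *s (LINT y:ball 0 R|lborel. g_dyadic Y k0 k R (Suc i) l' x y *v (c *s V_star Y n m l k y)) =
        (if l' = l then (if n = Suc i then (c * (kap l k * kap l (cnj k))) *s Z else 0) else 0)"
        using w by (simp only: G) (auto simp: vector_smult_assoc)
    qed
    also have "\<dots> = (if n = Suc i then (c * (kap l k * kap l (cnj k))) *s Z else 0)"
      by (subst sum.delta) (use l in auto)
    also have "n = Suc i \<longleftrightarrow> i = n - 1"
      using n by auto
    finally show ?thesis
      by (simp only: Let_def w_def)
  qed
  have "(\<Sum>i. if i = n - 1 then (c * (kap l k * kap l (cnj k))) *s Z else 0) = (c * (kap l k * kap l (cnj k))) *s Z"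
    using sums_unique[OF sums_single[of "n - 1" "\<lambda>_. (c * (kap l k * kap l (cnj k))) *s Z"]] by simp
  then show ?thesis
    unfolding green_apply_def trm Z_def[symmetric] by (simp add: vector_smult_assoc mult_ac)
qed

end

section \<open>Closed form of the fields, their norms and the energies\<close>

context lossy_ball
begin

text \<open>Inserting the two primitives, one product cancels and the other contains the Wronskian
  as a factor. For \<open>l = 2\<close> the components g and a receive different weights, conj(k)^2
  and k^2; this is the defect of the radial component.\<close>

lemma lommel_wronskian:
  assumes r: "r > 0"
  shows "lommel_J k l n r * Yg k n r - lommel_Y k l n r * Jg k n r =
      (if l = 1 then 1 else (cnj k)\<^sup>2) * cnj (Jg k n r) / (k * (\<i> * \<Delta>))"
    and "lommel_J k l n r * Ya k n r - lommel_Y k l n r * Ja k n r =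
      (if l = 1 then 1 else k\<^sup>2) * cnj (Ja k n r) / (k * (\<i> * \<Delta>))"
proof -
  define \<alpha> \<beta> where "\<alpha> = (if l = 1 then 1 else k\<^sup>2)" and "\<beta> = (if l = 1 then 1 else (cnj k)\<^sup>2)"
  define W where "W = complex_of_real (r ^ (2 * n + 1)) * (Jg k n r * Ya k n r - Yg k n r * Ja k n r)"
  have W: "W = 1 / k" unfolding W_def by (rule radial_wronskian[OF k(1) r])
  have "lommel_J k l n r * Yg k n r - lommel_Y k l n r * Jg k n r = \<beta> * cnj (Jg k n r) * W / (\<i> * \<Delta>)"
    unfolding lommel_def \<Delta>(2) \<alpha>_def[symmetric] \<beta>_def[symmetric] W_def divide_inverse by (simp only: algebra_simps)
  then show "lommel_J k l n r * Yg k n r - lommel_Y k l n r * Jg k n r = \<beta> * cnj (Jg k n r) / (k * (\<i> * \<Delta>))"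
    by (simp add: W)
  have "lommel_J k l n r * Ya k n r - lommel_Y k l n r * Ja k n r = \<alpha> * cnj (Ja k n r) * W / (\<i> * \<Delta>)"
    unfolding lommel_def \<Delta>(2) \<alpha>_def[symmetric] \<beta>_def[symmetric] W_def divide_inverse by (simp only: algebra_simps)
  then show "lommel_J k l n r * Ya k n r - lommel_Y k l n r * Ja k n r = \<alpha> * cnj (Ja k n r) / (k * (\<i> * \<Delta>))"
    by (simp add: W)
qed

text \<open>The wave V with coefficient \<open>c1\<close> plus its conjugate wave with coefficient
  \<open>c2\<close>, written as a single \<open>vfield\<close> so that curl and norm apply to the
  sum at once.\<close>

definition mode_field :: "nat \<Rightarrow> nat \<Rightarrow> int \<Rightarrow> complex \<Rightarrow> complex \<Rightarrow> real^3 \<Rightarrow> complex^3" where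
  "mode_field l n m c1 c2 = vfield l n (P n m)
     (\<lambda>r. c1 * kap l k * Jg k n r + c2 * kap l (cnj k) * cnj (Jg k n r))
     (\<lambda>r. c1 * kap l k * Ja k n r + c2 * kap l (cnj k) * cnj (Ja k n r))"

lemma V_star_eq_mode_field:
  assumes "m \<in> {- int n..int n}" "l \<in> {1, 2}" "x \<noteq> 0"
  shows "c *s V_star Y n m l k x = mode_field l n m 0 c x"
  unfolding waves(3)[OF assms] mode_field_def vfield_smult by (rule vfield_cong) simp_all

text \<open>Both components g and a of the bracket are the same linear expression \<open>T\<close>
  in a regular and a singular function. The part multiplying the regular function alone assembles F;
  the rest is the combination evaluated by \<open>lommel_wronskian\<close>.\<close>

lemma green_apply_closed:
  assumes m: "m \<in> {- int n..int n}" and n: "n \<ge> 1" and l: "l \<in> {1, 2}" and x: "0 < norm x" "norm x < R"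
  shows "green_apply Y k0 k R (\<lambda>y. c *s V_star Y n m l k y) x =
    mode_field l n m (c * \<i> * F_coeff k0 k R n l) (c * \<i> / \<Delta>) x"
proof -
  define \<rho> where "\<rho> = norm x"
  have \<rho>: "\<rho> > 0" using x by (simp add: \<rho>_def)
  have x0: "x \<noteq> 0" using x by auto
  define \<kappa> \<kappa>' s where "\<kappa> = kap l k" and "\<kappa>' = kap l (cnj k)" and "s = scat k0 k R n l"
  define LJ LY LJR LYR where "LJ = lommel_J k l n \<rho>" and "LY = lommel_Y k l n \<rho>"
    and "LJR = lommel_J k l n R" and "LYR = lommel_Y k l n R"
  define q where "q = \<kappa> * \<kappa>'"
  define T where "T G H = \<i> * k * c * q * (LJ * (\<kappa> * (G + \<i> * H) + s * (\<kappa> * G))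
     + ((LJR - LJ) + \<i> * (LYR - LY)) * (\<kappa> * G) + (LJR - LJ) * (s * (\<kappa> * G)))" for G H
  \<comment> \<open>The primitives at the field radius cancel in the terms with \<open>s\<close> and
    in the product of \<open>LJ\<close> with \<open>G\<close>, leaving only the combination of
    \<open>LJ H\<close> and \<open>LY G\<close>. Its sign comes from \<i> squared.\<close>
  have T: "T G H = c * \<i> * (k * q * ((1 + s) * LJR + \<i> * LYR)) * \<kappa> * G - k * c * q * \<kappa> * (LJ * H - LY * G)" for G H
  proof -
    have "T G H = \<i> * k * c * q * \<kappa> * (((1 + s) * LJR + \<i> * LYR) * G + \<i> * (LJ * H - LY * G))"
      by (simp add: T_def algebra_simps)
    also have "\<dots> = c * \<i> * (k * q * ((1 + s) * LJR + \<i> * LYR)) * \<kappa> * G + (\<i> * \<i>) * (k * c * q * \<kappa> * (LJ * H - LY * G))"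
      by (simp only: distrib_left mult_ac)
    finally show ?thesis by simp
  qed
  have F: "F_coeff k0 k R n l = k * q * ((1 + s) * LJR + \<i> * LYR)"
    unfolding F_coeff_lommel[OF re_k im_k n l R] by (simp add: q_def \<kappa>_def \<kappa>'_def s_def LJR_def LYR_def)
  have TF: "T G H = (c * \<i> * F_coeff k0 k R n l) * \<kappa> * G - k * c * q * \<kappa> * (LJ * H - LY * G)" for G H
    unfolding T F ..
  note W = lommel_wronskian[OF \<rho>, of l n, folded LJ_def LY_def]
  have G: "(\<i> * k * c * (kap l k * kap l (cnj k))) *s
       green_bracket n m l x
     = vfield l n (P n m) (\<lambda>r. T (Jg k n r) (Yg k n r)) (\<lambda>r. T (Ja k n r) (Ya k n r)) x"
    unfolding waves(1,2)[OF m l x0] vfield_smult vfield_add U_radial_def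
    by (rule vfield_cong) (simp_all add: T_def q_def \<kappa>_def \<kappa>'_def s_def LJ_def LY_def LJR_def LYR_def \<rho>_def)
  have D: "dyad (cvec (sgn x)) (cvec (sgn x)) *v (c *s V_star Y n m l k x) =
      (if l = 1 then 0 else vfield 2 n (P n m) (\<lambda>r. c * (\<kappa>' * cnj (Jg k n r))) (\<lambda>r. 0) x)"
    unfolding waves(3)[OF m l x0] vfield_smult \<kappa>'_def by (rule radial_projection_vfield[OF P[OF m] x0 l])
  show ?thesis
  proof (cases "l = 1")
    case True
    have e: "- (k * c * (w / (k * (\<i> * \<Delta>)))) = c * \<i> / \<Delta> * w" for w
      using k(1) \<Delta>(1) by (simp add: field_simps)
    have TT: "T (Jg k n \<rho>) (Yg k n \<rho>) = c * \<i> * F_coeff k0 k R n l * kap l k * Jg k n \<rho> + c * \<i> / \<Delta> * kap l (cnj k) * cnj (Jg k n \<rho>)"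
      "T (Ja k n \<rho>) (Ya k n \<rho>) = c * \<i> * F_coeff k0 k R n l * kap l k * Ja k n \<rho> + c * \<i> / \<Delta> * kap l (cnj k) * cnj (Ja k n \<rho>)"
      unfolding TF W using e True by (simp_all add: q_def \<kappa>_def \<kappa>'_def kap_def)
    show ?thesis
      unfolding green_apply_mode[OF m n l x] G D mode_field_def
      using True TT by (simp del: One_nat_def) (rule vfield_cong; simp add: \<rho>_def)
  next
    case False
    then have l2: "l = 2" using l by simp
    define K where "K = cnj k"
    have Kk: "K \<noteq> 0" "k \<noteq> 0" using k by (simp_all add: K_def)
    have sq: "\<i> * \<Delta> = k * k - K * K" using \<Delta>(2) by (simp add: K_def power2_eq_square)
    have kap2: "\<kappa> = 1 / k" "\<kappa>' = 1 / K" using False by (simp_all add: \<kappa>_def \<kappa>'_def kap_def K_def)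
    have ea: "- (k * c * q * \<kappa> * (k\<^sup>2 * w / (k * (\<i> * \<Delta>)))) = c * \<i> / \<Delta> * \<kappa>' * w" for w
      unfolding q_def kap2 using Kk \<Delta>(1) by (simp add: field_simps power2_eq_square)
    \<comment> \<open>Here \<open>lommel_wronskian\<close> provides conj(k)^2 where k^2 is wanted.
      The delta part adds the missing multiple, since conj(k)^2 + \<i> \<Delta> = k^2.\<close>
    have eg: "- (k * c * q * \<kappa> * (K\<^sup>2 * w / (k * (\<i> * \<Delta>)))) - 1 / k\<^sup>2 * (c * (\<kappa>' * w)) = c * \<i> / \<Delta> * \<kappa>' * w" for w
    proof -
      have "- (k * c * q * \<kappa> * (K\<^sup>2 * w / (k * (\<i> * \<Delta>)))) - 1 / k\<^sup>2 * (c * (\<kappa>' * w)) =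
        - (c * w * (K * K + \<i> * \<Delta>) / (k * k * K * (\<i> * \<Delta>)))"
        unfolding q_def kap2 using Kk \<Delta>(1) by (simp add: field_simps power2_eq_square)
      also have "K * K + \<i> * \<Delta> = k * k" unfolding sq by simp
      also have "- (c * w * (k * k) / (k * k * K * (\<i> * \<Delta>))) = c * \<i> / \<Delta> * \<kappa>' * w"
        unfolding kap2 using Kk \<Delta>(1) by (simp add: field_simps)
      finally show ?thesis .
    qed
    have "(\<i> * k * c * (kap l k * kap l (cnj k))) *s
       green_bracket n m l x
     - (1 / k\<^sup>2) *s (dyad (cvec (sgn x)) (cvec (sgn x)) *v (c *s V_star Y n m l k x))
     = vfield l n (P n m) (\<lambda>r. T (Jg k n r) (Yg k n r)) (\<lambda>r. T (Ja k n r) (Ya k n r)) x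
       + (- (1 / k\<^sup>2)) *s vfield l n (P n m) (\<lambda>r. c * (\<kappa>' * cnj (Jg k n r))) (\<lambda>r. 0) x"
      unfolding G D using l2 by (simp add: vec_eq_iff)
    also have "\<dots> = mode_field l n m (c * \<i> * F_coeff k0 k R n l) (c * \<i> / \<Delta>) x"
      unfolding vfield_smult vfield_add mode_field_def \<kappa>_def[symmetric] \<kappa>'_def[symmetric]
    proof (rule vfield_cong)
      have add: "a - b + - d * w = a + f" if "- b - d * w = f" for a b d f w :: complex
        by (simp add: that[symmetric])
      show "T (Jg k n (norm x)) (Yg k n (norm x)) + - (1 / k\<^sup>2) * (c * (\<kappa>' * cnj (Jg k n (norm x)))) =
         c * \<i> * F_coeff k0 k R n l * \<kappa> * Jg k n (norm x) + c * \<i> / \<Delta> * \<kappa>' * cnj (Jg k n (norm x))"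
        unfolding \<rho>_def[symmetric] TF W if_not_P[OF False] K_def[symmetric] by (rule add[OF eg])
      show "T (Ja k n (norm x)) (Ya k n (norm x)) + - (1 / k\<^sup>2) * 0 =
         c * \<i> * F_coeff k0 k R n l * \<kappa> * Ja k n (norm x) + c * \<i> / \<Delta> * \<kappa>' * cnj (Ja k n (norm x))"
        unfolding \<rho>_def[symmetric] TF W if_not_P[OF False] by (rule add) (use ea[of "cnj (Ja k n \<rho>)"] in simp)
    qed
    finally show ?thesis
      unfolding green_apply_mode[OF m n l x] .
  qed
qed

text \<open>A wave and its conjugate have the same Hermitian norm, which gives \<open>I_jjs\<close>
  for both squares. In the mixed term the conjugate of the conjugate wave is the wave itself, so the
  bilinear integral \<open>I_jj\<close> appears, together with its complex conjugate.\<close>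

lemma mode_field_norm:
  assumes m: "m \<in> {- int n..int n}" and n: "n \<ge> 1" and l: "l \<in> {1, 2}"
    and A: "A \<in> sets borel" "{0<..<R} \<subseteq> A" "A \<subseteq> {0..R}"
  shows "(LINT x:{x. norm x \<in> A}|lborel. (norm (mode_field l n m c1 c2 x))\<^sup>2) =
    real (n * (n + 1)) * (((cmod c1)\<^sup>2 + (cmod c2)\<^sup>2) * I_jjs k R n l + 2 * Re (c1 * cnj c2 * I_jj k R n l))"
proof -
  define \<kappa> \<kappa>' where "\<kappa> = kap l k" and "\<kappa>' = kap l (cnj k)"
  have \<kappa>: "cnj \<kappa> = \<kappa>'" "cnj \<kappa>' = \<kappa>" by (simp_all add: \<kappa>_def \<kappa>'_def kap_cnj)
  define e where "e r = c1 * \<kappa> * Jg k n r + c2 * \<kappa>' * cnj (Jg k n r)" for r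
  define ea where "ea r = c1 * \<kappa> * Ja k n r + c2 * \<kappa>' * cnj (Ja k n r)" for r
  have mf: "mode_field l n m c1 c2 = vfield l n (P n m) e ea"
    by (simp add: mode_field_def e_def[abs_def] ea_def[abs_def] \<kappa>_def \<kappa>'_def)
  have ce: "continuous_on B e" "continuous_on B ea" for B
    unfolding e_def[abs_def] ea_def[abs_def] by (intro continuous_intros continuous_on_J)+
  define M where "M = mode_density l n (Jg k n) (Ja k n) (Jg k n) (Ja k n)"
  define IJ where "IJ = (LINT r:{0..R}|lborel. density_J k l n r)"
  define IM where "IM = (LINT r:{0..R}|lborel. M r)"
  have "has_bochner_integral lborel
     (\<lambda>x. indicator A (norm x) *\<^sub>R cdot (vfield l n (P n m) e ea x) (vfield l n (P n m) e ea x))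
     (of_nat (n * (n + 1)) * (LINT r:A|lborel. mode_density l n e ea (\<lambda>r. cnj (e r)) (\<lambda>r. cnj (ea r)) r))"
    using vfield_integral[OF P[OF m] P[OF m] n n orth[OF m m] _ A(1,3) order_refl ce ce l l] by simp
  moreover have "indicator A (norm x) *\<^sub>R cdot (vfield l n (P n m) e ea x) (vfield l n (P n m) e ea x) =
      complex_of_real (indicator {x. norm x \<in> A} x *\<^sub>R (norm (mode_field l n m c1 c2 x))\<^sup>2)" for x
    by (simp add: cdot_self mf indicator_def)
  ultimately have "complex_of_real (LINT x:{x. norm x \<in> A}|lborel. (norm (mode_field l n m c1 c2 x))\<^sup>2) =
      of_nat (n * (n + 1)) * (LINT r:A|lborel. mode_density l n e ea (\<lambda>r. cnj (e r)) (\<lambda>r. cnj (ea r)) r)"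
    unfolding set_lebesgue_integral_def[of lborel "{x. norm x \<in> A}"] integral_complex_of_real[symmetric]
    by (simp only: has_bochner_integral_integral_eq)
  also have "(LINT r:A|lborel. mode_density l n e ea (\<lambda>r. cnj (e r)) (\<lambda>r. cnj (ea r)) r) =
     (LINT r:{0..R}|lborel. mode_density l n e ea (\<lambda>r. cnj (e r)) (\<lambda>r. cnj (ea r)) r)"
    by (rule set_integral_interval[OF A(2,3)])
  also have "\<dots> = (LINT r:{0..R}|lborel. ((c1 * cnj c1 + c2 * cnj c2) * (\<kappa> * \<kappa>')) * density_J k l n r
      + ((c1 * cnj c2 * (\<kappa> * \<kappa>)) * M r + cnj (c1 * cnj c2 * (\<kappa> * \<kappa>)) * cnj (M r)))"
  proof -
    have "mode_density l n e ea (\<lambda>r. cnj (e r)) (\<lambda>r. cnj (ea r)) r = ((c1 * cnj c1 + c2 * cnj c2) * (\<kappa> * \<kappa>')) * density_J k l n r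
      + ((c1 * cnj c2 * (\<kappa> * \<kappa>)) * M r + cnj (c1 * cnj c2 * (\<kappa> * \<kappa>)) * cnj (M r))" for r
      by (cases "l = 1") (simp_all add: mode_density_def M_def e_def ea_def \<kappa> algebra_simps)
    then show ?thesis by simp
  qed
  also have "\<dots> = ((c1 * cnj c1 + c2 * cnj c2) * (\<kappa> * \<kappa>')) * IJ + ((c1 * cnj c2 * (\<kappa> * \<kappa>)) * IM + cnj (c1 * cnj c2 * (\<kappa> * \<kappa>)) * cnj IM)"
  proof -
    have cM: "continuous_on {0..R} M"
      unfolding M_def by (intro continuous_mode_density continuous_on_J)
    have i: "set_integrable lborel {0..R} (\<lambda>r. a * density_J k l n r)" "set_integrable lborel {0..R} (\<lambda>r. a * M r)"
      "set_integrable lborel {0..R} (\<lambda>r. a * cnj (M r))" for a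
      by (intro borel_integrable_atLeastAtMost' continuous_intros cM continuous_mode_density continuous_on_J)+
    have "(LINT r:{0..R}|lborel. cnj (M r)) = cnj IM"
    proof -
      have "(\<lambda>r. indicat_real {0..R} r *\<^sub>R cnj (M r)) = (\<lambda>r. cnj (indicat_real {0..R} r *\<^sub>R M r))"
        by (simp add: fun_eq_iff indicator_def)
      then show ?thesis
        unfolding IM_def set_lebesgue_integral_def by (simp only: Bochner_Integration.integral_cnj)
    qed
    then show ?thesis
      unfolding set_integral_add(2)[OF i(1) set_integral_add(1)[OF i(2,3)]] set_integral_add(2)[OF i(2,3)]
        set_integral_mult_right IJ_def IM_def by simp
  qed
  also have "\<dots> = (c1 * cnj c1 + c2 * cnj c2) * of_real (I_jjs k R n l) + (c1 * cnj c2 * I_jj k R n l + cnj (c1 * cnj c2 * I_jj k R n l))"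
    unfolding I_jjs_eq[OF k(1) n l] I_jj_eq[OF k(1) n l] IJ_def IM_def M_def \<kappa>_def \<kappa>'_def
    by (simp add: mult_ac)
  also have "\<dots> = of_real (((cmod c1)\<^sup>2 + (cmod c2)\<^sup>2) * I_jjs k R n l + 2 * Re (c1 * cnj c2 * I_jj k R n l))"
    unfolding complex_add_cnj complex_norm_square[symmetric] by (simp del: of_real_power)
  finally have "complex_of_real (LINT x:{x. norm x \<in> A}|lborel. (norm (mode_field l n m c1 c2 x))\<^sup>2) =
    complex_of_real (real (n * (n + 1)) * (((cmod c1)\<^sup>2 + (cmod c2)\<^sup>2) * I_jjs k R n l + 2 * Re (c1 * cnj c2 * I_jj k R n l)))"
    by (simp only: of_real_mult of_real_of_nat_eq)
  then show ?thesis by (simp only: of_real_eq_iff)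
qed

text \<open>In the radial system h is k^2 g for the wave and conj(k)^2 g for its conjugate; with the
  normalisations 1/k and 1/conj(k) one power of each wave number is left over.\<close>

lemma curl_mode_field:
  assumes m: "m \<in> {- int n..int n}" and l: "l \<in> {1, 2}" and x: "x \<noteq> 0"
  shows "curl (mode_field l n m c1 c2) x = mode_field (3 - l) n m (c1 * k) (c2 * cnj k) x"
proof -
  define \<kappa> \<kappa>' where "\<kappa> = kap l k" and "\<kappa>' = kap l (cnj k)"
  have s: "radial_system n (\<lambda>r. c1 * \<kappa> * Jg k n r + c2 * \<kappa>' * cnj (Jg k n r)) (\<lambda>r. c1 * \<kappa> * Ja k n r + c2 * \<kappa>' * cnj (Ja k n r))
     (\<lambda>r. c1 * \<kappa> * (k\<^sup>2 * Jg k n r) + c2 * \<kappa>' * ((cnj k)\<^sup>2 * cnj (Jg k n r)))"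
    by (rule radial_system_linear[OF J_system[OF k(1)] J_cnj_system[OF k(1)]])
  show ?thesis
  proof (cases "l = 1")
    case True
    have two: "3 - l = 2" using True by simp
    have "curl (mode_field l n m c1 c2) x = vfield 2 n (P n m) (\<lambda>r. c1 * \<kappa> * Jg k n r + c2 * \<kappa>' * cnj (Jg k n r))
       (\<lambda>r. c1 * \<kappa> * Ja k n r + c2 * \<kappa>' * cnj (Ja k n r)) x"
      using curl_vfield_1[OF P[OF m] s x] unfolding mode_field_def \<kappa>_def \<kappa>'_def True .
    also have "\<dots> = mode_field (3 - l) n m (c1 * k) (c2 * cnj k) x"
      unfolding mode_field_def two
      by (rule vfield_cong) (use k True in \<open>simp_all add: \<kappa>_def \<kappa>'_def kap_def\<close>)
    finally show ?thesis .
  next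
    case False
    then have l2: "l = 2" using l by simp
    have "curl (mode_field l n m c1 c2) x = vfield 1 n (P n m) (\<lambda>r. c1 * \<kappa> * (k\<^sup>2 * Jg k n r) + c2 * \<kappa>' * ((cnj k)\<^sup>2 * cnj (Jg k n r)))
       (\<lambda>r. c1 * k * Ja k n r + c2 * cnj k * cnj (Ja k n r)) x"
      using curl_vfield_2[OF P[OF m] s x] unfolding mode_field_def \<kappa>_def \<kappa>'_def l2 .
    also have "\<dots> = mode_field (3 - l) n m (c1 * k) (c2 * cnj k) x"
    proof -
      have one: "3 - l = 1" using l2 by simp
      show ?thesis
        unfolding mode_field_def one
        by (rule vfield_cong) (use k l2 in \<open>simp_all add: \<kappa>_def \<kappa>'_def kap_def power2_eq_square\<close>)
    qed
    finally show ?thesis .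
  qed
qed

lemma mode_field_smult: "c *s mode_field l n m c1 c2 x = mode_field l n m (c * c1) (c * c2) x"
  unfolding mode_field_def vfield_smult by (rule vfield_cong) (simp_all add: algebra_simps)

lemma mode_field_energy:
  assumes m: "m \<in> {- int n..int n}" and n: "n \<ge> 1" and l: "l \<in> {1, 2}"
    and F: "\<And>x. 0 < norm x \<Longrightarrow> norm x < R \<Longrightarrow> F x = mode_field l n m (d * a) (d * b) x"
  shows "(LINT x:{x. 0 < norm x \<and> norm x < R}|lborel. (norm (F x))\<^sup>2) =
    real (n * (n + 1)) * (cmod d)\<^sup>2 * (((cmod a)\<^sup>2 + (cmod b)\<^sup>2) * I_jjs k R n l + 2 * Re (a * cnj b * I_jj k R n l))"
proof -
  have set: "{x :: real^3. 0 < norm x \<and> norm x < R} = {x. norm x \<in> {0<..<R}}" by auto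
  have "open {x :: real^3. 0 < norm x \<and> norm x < R}"
    by (intro open_Collect_conj open_Collect_less continuous_intros)
  then have "(LINT x:{x. 0 < norm x \<and> norm x < R}|lborel. (norm (F x))\<^sup>2) =
      (LINT x:{x. 0 < norm x \<and> norm x < R}|lborel. (norm (mode_field l n m (d * a) (d * b) x))\<^sup>2)"
    by (intro set_lebesgue_integral_cong) (auto simp: F)
  also have "\<dots> = real (n * (n + 1)) * (((cmod (d * a))\<^sup>2 + (cmod (d * b))\<^sup>2) * I_jjs k R n l
      + 2 * Re (d * a * cnj (d * b) * I_jj k R n l))"
    unfolding set by (rule mode_field_norm[OF m n l]) auto
  also have "d * a * cnj (d * b) * I_jj k R n l = of_real ((cmod d)\<^sup>2) * (a * cnj b * I_jj k R n l)"
    unfolding complex_norm_square by (simp add: mult_ac)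
  also have "Re (of_real ((cmod d)\<^sup>2) * (a * cnj b * I_jj k R n l)) = (cmod d)\<^sup>2 * Re (a * cnj b * I_jj k R n l)"
    by (simp only: Re_complex_of_real Im_complex_of_real times_complex.sel)
  finally show ?thesis
    by (simp add: norm_mult power_mult_distrib algebra_simps)
qed

lemma V_star_norm:
  assumes m: "m \<in> {- int n..int n}" and n: "n \<ge> 1" and l: "l \<in> {1, 2}"
  shows "(LINT y:ball 0 R|lborel. (norm (V_star Y n m l k y))\<^sup>2) = real (n * (n + 1)) * I_jjs k R n l"
proof -
  have "(LINT y:ball 0 R|lborel. (norm (V_star Y n m l k y))\<^sup>2) =
      (LINT x:{x. 0 < norm x \<and> norm x < R}|lborel. (norm (V_star Y n m l k x))\<^sup>2)"
    by (rule set_integral_discrete_difference[where X = "{0}"]) auto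
  also have "\<dots> = real (n * (n + 1)) * (cmod 1)\<^sup>2 * (((cmod 0)\<^sup>2 + (cmod 1)\<^sup>2) * I_jjs k R n l + 2 * Re (0 * cnj 1 * I_jj k R n l))"
    using V_star_eq_mode_field[OF m l, of _ 1] by (intro mode_field_energy[OF m n l]) simp
  finally show ?thesis by simp
qed

text \<open>The squared normalisation constant is 1 / (n (n + 1) \<open>I_jjs\<close>), which
  cancels the angular factor of \<open>mode_field_norm\<close>. The common factor \<i> of both
  coefficients has modulus 1.\<close>

lemma stored_energies:
  fixes \<omega> \<mu> :: real
  assumes m: "m \<in> {- int n..int n}" and n: "n \<ge> 1" and l: "l \<in> {1, 2}" and pos: "\<omega> > 0" "\<mu> > 0"
  defines "F \<equiv> F_coeff k0 k R n l"
  shows "(LINT x:{x. 0 < norm x \<and> norm x < R}|lborel. (norm (E_field Y \<omega> \<mu> k0 k R (v_star Y k R n m l) x))\<^sup>2) =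
      \<omega>\<^sup>2 * \<mu>\<^sup>2 * ((cmod F)\<^sup>2 + (1 / (4 * Re k * Im k))\<^sup>2 + Re (F * I_jj k R n l) / (2 * Re k * Im k * I_jjs k R n l))"
    and "(LINT x:{x. 0 < norm x \<and> norm x < R}|lborel. (norm (H_field Y \<omega> \<mu> k0 k R (v_star Y k R n m l) x))\<^sup>2) =
      ((cmod (k * F))\<^sup>2 + (cmod (k / of_real (4 * Re k * Im k)))\<^sup>2) * (I_jjs k R n (3 - l) / I_jjs k R n l)
        + Re (k\<^sup>2 * F * I_jj k R n (3 - l)) / (2 * Re k * Im k * I_jjs k R n l)"
proof -
  define I where "I = I_jjs k R n l"
  have I: "I > 0" unfolding I_def by (rule I_jjs_pos[OF k(1) n l R])
  define nn where "nn = real (n * (n + 1))"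
  have nn: "nn > 0" unfolding nn_def of_nat_0_less_iff using n by simp
  define c where "c = complex_of_real (inverse (sqrt (nn * I)))"
  have c: "(cmod c)\<^sup>2 = 1 / (nn * I)"
    using nn I by (simp add: c_def power_inverse divide_inverse norm_inverse del: of_real_inverse)
  have v: "v_star Y k R n m l = (\<lambda>y. c *s V_star Y n m l k y)"
    unfolding v_star_def[abs_def] V_star_norm[OF m n l] c_def nn_def I_def
    by (simp only: scaleR_smult)
  define D where "D = 4 * Re k * Im k"
  have D: "D > 0" using re_k im_k by (simp add: D_def)
  have \<Delta>D: "\<Delta> = of_real D" by (simp add: \<Delta>_def D_def)
  define w where "w = \<i> * of_real \<omega> * complex_of_real \<mu>"
  have w: "w \<noteq> 0" "(cmod w)\<^sup>2 = \<omega>\<^sup>2 * \<mu>\<^sup>2"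
    using pos by (simp_all add: w_def norm_mult power_mult_distrib)
  have E: "E_field Y \<omega> \<mu> k0 k R (v_star Y k R n m l) x = mode_field l n m (w * c * \<i> * F) (w * c * \<i> * (1 / \<Delta>)) x"
    if "0 < norm x" "norm x < R" for x
    unfolding E_field_def v green_apply_closed[OF m n l that] mode_field_smult F_def w_def by (simp add: mult_ac)
  have H: "H_field Y \<omega> \<mu> k0 k R (v_star Y k R n m l) x = mode_field (3 - l) n m (c * \<i> * (k * F)) (c * \<i> * (cnj k / \<Delta>)) x"
    if x: "0 < norm x" "norm x < R" for x
  proof -
    have "open {x :: real^3. 0 < norm x \<and> norm x < R}"
      by (intro open_Collect_conj open_Collect_less continuous_intros)
    then have "curl (E_field Y \<omega> \<mu> k0 k R (v_star Y k R n m l)) x = curl (mode_field l n m (w * c * \<i> * F) (w * c * \<i> * (1 / \<Delta>))) x"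
      by (rule curl_transform) (use x E in auto)
    also have "\<dots> = mode_field (3 - l) n m (w * c * \<i> * F * k) (w * c * \<i> * (1 / \<Delta>) * cnj k) x"
      by (rule curl_mode_field[OF m l]) (use x in auto)
    finally have "H_field Y \<omega> \<mu> k0 k R (v_star Y k R n m l) x =
        mode_field (3 - l) n m (1 / w * (w * c * \<i> * F * k)) (1 / w * (w * c * \<i> * (1 / \<Delta>) * cnj k)) x"
      unfolding H_field_def w_def[symmetric] by (simp only: mode_field_smult)
    moreover have "1 / w * (w * c * \<i> * F * k) = c * \<i> * (k * F)" "1 / w * (w * c * \<i> * (1 / \<Delta>) * cnj k) = c * \<i> * (cnj k / \<Delta>)"
      using w(1) by simp_all
    ultimately show ?thesis by (simp only:)
  qed
  have l': "3 - l \<in> {1, 2}" using l by auto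
  have "(LINT x:{x. 0 < norm x \<and> norm x < R}|lborel. (norm (E_field Y \<omega> \<mu> k0 k R (v_star Y k R n m l) x))\<^sup>2) =
    nn * (cmod (w * c * \<i>))\<^sup>2 * (((cmod F)\<^sup>2 + (cmod (1 / \<Delta>))\<^sup>2) * I + 2 * Re (F * cnj (1 / \<Delta>) * I_jj k R n l))"
    unfolding nn_def I_def by (rule mode_field_energy[OF m n l E])
  also have "F * cnj (1 / \<Delta>) * I_jj k R n l = F * I_jj k R n l / of_real D"
    by (simp add: \<Delta>D)
  also have "(cmod (w * c * \<i>))\<^sup>2 = \<omega>\<^sup>2 * \<mu>\<^sup>2 / (nn * I)"
    by (simp add: norm_mult power_mult_distrib w c)
  also have "(cmod (1 / \<Delta>))\<^sup>2 = (1 / D)\<^sup>2"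
    using D by (simp add: \<Delta>D norm_divide)
  also have "nn * (\<omega>\<^sup>2 * \<mu>\<^sup>2 / (nn * I)) * (((cmod F)\<^sup>2 + (1 / D)\<^sup>2) * I + 2 * Re (F * I_jj k R n l / of_real D)) =
     \<omega>\<^sup>2 * \<mu>\<^sup>2 * ((cmod F)\<^sup>2 + (1 / D)\<^sup>2 + Re (F * I_jj k R n l) / (D / 2 * I))"
    unfolding Re_divide_of_real using nn I D by (simp add: field_simps)
  finally show "(LINT x:{x. 0 < norm x \<and> norm x < R}|lborel. (norm (E_field Y \<omega> \<mu> k0 k R (v_star Y k R n m l) x))\<^sup>2) =
      \<omega>\<^sup>2 * \<mu>\<^sup>2 * ((cmod F)\<^sup>2 + (1 / (4 * Re k * Im k))\<^sup>2 + Re (F * I_jj k R n l) / (2 * Re k * Im k * I_jjs k R n l))"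
    by (simp add: D_def I_def)
  \<comment> \<open>The curl has moved the field to type 3 - l while the normalisation keeps l,
    whence the ratio of the two integrals. Conjugating conj(k) / \<Delta> gives k / \<Delta>, and
    with k F this produces k^2 F in the mixed term.\<close>
  have "(LINT x:{x. 0 < norm x \<and> norm x < R}|lborel. (norm (H_field Y \<omega> \<mu> k0 k R (v_star Y k R n m l) x))\<^sup>2) =
    nn * (cmod (c * \<i>))\<^sup>2 * (((cmod (k * F))\<^sup>2 + (cmod (cnj k / \<Delta>))\<^sup>2) * I_jjs k R n (3 - l)
      + 2 * Re (k * F * cnj (cnj k / \<Delta>) * I_jj k R n (3 - l)))"
    unfolding nn_def by (rule mode_field_energy[OF m n l' H])
  also have "k * F * cnj (cnj k / \<Delta>) * I_jj k R n (3 - l) = k\<^sup>2 * F * I_jj k R n (3 - l) / of_real D"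
    by (simp add: \<Delta>D power2_eq_square mult_ac)
  also have "(cmod (c * \<i>))\<^sup>2 = 1 / (nn * I)"
    by (simp add: norm_mult power_mult_distrib c)
  also have "cmod (cnj k / \<Delta>) = cmod (k / of_real D)"
    by (simp add: \<Delta>D norm_divide)
  also have "nn * (1 / (nn * I)) * (((cmod (k * F))\<^sup>2 + (cmod (k / of_real D))\<^sup>2) * I_jjs k R n (3 - l)
      + 2 * Re (k\<^sup>2 * F * I_jj k R n (3 - l) / of_real D)) =
     ((cmod (k * F))\<^sup>2 + (cmod (k / of_real D))\<^sup>2) * (I_jjs k R n (3 - l) / I)
      + Re (k\<^sup>2 * F * I_jj k R n (3 - l)) / (D / 2 * I)"
    unfolding Re_divide_of_real using nn I D by (simp add: field_simps)
  finally show "(LINT x:{x. 0 < norm x \<and> norm x < R}|lborel. (norm (H_field Y \<omega> \<mu> k0 k R (v_star Y k R n m l) x))\<^sup>2) =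
      ((cmod (k * F))\<^sup>2 + (cmod (k / of_real (4 * Re k * Im k)))\<^sup>2) * (I_jjs k R n (3 - l) / I_jjs k R n l)
        + Re (k\<^sup>2 * F * I_jj k R n (3 - l)) / (2 * Re k * Im k * I_jjs k R n l)"
    by (simp add: D_def I_def)
qed

end

section \<open>From spherical harmonics to their polynomials, and the energies\<close>

lemma harm_poly_of_spherical_harmonic:
  assumes "spherical_harmonic n S"
  shows "\<exists>p. harm_poly n p \<and> (\<forall>x. norm x = 1 \<longrightarrow> S x = p x)"
  using assms unfolding spherical_harmonic_def harm_poly_def by auto

theorem mainTheorem3:
  fixes \<omega> \<mu>0 \<epsilon>0 k0 R1 :: real and \<epsilon>1 k1 :: complex
    and Y :: "nat \<Rightarrow> int \<Rightarrow> real^3 \<Rightarrow> complex"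
    and n l :: nat and m :: int
    and E H :: "real^3 \<Rightarrow> complex^3"
    and We Wm :: real
  assumes "\<omega> > 0" and "\<mu>0 > 0" and "\<epsilon>0 > 0" and "R1 > 0"
    and "k0 = \<omega> * sqrt (\<mu>0 * \<epsilon>0)"
    and "k1 = of_real \<omega> * csqrt (of_real \<mu>0 * \<epsilon>1)"
    and "Re k1 > 0" and "Im k1 > 0"
    and "orthonormal_spherical_harmonics Y"
    and "n \<ge> 1" and "- int n \<le> m" and "m \<le> int n" and "l \<in> {1, 2}"
    and "E = E_field Y \<omega> \<mu>0 k0 k1 R1 (v_star Y k1 R1 n m l)"
    and "H = H_field Y \<omega> \<mu>0 k0 k1 R1 (v_star Y k1 R1 n m l)"
    and "We = Re \<epsilon>1 / 4 * (LINT r:{r. 0 < norm r \<and> norm r < R1}|lborel. (norm (E r))\<^sup>2)"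
    and "Wm = \<mu>0 / 4 * (LINT r:{r. 0 < norm r \<and> norm r < R1}|lborel. (norm (H r))\<^sup>2)"
  shows "We = Re \<epsilon>1 / 4 * \<omega>\<^sup>2 * \<mu>0\<^sup>2 *
           ((cmod (F_coeff k0 k1 R1 n l))\<^sup>2 + (1 / (4 * Re k1 * Im k1))\<^sup>2
            + Re (F_coeff k0 k1 R1 n l * I_jj k1 R1 n l)
              / (2 * Re k1 * Im k1 * I_jjs k1 R1 n l))
       \<and> Wm = \<mu>0 / 4 *
           (((cmod (k1 * F_coeff k0 k1 R1 n l))\<^sup>2 + (cmod (k1 / of_real (4 * Re k1 * Im k1)))\<^sup>2)
              * (I_jjs k1 R1 n (3 - l) / I_jjs k1 R1 n l)
            + Re (k1\<^sup>2 * F_coeff k0 k1 R1 n l * I_jj k1 R1 n (3 - l))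
              / (2 * Re k1 * Im k1 * I_jjs k1 R1 n l))"
proof -
  define P where "P n m = (SOME p. harm_poly n p \<and> (\<forall>x. norm x = 1 \<longrightarrow> Y n m x = p x))" for n m
  have Y: "spherical_harmonic n (Y n m)" if "m \<in> {- int n..int n}" for n m
    using assms(9) that unfolding orthonormal_spherical_harmonics_def by blast
  have P: "harm_poly n (P n m) \<and> (\<forall>x. norm x = 1 \<longrightarrow> Y n m x = P n m x)" if nm: "m \<in> {- int n..int n}" for n m
    unfolding P_def by (rule someI_ex[OF harm_poly_of_spherical_harmonic[OF Y[OF nm]]])
  interpret lossy_ball k1 R1 k0 Y P
  proof
    fix n n' :: nat and m m' :: int
    assume m: "m \<in> {- int n..int n}" "m' \<in> {- int n'..int n'}"
    \<comment> \<open>\<open>Y\<close> and \<open>P\<close> agree on the unit sphere and may differ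
      elsewhere, so orthonormality is transferred by the congruence for sphere integrals.\<close>
    have "sphere_integral (\<lambda>x. Y n m x * cnj (Y n' m' x)) = sphere_integral (\<lambda>x. P n m x * cnj (P n' m' x))"
    proof (rule sphere_integral_cong)
      show "continuous_on UNIV (\<lambda>x. P n m x * cnj (P n' m' x))"
        using P[OF m(1)] P[OF m(2)] by (intro continuous_intros continuous_on_complex_poly harm_polyD(1)) auto
    qed (use P[OF m(1)] P[OF m(2)] in auto)
    moreover have "sphere_integral (\<lambda>x. Y n m x * cnj (Y n' m' x)) = (if n = n' \<and> m = m' then 1 else 0)"
      using assms(9) m unfolding orthonormal_spherical_harmonics_def by blast
    ultimately show "sphere_integral (\<lambda>x. P n m x * cnj (P n' m' x)) = (if n = n' \<and> m = m' then 1 else 0)"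
      by (simp only:)
  qed (use assms(4,7,8) P in auto)
  have m: "m \<in> {- int n..int n}" using assms(11,12) by simp
  show ?thesis
    unfolding assms(14-17) stored_energies[OF m assms(10,13,1,2)] by (simp add: mult.assoc)
qed

end
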